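(* Let $\mathbb{F}_q$ be a fixed finite field of odd cardinality $q$. For every even natural number $k$ we have $$\frac{1}{\#\mathcal{H}_{2g+1,q}}\sum_{D\in\mathcal{H}_{2g+1,q}}L(\tfrac{1}{2},\chi_{D})^{k}\gg_{k}(\log_{q}|D|)^{k(k+1)/2},$$ where on the right-hand side $|D|=q^{2g+1}$, so that $\log_q|D|=2g+1$. That is, for every even positive integer $k$ there is a constant $c>0$, depending only on $k$ and the fixed $q$, such that for all sufficiently large $g$ the left-hand side is at least $c\,(2g+1)^{k(k+1)/2}$.
   Context: Let $A=\mathbb{F}_q[T]$, with $q$ a fixed odd prime power. For nonzero $f\in A$ put $|f|=q^{\deg f}$. For an integer $g\ge 1$, let $$\mathcal{H}_{2g+1,q}=\{D\in A : D \text{ square-free, monic, } \deg D=2g+1\}.$$ The function $D\mapsto |D|=q^{2g+1}$ is constant on $\mathcal{H}_{2g+1,q}$. For $D\in\mathcal{H}_{2g+1,q}$, the quadratic character $\chi_D$ is $\chi_D(f)=\left(\frac{D}{f}\right)$ for monic $f\in A$, where $\left(\frac{D}{f}\right)$ is the quadratic residue symbol in $A$. For $P$ monic irreducible, $\chi_D(P)=0$ if $P\mid D$, $\chi_D(P)=1$ if $P\nmid D$ and $D$ is a square modulo $P$, and $\chi_D(P)=-1$ if $P\nmid D$ and $D$ is not a square modulo $P$; it is extended completely multiplicatively to all monic $f$, with $\chi_D(1)=1$. The associated $L$-function is $L(s,\chi_D)=\sum_{f \text{ monic}}\chi_D(f)|f|^{-s}$ for $\mathrm{Re}(s)>1$.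 It is a polynomial of degree $2g$ in $q^{-s}$, namely $$L(s,\chi_D)=\sum_{n=0}^{2g}\ \sum_{\substack{f\text{ monic}\\ \deg f=n}}\chi_D(f)\,q^{-ns},$$ and this formula defines $L(s,\chi_D)$ for all $s\in\mathbb{C}$, in particular at $s=\tfrac12$. *)

theory Defs
  imports
    "HOL-Analysis.Analysis"
    "HOL-Computational_Algebra.Computational_Algebra"
    "HOL-Number_Theory.Cong"
begin

text \<open>
  \<open>\<bbbF>\<^sub>q\<close> is an arbitrary finite field, given as a type \<open>'a :: {field, finite}\<close> with
  \<open>q = CARD('a)\<close>, and \<open>A = \<bbbF>\<^sub>q[T]\<close> is \<open>'a poly\<close>. The sort does not include
  \<^class>\<open>field_gcd\<close>, so \<^const>\<open>prime_factorization\<close> and \<^const>\<open>multiplicity\<close> are not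
  available on \<open>'a poly\<close>, while \<^const>\<open>irreducible\<close>, \<^const>\<open>squarefree\<close> and \<^const>\<open>cong\<close> are.
\<close>

definition monic :: "'a::{field,finite} poly \<Rightarrow> bool" where
  "monic f \<longleftrightarrow> lead_coeff f = 1"

definition monic_polys :: "nat \<Rightarrow> 'a::{field,finite} poly set" where
  "monic_polys n = {f. monic f \<and> degree f = n}"

text \<open>The family \<open>\<H>\<^bsub>n,q\<^esub>\<close> for \<open>n = 2 * g + 1\<close>.\<close>

definition hyperelliptic_family :: "nat \<Rightarrow> 'a::{field,finite} poly set" where
  "hyperelliptic_family n = {D. squarefree D \<and> monic D \<and> degree D = n}"

definition quad_symbol :: "'a::{field,finite} poly \<Rightarrow> 'a poly \<Rightarrow> int" where
  "quad_symbol D P =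
     (if P dvd D then 0 else if \<exists>h. [D = h ^ 2] (mod P) then 1 else - 1)"

text \<open>The exponent of \<open>P\<close> in \<open>f\<close>; the set is finite when \<open>f \<noteq> 0\<close> and \<open>P\<close> is not constant.\<close>

definition poly_multiplicity :: "'a::{field,finite} poly \<Rightarrow> 'a poly \<Rightarrow> nat" where
  "poly_multiplicity P f = Max {n. P ^ n dvd f}"

text \<open>
  The completely multiplicative extension of \<open>P \<mapsto> quad_symbol D P\<close> from the monic irreducible
  polynomials to the monic ones; only the values at monic \<open>f\<close> are meaningful.
\<close>

definition quad_char :: "'a::{field,finite} poly \<Rightarrow> 'a poly \<Rightarrow> int" where
  "quad_char D f =
     (\<Prod>P | monic P \<and> irreducible P \<and> P dvd f. quad_symbol D P ^ poly_multiplicity P f)"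

text \<open>
  \<open>L(s, \<chi>\<^sub>D)\<close> as a polynomial in \<open>q\<^bsup>-s\<^esup>\<close>, for \<open>D\<close> of odd degree \<open>2 * g + 1\<close>, so that
  \<open>degree D - 1 = 2 * g\<close>.
\<close>

definition L_quad :: "complex \<Rightarrow> 'a::{field,finite} poly \<Rightarrow> complex" where
  "L_quad s D =
     (\<Sum>n = 0..degree D - 1. \<Sum>f\<in>monic_polys n.
        of_int (quad_char D f) * of_nat CARD('a) powr (- (of_nat n * s)))"

lemma finite_polys_degree_le: "finite {f :: 'a::{field,finite} poly. degree f \<le> n}"
proof (rule finite_subset)
  show "{f :: 'a poly. degree f \<le> n} \<subseteq> Poly ` {xs. set xs \<subseteq> UNIV \<and> length xs \<le> Suc n}"
  proof
    fix f :: "'a poly"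
    assume "f \<in> {f. degree f \<le> n}"
    then have "length (coeffs f) \<le> Suc n"
      by (cases "f = 0") (auto simp: length_coeffs_degree)
    then show "f \<in> Poly ` {xs. set xs \<subseteq> UNIV \<and> length xs \<le> Suc n}"
      by (intro image_eqI[of _ _ "coeffs f"]) auto
  qed
  show "finite (Poly ` {xs :: 'a list. set xs \<subseteq> UNIV \<and> length xs \<le> Suc n})"
    by (intro finite_imageI finite_lists_length_le) auto
qed

lemma finite_monic_polys: "finite (monic_polys n)"
  by (rule finite_subset[OF _ finite_polys_degree_le[of n]]) (auto simp: monic_polys_def)

lemma finite_hyperelliptic_family: "finite (hyperelliptic_family n)"
  by (rule finite_subset[OF _ finite_polys_degree_le[of n]]) (auto simp: hyperelliptic_family_def)

lemma finite_monic_irreducible_divisors: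
  assumes "f \<noteq> 0"
  shows "finite {P. monic P \<and> irreducible P \<and> P dvd f}"
  by (rule finite_subset[OF _ finite_polys_degree_le[of "degree f"]])
     (use assms in \<open>auto intro: dvd_imp_degree_le\<close>)

lemma monic_dvd_imp_eq:
  assumes "monic P" "monic Q" "irreducible P" "irreducible Q" "Q dvd P"
  shows "Q = P"
proof -
  obtain r where r: "P = Q * r"
    using assms(5) by blast
  then have "Q dvd 1 \<or> r dvd 1"
    using assms(3) by (intro irreducibleD)
  then have "r dvd 1"
    using assms(4) by (auto simp: irreducible_def)
  then obtain c where c: "r = [:c:]"
    by (auto simp: is_unit_poly_iff)
  have "lead_coeff P = lead_coeff Q * lead_coeff r"
    using r by (simp add: lead_coeff_mult)
  then have "c = 1"
    using assms c by (simp add: monic_def)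
  with r c show ?thesis
    by (simp add: one_pCons)
qed

lemma finite_powers_dvd:
  fixes P f :: "'a::{field,finite} poly"
  assumes "irreducible P" "f \<noteq> 0"
  shows "finite {n. P ^ n dvd f}"
proof (rule finite_subset)
  have nu: "\<not> is_unit P" "P \<noteq> 0"
    using assms(1) by (auto simp: irreducible_def)
  then have deg: "degree P > 0"
    by (metis is_unit_iff_degree neq0_conv)
  show "{n. P ^ n dvd f} \<subseteq> {..degree f}"
  proof
    fix n
    assume "n \<in> {n. P ^ n dvd f}"
    then have "degree (P ^ n) \<le> degree f"
      using assms(2) by (auto intro: dvd_imp_degree_le)
    moreover have "degree (P ^ n) = n * degree P"
      using nu by (simp add: degree_power_eq)
    moreover have "n * 1 \<le> n * degree P"
      using deg by (intro mult_le_mono2) simp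
    ultimately show "n \<in> {..degree f}"
      unfolding atMost_iff by linarith
  qed
qed simp

lemma poly_multiplicity_eqI:
  fixes P f :: "'a::{field,finite} poly"
  assumes "P ^ n dvd f" "\<not> P ^ Suc n dvd f"
  shows "poly_multiplicity P f = n"
proof -
  have "m \<le> n" if "P ^ m dvd f" for m
  proof (rule ccontr)
    assume "\<not> m \<le> n"
    then have "P ^ Suc n dvd P ^ m"
      by (intro le_imp_power_dvd) simp
    with that assms(2) show False
      using dvd_trans by blast
  qed
  then show ?thesis
    unfolding poly_multiplicity_def using assms(1)
    by (intro Max_eqI) (auto intro: finite_subset[of _ "{..n}"])
qed

lemma poly_multiplicity_decomp:
  fixes P f :: "'a::{field,finite} poly"
  assumes "irreducible P" "f \<noteq> 0"
  obtains f' where "f = P ^ poly_multiplicity P f * f'" "\<not> P dvd f'"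
proof -
  note fin = finite_powers_dvd[OF assms]
  have "0 \<in> {n. P ^ n dvd f}"
    by simp
  then have "{n. P ^ n dvd f} \<noteq> {}"
    by blast
  with fin have "poly_multiplicity P f \<in> {n. P ^ n dvd f}"
    unfolding poly_multiplicity_def by (rule Max_in)
  then obtain f' where f': "f = P ^ poly_multiplicity P f * f'"
    by blast
  moreover have "\<not> P dvd f'"
  proof
    assume "P dvd f'"
    then have "P ^ poly_multiplicity P f * P dvd P ^ poly_multiplicity P f * f'"
      by (intro mult_dvd_mono dvd_refl)
    then have "P ^ Suc (poly_multiplicity P f) dvd f"
      by (simp only: f'[symmetric] power_Suc2)
    then have "Suc (poly_multiplicity P f) \<le> Max {n. P ^ n dvd f}"
      using fin by (intro Max_ge) auto
    then show False
      by (simp add: poly_multiplicity_def)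
  qed
  ultimately show ?thesis
    using that by blast
qed

lemma poly_multiplicity_mult:
  fixes P f g :: "'a::{field,finite} poly"
  assumes "irreducible P" "f \<noteq> 0" "g \<noteq> 0"
  shows "poly_multiplicity P (f * g) = poly_multiplicity P f + poly_multiplicity P g"
proof -
  have P: "prime_elem P"
    using assms(1) by (rule field_poly_irreducible_imp_prime)
  obtain f' where f': "f = P ^ poly_multiplicity P f * f'" "\<not> P dvd f'"
    using poly_multiplicity_decomp[OF assms(1,2)] .
  obtain g' where g': "g = P ^ poly_multiplicity P g * g'" "\<not> P dvd g'"
    using poly_multiplicity_decomp[OF assms(1,3)] .
  define m where "m = poly_multiplicity P f + poly_multiplicity P g"
  have eq: "f * g = P ^ m * (f' * g')"
  proof -
    have "f * g = (P ^ poly_multiplicity P f * f') * (P ^ poly_multiplicity P g * g')"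
      using f'(1) g'(1) by simp
    then show ?thesis
      by (simp add: m_def power_add mult_ac)
  qed
  have "\<not> P ^ Suc m dvd f * g"
  proof
    assume "P ^ Suc m dvd f * g"
    then have "P ^ m * P dvd P ^ m * (f' * g')"
      by (simp add: eq mult.commute)
    then have "P dvd f' * g'"
      using P by (subst (asm) dvd_mult_cancel_left) auto
    then show False
      using P f'(2) g'(2) prime_elem_dvd_multD by blast
  qed
  moreover have "P ^ m dvd f * g"
    by (simp add: eq)
  ultimately show ?thesis
    unfolding m_def[symmetric] by (intro poly_multiplicity_eqI)
qed

lemma quad_char_1: "quad_char (D :: 'a::{field,finite} poly) 1 = 1"
proof -
  have "{P :: 'a poly. monic P \<and> irreducible P \<and> P dvd 1} = {}"
    by (auto simp: irreducible_def)
  then show ?thesis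
    unfolding quad_char_def by (simp only: prod.empty)
qed

lemma quad_char_irreducible:
  assumes "monic P" "irreducible P"
  shows "quad_char D P = quad_symbol D P"
proof -
  have "{Q. monic Q \<and> irreducible Q \<and> Q dvd P} = {P}"
    using assms monic_dvd_imp_eq by auto
  moreover have "poly_multiplicity P P = 1"
  proof (rule poly_multiplicity_eqI)
    show "\<not> P ^ Suc 1 dvd P"
    proof
      assume "P ^ Suc 1 dvd P"
      then have "P * P dvd P * 1"
        by simp
      then show False
        using assms(2) by (subst (asm) dvd_mult_cancel_left) (auto simp: irreducible_def)
    qed
  qed simp
  ultimately show ?thesis
    by (simp add: quad_char_def)
qed

lemma quad_char_mult:
  assumes "monic f" "monic g"
  shows "quad_char D (f * g) = quad_char D f * quad_char D g"
proof -
  have nz: "f \<noteq> 0" "g \<noteq> 0"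
    using assms by (auto simp: monic_def)
  let ?S = "\<lambda>h. {P. monic P \<and> irreducible P \<and> P dvd h}"
  have ext: "quad_char D h = (\<Prod>P\<in>?S (f * g). quad_symbol D P ^ poly_multiplicity P h)"
    if "h dvd f * g" for h
    unfolding quad_char_def
  proof (rule prod.mono_neutral_left)
    show "finite (?S (f * g))"
      using nz by (intro finite_monic_irreducible_divisors) auto
    show "?S h \<subseteq> ?S (f * g)"
      using that by (auto intro: dvd_trans)
      show "\<forall>P\<in>?S (f * g) - ?S h. quad_symbol D P ^ poly_multiplicity P h = 1"
    proof
      fix P
      assume "P \<in> ?S (f * g) - ?S h"
      then have "poly_multiplicity P h = 0"
        by (intro poly_multiplicity_eqI) auto
      then show "quad_symbol D P ^ poly_multiplicity P h = 1"
        by simp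
    qed
  qed
  have "quad_char D (f * g) =
    (\<Prod>P\<in>?S (f * g). quad_symbol D P ^ poly_multiplicity P f * quad_symbol D P ^ poly_multiplicity P g)"
    unfolding quad_char_def
    by (rule prod.cong) (use nz in \<open>auto simp: poly_multiplicity_mult power_add\<close>)
  also have "\<dots> = quad_char D f * quad_char D g"
    by (simp add: prod.distrib ext)
  finally show ?thesis .
qed

text \<open>At real arguments the \<open>L\<close>-function is real, so taking real parts there loses nothing.\<close>

lemma L_quad_real: "L_quad (of_real x) (D :: 'a::{field,finite} poly) \<in> \<real>"
proof -
  have "complex_of_nat CARD('a) powr (- (of_nat n * of_real x)) \<in> \<real>" for n
  proof -
    have "complex_of_nat CARD('a) powr (- (of_nat n * of_real x)) =
        of_real (real CARD('a)) powr of_real (- (real n * x))"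
      by simp
    also have "\<dots> = of_real (real CARD('a) powr (- (real n * x)))"
      by (rule powr_of_real) simp
    finally show ?thesis
      by simp
  qed
  then show ?thesis
    unfolding L_quad_def
    by (intro sum_in_Reals Reals_mult Reals_of_int)
qed

end

theory Submission
  imports Defs "HOL-Real_Asymp.Real_Asymp"
begin

text \<open>
  Write \<open>K = k * (k + 1) / 2\<close>, \<open>N = 2 * g + 1\<close> and \<open>q = CARD('a)\<close>. The method is that of Rudnick and
  Soundararajan: compare the \<open>L\<close>-value with a short truncation \<open>B(D)\<close> of its Dirichlet series, of
  length \<open>x\<close>, a small fraction of \<open>g\<close>. For even \<open>k\<close> the graph of \<open>a \<mapsto> a ^ k\<close> lies above its tangents
  (\<open>even_power_tangent\<close>), so for every \<open>\<lambda>\<close> the sum of \<open>L ^ k\<close> is at least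
  \<open>k * \<lambda> ^ (k - 1)\<close> times the sum of \<open>L * B ^ (k - 1)\<close> minus \<open>(k - 1) * \<lambda> ^ k\<close> times the sum of \<open>B ^ k\<close>.
  It suffices to bound the mixed moment from below (\<open>mixed_moment_lower\<close>) and the moment of \<open>B\<close> from
  above (\<open>moment_upper\<close>), both by constants times \<open>g ^ K\<close> times the size of the family, and to choose
  \<open>\<lambda>\<close> small.

  Expanding the moments gives sums over \<open>k\<close>-tuples \<open>f\<close> of monic polynomials of
  \<open>|\<Prod>f| ^ (- 1 / 2)\<close> times the sum of \<open>\<chi>\<^sub>D(\<Prod>f)\<close> over the family. If \<open>\<Prod>f\<close> is a square, the inner sum
  counts the \<open>D\<close> prime to it. Such tuples are parametrised by labels \<open>l i j\<close>, \<open>i \<le> j < k\<close>, through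
  \<open>f i = (\<Prod>j. l i j)\<close> with \<open>l i i\<close> counted twice. There are \<open>K\<close> labels, each contributing
  \<open>\<Sum> 1 / |l|\<close>, which is of the order of \<open>g\<close>. The parametrisation is onto
  (\<open>square_product_factorisation\<close>), which gives the upper bound \<open>sum_square_tuples_upper\<close>; it is injective
  where the product of the labels is squarefree (\<open>labels_determined\<close>), and this happens for a positive
  proportion of the labels without small prime factors, which gives the lower bound
  \<open>sum_square_tuples_lower\<close>.

  If \<open>\<Prod>f\<close> is not a square, the inner sum is small (\<open>family_character_sum\<close>), by a sieve and the inequality
  of Polya and Vinogradov. This is enough only if the total degree of the tuple is at most a little
  more than \<open>g\<close>, whereas the Dirichlet polynomial of \<open>L\<close> has length \<open>2 * g\<close>. The functional equation
  halves it: \<open>L\<close> at the central point is the sum of the truncations of lengths \<open>g + 1\<close> and \<open>g\<close>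
  (\<open>L_quad_half\<close>).

  The arithmetic input is thus reciprocity, the functional equation and the inequality of Polya and
  Vinogradov for the quadratic characters of \<open>A\<close>. All three come from one device. The Gauss sum of the
  quadratic form \<open>w \<mapsto> res (v * w\<^sup>2 / m)\<close> on the residues modulo \<open>m\<close> agrees with the Gauss sum of the
  quadratic character (\<open>quad_gauss_eq_char_gauss\<close>) and can be evaluated exactly, sign included, because
  the polynomials of degree below half the degree of \<open>m\<close> form a totally isotropic subspace
  (\<open>quad_gauss_const\<close>). Comparing the values at \<open>P\<close>, \<open>D\<close> and \<open>P * D\<close> gives reciprocity; summing the Gauss
  sum over monic polynomials of a given degree gives the other two (\<open>char_gauss_sum_monic_polys\<close>).
\<close>

section \<open>Monic polynomials and primes\<close>

definition monic_prime :: "'a::{field,finite} poly \<Rightarrow> bool" where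
  "monic_prime P \<longleftrightarrow> monic P \<and> irreducible P"

text \<open>The canonical residues modulo a polynomial of degree \<open>n\<close>. The encoding by coefficients keeps the zero
  polynomial also for \<open>n = 0\<close>, where \<open>degree 0 < n\<close> fails.\<close>

definition polys_below :: "nat \<Rightarrow> 'a::{field,finite} poly set" where
  "polys_below n = {u. \<forall>i\<ge>n. coeff u i = 0}"

lemma polys_below_iff: "u \<in> polys_below n \<longleftrightarrow> u = 0 \<or> degree u < n"
proof
  assume "u \<in> polys_below n"
  then show "u = 0 \<or> degree u < n"
    by (metis (mono_tags, lifting) leading_coeff_0_iff leI polys_below_def mem_Collect_eq)
next
  assume "u = 0 \<or> degree u < n"
  then show "u \<in> polys_below n"
    by (auto simp: polys_below_def coeff_eq_0)
qed

lemma zero_in_polys_below [simp]: "0 \<in> polys_below n"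
  by (simp add: polys_below_iff)

lemma polys_below_0 [simp]: "polys_below 0 = {0}"
  by (auto simp: polys_below_iff)

lemma polys_below_add: "u \<in> polys_below n \<Longrightarrow> v \<in> polys_below n \<Longrightarrow> u + v \<in> polys_below n"
  by (auto simp: polys_below_def)

lemma polys_below_diff: "u \<in> polys_below n \<Longrightarrow> v \<in> polys_below n \<Longrightarrow> u - v \<in> polys_below n"
  by (auto simp: polys_below_def)

lemma polys_below_mono: "m \<le> n \<Longrightarrow> polys_below m \<subseteq> polys_below n"
  by (auto simp: polys_below_def)

lemma polys_below_Suc: "polys_below (Suc n) = (\<lambda>(c, u). pCons c u) ` (UNIV \<times> polys_below n)"
proof (intro equalityI subsetI)
  fix u :: "'a poly" assume u: "u \<in> polys_below (Suc n)"
  obtain c v where cv: "u = pCons c v" by (cases u)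
  then have "v \<in> polys_below n"
    using u by (auto simp: polys_below_def)
  then show "u \<in> (\<lambda>(c, u). pCons c u) ` (UNIV \<times> polys_below n)"
    using cv by auto
next
  fix u :: "'a poly" assume "u \<in> (\<lambda>(c, u). pCons c u) ` (UNIV \<times> polys_below n)"
  then show "u \<in> polys_below (Suc n)"
    by (auto simp: polys_below_def coeff_pCons split: nat.splits)
qed

lemma finite_polys_below [simp]: "finite (polys_below n)"
  by (induction n) (auto simp: polys_below_Suc)

lemma card_polys_below: "card (polys_below n :: 'a::{field,finite} poly set) = CARD('a) ^ n"
proof (induction n)
  case (Suc n)
  have "card (polys_below (Suc n) :: 'a poly set) = card ((UNIV :: 'a set) \<times> (polys_below n :: 'a poly set))"
    unfolding polys_below_Suc by (rule card_image) (auto simp: inj_on_def)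
  then show ?case
    using Suc by (simp add: card_cartesian_product)
qed simp

lemma monic_mult: "monic f \<Longrightarrow> monic g \<Longrightarrow> monic (f * g)"
  by (simp add: monic_def lead_coeff_mult)

lemma monic_1 [simp]: "monic 1"
  by (simp add: monic_def)

lemma monic_power: "monic f \<Longrightarrow> monic (f ^ n)"
  by (induction n) (auto intro: monic_mult)

lemma monic_prod: "(\<And>i. i \<in> S \<Longrightarrow> monic (f i)) \<Longrightarrow> monic (prod f S)"
  by (induction S rule: infinite_finite_induct) (auto intro: monic_mult)

lemma monic_nz: "monic f \<Longrightarrow> f \<noteq> 0"
  by (auto simp: monic_def)

lemma monic_cofactor: "monic (f * g) \<Longrightarrow> monic f \<Longrightarrow> monic g"
  by (simp add: monic_def lead_coeff_mult)

lemma monic_degree_mult: "monic f \<Longrightarrow> monic g \<Longrightarrow> degree (f * g) = degree f + degree g"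
  by (simp add: degree_mult_eq monic_nz)

lemma monic_degree_0: "monic f \<Longrightarrow> degree f = 0 \<Longrightarrow> f = 1"
  by (cases f) (auto simp: monic_def one_pCons split: if_splits)

lemma monic_degree_prod:
  "finite S \<Longrightarrow> (\<And>i. i \<in> S \<Longrightarrow> monic (f i)) \<Longrightarrow> degree (prod f S) = (\<Sum>i\<in>S. degree (f i))"
  by (induction S rule: finite_induct) (auto simp: monic_degree_mult monic_prod)

lemma monic_polys_eq: "monic_polys n = (\<lambda>u. monom 1 n + u) ` polys_below n"
proof (intro equalityI subsetI)
  fix f :: "'a poly" assume f: "f \<in> monic_polys n"
  have "f - monom 1 n \<in> polys_below n"
    using f by (auto simp: polys_below_def monic_polys_def monic_def coeff_eq_0 le_less)
  then show "f \<in> (\<lambda>u. monom 1 n + u) ` polys_below n"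
    by (intro image_eqI[of _ _ "f - monom 1 n"]) auto
next
  fix f :: "'a poly" assume "f \<in> (\<lambda>u. monom 1 n + u) ` polys_below n"
  then obtain u where u: "f = monom 1 n + u" "u \<in> polys_below n" by auto
  have c: "coeff f n = 1" using u by (auto simp: polys_below_def)
  have "degree f \<le> n" using u by (intro degree_le) (auto simp: polys_below_def)
  moreover have "degree f \<ge> n" using c by (intro le_degree) auto
  ultimately show "f \<in> monic_polys n"
    using c by (auto simp: monic_polys_def monic_def)
qed

lemma sum_monic_polys: "(\<Sum>f\<in>monic_polys n. F f) = (\<Sum>u\<in>polys_below n. F (monom 1 n + u))"
  unfolding monic_polys_eq by (subst sum.reindex) (auto simp: inj_on_def)

lemma card_monic_polys: "card (monic_polys n :: 'a::{field,finite} poly set) = CARD('a) ^ n"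
  unfolding monic_polys_eq by (subst card_image) (auto simp: inj_on_def card_polys_below)

lemma monic_prime_degree: "monic_prime P \<Longrightarrow> degree P > 0"
  by (metis irreducible_def is_unit_iff_degree monic_prime_def neq0_conv)

lemma monic_prime_nz: "monic_prime P \<Longrightarrow> P \<noteq> 0"
  by (auto simp: monic_prime_def irreducible_def)

lemma monic_prime_not_1: "monic_prime P \<Longrightarrow> \<not> P dvd 1"
  by (auto simp: monic_prime_def irreducible_def)

lemma monic_prime_prime: "monic_prime P \<Longrightarrow> prime_elem P"
  by (simp add: monic_prime_def field_poly_irreducible_imp_prime)

lemma monic_prime_dvd_mult: "monic_prime P \<Longrightarrow> P dvd a * b \<longleftrightarrow> P dvd a \<or> P dvd b"
  by (simp add: monic_prime_prime prime_elem_dvd_mult_iff)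

lemma monic_prime_dvd_power: "monic_prime P \<Longrightarrow> P dvd a ^ n \<longleftrightarrow> n > 0 \<and> P dvd a"
  using monic_prime_not_1 by (induction n) (auto simp: monic_prime_dvd_mult)

lemma monic_prime_dvd_prod:
  "finite S \<Longrightarrow> monic_prime P \<Longrightarrow> P dvd prod f S \<longleftrightarrow> (\<exists>i\<in>S. P dvd f i)"
proof (induction S rule: finite_induct)
  case empty
  then show ?case by (simp only: prod.empty monic_prime_not_1 bex_empty)
next
  case (insert x S)
  then show ?case by (simp add: monic_prime_dvd_mult)
qed

lemma monic_prime_dvd_monic_prime: "monic_prime P \<Longrightarrow> monic_prime Q \<Longrightarrow> P dvd Q \<longleftrightarrow> P = Q"
  unfolding monic_prime_def by (metis dvd_refl monic_dvd_imp_eq)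

text \<open>A monic divisor of least positive degree is irreducible.\<close>

lemma monic_prime_divisor_exists:
  assumes "degree (f :: 'a::{field,finite} poly) > 0"
  obtains P where "monic_prime P" "P dvd f"
proof -
  have f0: "f \<noteq> 0" using assms by auto
  define S where "S = (\<lambda>n. \<exists>g. g dvd f \<and> degree g > 0 \<and> degree g = n)"
  define n where "n = (LEAST n. S n)"
  have "S (degree f)" unfolding S_def using assms dvd_refl by blast
  then have "S n" unfolding n_def by (rule LeastI)
  then obtain g where g: "g dvd f" "degree g > 0" "degree g = n"
    by (auto simp: S_def)
  have min: "n \<le> degree h" if "h dvd f" "degree h > 0" for h
    unfolding n_def using that by (intro Least_le) (auto simp: S_def)
  have g0: "g \<noteq> 0" using g by auto
  define P where "P = smult (inverse (lead_coeff g)) g"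
  have P: "P dvd f" "degree P = n" "monic P" "P \<noteq> 0"
    using g g0 by (auto simp: P_def monic_def smult_dvd)
  have "irreducible P"
  proof (rule irreducibleI)
    show "\<not> P dvd 1" using P g by (metis is_unit_iff_degree less_numeral_extra(3))
    fix a b assume ab: "P = a * b"
    then have nz: "a \<noteq> 0" "b \<noteq> 0" using P by auto
    then have deg: "degree a + degree b = n" using ab P by (simp add: degree_mult_eq)
    have d: "a dvd f" "b dvd f" using ab P by (auto intro: dvd_trans dvd_mult_left dvd_mult_right)
    have "degree a = 0 \<or> degree b = 0"
      using min[OF d(1)] min[OF d(2)] deg by (cases "degree a"; cases "degree b") auto
    then show "a dvd 1 \<or> b dvd 1"
      using nz is_unit_iff_degree by blast
  qed (use P in auto)
  then show ?thesis using that P by (auto simp: monic_prime_def)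
qed

lemma mod_in_polys_below: "m \<noteq> 0 \<Longrightarrow> u mod m \<in> polys_below (degree m)"
  using degree_mod_less[of m u] by (auto simp: polys_below_iff)

lemma mod_polys_below_eq: "u \<in> polys_below (degree m) \<Longrightarrow> u mod m = u"
  by (auto simp: polys_below_iff mod_poly_less)

lemma polys_below_dvd_imp_0: "u \<in> polys_below (degree m) \<Longrightarrow> m dvd u \<Longrightarrow> u = 0"
  by (metis mod_polys_below_eq mod_eq_0_iff_dvd)

lemma polys_below_eqI: "u \<in> polys_below (degree m) \<Longrightarrow> v \<in> polys_below (degree m) \<Longrightarrow> m dvd u - v \<Longrightarrow> u = v"
  using polys_below_diff polys_below_dvd_imp_0 by fastforce

text \<open>Translation by \<open>1\<close> permutes the field but adds \<open>CARD('a)\<close> to the sum of its elements.\<close>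

lemma of_nat_card_field: "of_nat CARD('a) = (0 :: 'a::{field,finite})"
proof -
  have "(\<Sum>x\<in>UNIV. x + 1 :: 'a) = (\<Sum>x\<in>UNIV. x)"
    by (rule sum.reindex_bij_witness[of _ "\<lambda>x. x - 1" "\<lambda>x. x + 1"]) auto
  then show ?thesis by (simp add: sum.distrib)
qed

lemma two_nonzero:
  assumes "odd CARD('a::{field,finite})"
  shows "(2 :: 'a) \<noteq> 0"
proof
  assume two: "(2 :: 'a) = 0"
  obtain n where "CARD('a) = 2 * n + 1" using assms by (elim oddE)
  then have "of_nat CARD('a) = (2 :: 'a) * of_nat n + 1" by simp
  then show False using two of_nat_card_field[where 'a='a] by simp
qed

section \<open>Quadratic symbols modulo a prime\<close>

lemma quad_symbol_eq_0: "quad_symbol a P = 0 \<longleftrightarrow> P dvd a"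
  by (auto simp: quad_symbol_def)

lemma quad_symbol_mod [simp]: "quad_symbol (a mod P) P = quad_symbol a P"
  by (simp add: quad_symbol_def dvd_mod_iff cong_def)

lemma quad_symbol_range: "quad_symbol a P \<in> {-1, 0, 1}"
  by (auto simp: quad_symbol_def)

lemma quad_symbol_square: "quad_symbol (a ^ 2) P = (if P dvd a ^ 2 then 0 else 1)"
proof -
  have "\<exists>h. [a ^ 2 = h ^ 2] (mod P)" using cong_refl by blast
  then show ?thesis by (simp add: quad_symbol_def)
qed

lemma quad_symbol_eq_1: "quad_symbol a P = 1 \<longleftrightarrow> \<not> P dvd a \<and> (\<exists>h. [a = h ^ 2] (mod P))"
  by (auto simp: quad_symbol_def)

lemma bij_betw_mult_mod:
  assumes P: "monic_prime P" and a: "\<not> P dvd a"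
  shows "bij_betw (\<lambda>u. (a * u) mod P) (polys_below (degree P)) (polys_below (degree P))"
proof -
  have "inj_on (\<lambda>u. (a * u) mod P) (polys_below (degree P))"
  proof (rule inj_onI)
    fix u v assume uv: "u \<in> polys_below (degree P)" "v \<in> polys_below (degree P)" "(a * u) mod P = (a * v) mod P"
    then have "P dvd a * (u - v)" by (simp add: mod_eq_dvd_iff right_diff_distrib)
    then show "u = v" using a uv P polys_below_eqI by (auto simp: monic_prime_dvd_mult)
  qed
  moreover have "(\<lambda>u. (a * u) mod P) ` polys_below (degree P) \<subseteq> polys_below (degree P)"
    using mod_in_polys_below[OF monic_prime_nz[OF P]] by auto
  ultimately show ?thesis
    by (simp add: bij_betw_def endo_inj_surj)
qed

text \<open>A nonzero square in the residue field has the two roots \<open>w\<close> and \<open>- w\<close>, which differ because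
  \<open>2 \<noteq> 0\<close>.\<close>

lemma card_square_roots_mod:
  assumes two: "(2 :: 'a::{field,finite}) \<noteq> 0" and P: "monic_prime (P :: 'a poly)" and u: "u \<in> polys_below (degree P)"
  shows "int (card {w \<in> polys_below (degree P). w ^ 2 mod P = u}) = 1 + quad_symbol u P"
proof (cases "P dvd u")
  case True
  then have u0: "u = 0" using u polys_below_dvd_imp_0 by auto
  have "{w \<in> polys_below (degree P). w ^ 2 mod P = u} = {0}"
    using P polys_below_dvd_imp_0 u0 by (auto simp: mod_eq_0_iff_dvd monic_prime_dvd_power)
  then show ?thesis using True by (simp add: quad_symbol_def)
next
  case nd: False
  show ?thesis
  proof (cases "\<exists>h. [u = h ^ 2] (mod P)")
    case True
    then obtain h where h: "[u = h ^ 2] (mod P)" by auto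
    define w where "w = h mod P"
    have w: "w \<in> polys_below (degree P)" unfolding w_def using mod_in_polys_below monic_prime_nz P by auto
    have wu: "w ^ 2 mod P = u"
      using h u by (simp add: w_def power_mod cong_def mod_polys_below_eq)
    have mw: "- w \<in> polys_below (degree P)" using polys_below_diff[OF _ w, of 0] by simp
    have nw: "\<not> P dvd w"
      using nd wu P by (metis dvd_mod monic_prime_dvd_power pos2 dvd_refl)
    have ne: "w \<noteq> - w"
    proof
      assume "w = - w"
      then have "w + w = 0" by (metis add.right_inverse)
      then have "smult 2 w = 0" by (metis mult_2 numeral_poly mult_smult_left smult_1_left smult_add_left one_add_one)
      then show False using two nw by auto
    qed
    have "{w \<in> polys_below (degree P). w ^ 2 mod P = u} = {w, -w}"
    proof (intro equalityI subsetI)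
      fix v assume "v \<in> {w \<in> polys_below (degree P). w ^ 2 mod P = u}"
      then have v: "v \<in> polys_below (degree P)" "v ^ 2 mod P = w ^ 2 mod P" using wu by auto
      then have "P dvd v ^ 2 - w ^ 2" by (simp add: mod_eq_dvd_iff)
      then have "P dvd (v - w) * (v - (-w))" by (simp add: power2_eq_square algebra_simps)
      then show "v \<in> {w, -w}"
        using v w mw P polys_below_eqI unfolding monic_prime_dvd_mult[OF P] by blast
    qed (use w mw wu in auto)
    moreover have "card {w, -w} = 2" using ne by simp
    ultimately show ?thesis using nd True by (simp add: quad_symbol_def)
  next
    case False
    then have "{w \<in> polys_below (degree P). w ^ 2 mod P = u} = {}"
      by (metis (mono_tags, lifting) Collect_empty_eq cong_def cong_mod_left u mod_polys_below_eq)
    then show ?thesis using False nd by (simp only: card.empty quad_symbol_def) simp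
  qed
qed

lemma sum_card_swap:
  assumes "finite A" "finite B"
  shows "(\<Sum>u\<in>A. card {w \<in> B. R u w}) = (\<Sum>w\<in>B. card {u \<in> A. R u w})"
  using sum.swap[of "\<lambda>u w. if R u w then 1 else 0 :: nat" B A] assms
  by (simp add: sum.inter_filter[symmetric])

text \<open>Every residue is a square root of exactly one residue, so the numbers \<open>1 + quad_symbol u P\<close> of square
  roots add up to the number of residues.\<close>

lemma sum_quad_symbol_eq_0:
  assumes two: "(2 :: 'a::{field,finite}) \<noteq> 0" and P: "monic_prime (P :: 'a poly)"
  shows "(\<Sum>u\<in>polys_below (degree P). quad_symbol u P) = 0"
proof -
  let ?R = "polys_below (degree P) :: 'a poly set"
  have "(\<Sum>u\<in>?R. 1 + quad_symbol u P) = (\<Sum>u\<in>?R. int (card {w \<in> ?R. w ^ 2 mod P = u}))"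
    by (intro sum.cong) (auto simp: card_square_roots_mod[OF two P])
  also have "\<dots> = int (\<Sum>u\<in>?R. card {w \<in> ?R. w ^ 2 mod P = u})"
    by simp
  also have "(\<Sum>u\<in>?R. card {w \<in> ?R. w ^ 2 mod P = u}) = (\<Sum>w\<in>?R. card {u \<in> ?R. w ^ 2 mod P = u})"
    by (rule sum_card_swap) simp_all
  also have "(\<Sum>w\<in>?R. card {u \<in> ?R. w ^ 2 mod P = u}) = (\<Sum>w\<in>?R. 1)"
  proof (rule sum.cong[OF refl])
    fix w assume "w \<in> ?R"
    have "{u \<in> ?R. w ^ 2 mod P = u} = {w ^ 2 mod P}"
      using mod_in_polys_below[OF monic_prime_nz[OF P], of "w ^ 2"] by auto
    then show "card {u \<in> ?R. w ^ 2 mod P = u} = 1" by simp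
  qed
  finally show ?thesis by (simp add: sum.distrib)
qed

text \<open>A factor that is a nonzero square modulo \<open>P\<close> can be moved across the congruence. The case of two
  non-squares is a counting argument: if \<open>a\<close> is a non-square, the symbols of \<open>u\<close> and \<open>a * u\<close> never have
  a positive sum, but summed over all residues they cancel, so they cancel for each \<open>u\<close>.\<close>

lemma quad_symbol_mult:
  assumes two: "(2 :: 'a::{field,finite}) \<noteq> 0" and P: "monic_prime (P :: 'a poly)"
  shows "quad_symbol (a * b) P = quad_symbol a P * quad_symbol b P"
proof -
  let ?R = "polys_below (degree P) :: 'a poly set"
  have sq: "quad_symbol (x * y) P = quad_symbol y P" if x: "quad_symbol x P = 1" for x y
  proof -
    obtain h where h: "[x = h ^ 2] (mod P)" and nx: "\<not> P dvd x"
      using x by (auto simp: quad_symbol_eq_1)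
    have nh: "\<not> P dvd h"
    proof
      assume "P dvd h"
      then have "P dvd h ^ 2" by (simp add: power2_eq_square)
      then show False using h nx cong_dvd_iff by (metis cong_def dvd_mod_iff)
    qed
    have "(\<exists>k. [x * y = k ^ 2] (mod P)) \<longleftrightarrow> (\<exists>k. [y = k ^ 2] (mod P))"
    proof
      assume "\<exists>k. [y = k ^ 2] (mod P)"
      then obtain k where "[y = k ^ 2] (mod P)" by auto
      then have "[x * y = (h * k) ^ 2] (mod P)"
        using h by (metis cong_mult power_mult_distrib)
      then show "\<exists>k. [x * y = k ^ 2] (mod P)" by blast
    next
      assume "\<exists>k. [x * y = k ^ 2] (mod P)"
      then obtain k where k: "[x * y = k ^ 2] (mod P)" by auto
      have "k mod P \<in> (\<lambda>u. (h * u) mod P) ` ?R"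
        using bij_betw_mult_mod[OF P nh] mod_in_polys_below[OF monic_prime_nz[OF P]] by (auto simp: bij_betw_def)
      then obtain w where "k mod P = (h * w) mod P" by auto
      then have "[k = h * w] (mod P)" by (simp add: cong_def)
      then have "[k ^ 2 = h ^ 2 * w ^ 2] (mod P)" by (metis cong_pow power_mult_distrib)
      moreover have "[x * y = h ^ 2 * y] (mod P)" using h by (intro cong_mult) auto
      ultimately have "[h ^ 2 * y = h ^ 2 * w ^ 2] (mod P)"
        using k by (metis cong_sym cong_trans)
      then have "P dvd h ^ 2 * (y - w ^ 2)"
        by (simp add: cong_def mod_eq_dvd_iff right_diff_distrib)
      then have "P dvd y - w ^ 2" using nh P by (simp add: monic_prime_dvd_mult monic_prime_dvd_power)
      then show "\<exists>k. [y = k ^ 2] (mod P)" by (auto simp: cong_def mod_eq_dvd_iff)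
    qed
    then show ?thesis using nx P by (auto simp: quad_symbol_def monic_prime_dvd_mult)
  qed
  consider "P dvd a \<or> P dvd b" | "quad_symbol a P = 1" | "quad_symbol b P = 1"
    | "quad_symbol a P = -1" "quad_symbol b P = -1" "\<not> P dvd a"
    unfolding quad_symbol_def by presburger
  then show ?thesis
  proof cases
    case 1
    then have "P dvd a * b" by auto
    then have "quad_symbol (a * b) P = 0" by (simp only: quad_symbol_eq_0)
    moreover have "quad_symbol a P = 0 \<or> quad_symbol b P = 0" using 1 by (simp only: quad_symbol_eq_0)
    ultimately show ?thesis by (metis mult_eq_0_iff)
  next
    case 2
    then show ?thesis by (simp add: sq)
  next
    case 3
    then show ?thesis using sq[of b a] by (simp add: mult.commute)
  next
    case 4
    \<comment> \<open>\<open>u \<mapsto> \<chi>(u) + \<chi>(a u)\<close> has sum zero and is nowhere positive.\<close>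
    have le: "quad_symbol u P + quad_symbol (a * u) P \<le> 0" for u
    proof -
      have "quad_symbol (a * u) P = -1" if "quad_symbol u P = 1"
        using sq[OF that, of a] 4 by (simp add: mult.commute)
      moreover have "quad_symbol (a * u) P = 0" if "quad_symbol u P = 0"
        using that by (simp add: quad_symbol_eq_0)
      ultimately show ?thesis
        using quad_symbol_range[of u P] quad_symbol_range[of "a * u" P] by auto
    qed
    have "(\<Sum>u\<in>?R. quad_symbol (a * u) P) = (\<Sum>u\<in>?R. quad_symbol u P)"
      using sum.reindex_bij_betw[OF bij_betw_mult_mod[OF P 4(3)], of "\<lambda>u. quad_symbol u P"]
      by (simp only: quad_symbol_mod)
    then have "(\<Sum>u\<in>?R. quad_symbol u P + quad_symbol (a * u) P) = 0"
      using sum_quad_symbol_eq_0[OF two P] by (simp add: sum.distrib)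
    then have "\<forall>u\<in>?R. quad_symbol u P + quad_symbol (a * u) P = 0"
      using sum_nonneg_eq_0_iff[of ?R "\<lambda>u. - (quad_symbol u P + quad_symbol (a * u) P)"] le
      unfolding sum_negf neg_equal_0_iff_equal neg_0_le_iff_le by simp
    then have "quad_symbol (b mod P) P + quad_symbol (a * (b mod P)) P = 0"
      by (rule bspec) (rule mod_in_polys_below[OF monic_prime_nz[OF P]])
    moreover have "quad_symbol (a * (b mod P)) P = quad_symbol (a * b) P"
      by (metis mod_mult_right_eq quad_symbol_mod)
    ultimately have "quad_symbol b P + quad_symbol (a * b) P = 0" by (simp only: quad_symbol_mod)
    then have "quad_symbol (a * b) P = - quad_symbol b P" by (simp only: eq_neg_iff_add_eq_0 add.commute)
    then show ?thesis by (simp only: 4(1) mult_minus1)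
  qed
qed

section \<open>A non-trivial additive character\<close>

text \<open>Let \<open>H\<close> be a maximal proper additive subgroup and \<open>a \<notin> H\<close>. Every element is congruent to some \<open>k * a\<close>
  modulo \<open>H\<close>, with \<open>k\<close> unique modulo the least \<open>p > 0\<close> for which \<open>p * a \<in> H\<close>; the character sends it
  to \<open>exp (2 * pi * \<i> * k / p)\<close>.\<close>

lemma additive_character_exists:
  obtains \<psi> :: "'a::{field,finite} \<Rightarrow> complex"
  where "\<And>x y. \<psi> (x + y) = \<psi> x * \<psi> y" "\<exists>x. \<psi> x \<noteq> 1" "\<And>x. norm (\<psi> x) = 1"
proof -
  define sg :: "'a set \<Rightarrow> bool" where
    "sg H \<longleftrightarrow> 0 \<in> H \<and> (\<forall>x\<in>H. \<forall>y\<in>H. x - y \<in> H)" for H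
  define S where "S = {H. sg H \<and> H \<noteq> UNIV}"
  have "(1 :: 'a) \<notin> {0}" by simp
  then have "{0 :: 'a} \<noteq> UNIV" by blast
  then have S0: "{0} \<in> S"
    by (simp add: S_def sg_def)
  have "finite S" by simp
  then obtain H where H: "H \<in> S" and max: "\<And>H'. H' \<in> S \<Longrightarrow> H \<subseteq> H' \<Longrightarrow> H' = H"
    using finite_has_maximal[of S] S0 by (metis empty_iff)
  have sub: "sg H" "H \<noteq> UNIV" using H by (auto simp: S_def)
  have H0: "0 \<in> H" and Hd: "\<And>x y. x \<in> H \<Longrightarrow> y \<in> H \<Longrightarrow> x - y \<in> H"
    using sub by (auto simp: sg_def)
  have Hm: "x \<in> H \<Longrightarrow> - x \<in> H" for x using Hd[OF H0, of x] by simp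
  have Ha: "x + y \<in> H" if "x \<in> H" "y \<in> H" for x y
    using Hd[OF that(1) Hm[OF that(2)]] by simp
  have Hk: "of_int k * x \<in> H" if "x \<in> H" for k x
  proof (induction k rule: int_induct[where k=0])
    case base then show ?case using H0 by simp
  next
    case (step1 i) then show ?case using Ha[OF step1(2) that] by (simp add: algebra_simps)
  next
    case (step2 i) then show ?case using Hd[OF step2(2) that] by (simp add: algebra_simps)
  qed
  obtain a where a: "a \<notin> H" using sub by auto
  \<comment> \<open>By maximality, \<open>H\<close> and \<open>a\<close> generate everything.\<close>
  define H' where "H' = {x. \<exists>k::int. x - of_int k * a \<in> H}"
  have "sg H'"
    unfolding sg_def
  proof (intro conjI ballI)
    show "0 \<in> H'" unfolding H'_def using H0 by (auto intro!: exI[of _ 0])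
    fix x y assume "x \<in> H'" "y \<in> H'"
    then obtain k l :: int where "x - of_int k * a \<in> H" "y - of_int l * a \<in> H"
      by (auto simp: H'_def)
    then have "(x - of_int k * a) - (y - of_int l * a) \<in> H" by (rule Hd)
    then have "(x - y) - of_int (k - l) * a \<in> H" by (simp add: algebra_simps)
    then show "x - y \<in> H'" unfolding H'_def by blast
  qed
  moreover have "H \<subseteq> H'" unfolding H'_def by (auto intro!: exI[of _ 0])
  moreover have "a \<in> H'" unfolding H'_def using H0 by (auto intro!: exI[of _ 1])
  ultimately have "H' = UNIV" using max[of H'] a by (auto simp: S_def)
  then have ex: "\<exists>k::int. x - of_int k * a \<in> H" for x by (auto simp: H'_def)
  define p where "p = (LEAST n. n > 0 \<and> of_nat n * a \<in> H)"
  have "CARD('a) > 0 \<and> of_nat CARD('a) * a \<in> H"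
    using H0 of_nat_card_field[where 'a='a] by simp
  then have p: "p > 0" "of_nat p * a \<in> H" and pmin: "\<And>n. n > 0 \<Longrightarrow> of_nat n * a \<in> H \<Longrightarrow> p \<le> n"
    using LeastI[of "\<lambda>n. n > 0 \<and> of_nat n * a \<in> H"] Least_le[of "\<lambda>n. n > 0 \<and> of_nat n * a \<in> H"]
    unfolding p_def by blast+
  have p1: "p > 1" using p a by (cases "p = 1") auto
  have dvd: "int p dvd k" if "of_int k * a \<in> H" for k :: int
  proof -
    define n where "n = nat (k mod int p)"
    have n: "int n = k mod int p" "n < p" using p by (simp_all add: n_def nat_less_iff)
    have "k = (k div int p) * int p + int n" by (simp add: n)
    then have "of_int k = of_int (k div int p) * of_nat p + (of_nat n :: 'a)"
      by (metis of_int_add of_int_mult of_int_of_nat_eq)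
    then have "of_nat n * a = of_int k * a - of_int (k div int p) * (of_nat p * a)"
      by (simp add: algebra_simps)
    also have "\<dots> \<in> H" by (intro Hd that Hk p)
    finally have "n = 0" using pmin[of n] n(2) by (cases "n = 0") auto
    then show ?thesis using n(1) by (simp add: dvd_eq_mod_eq_0)
  qed
  define \<kappa> :: "'a \<Rightarrow> int" where "\<kappa> x = (SOME k. x - of_int k * a \<in> H)" for x
  have \<kappa>: "x - of_int (\<kappa> x) * a \<in> H" for x
    unfolding \<kappa>_def using someI_ex[OF ex] .
  define \<psi> where "\<psi> x = cis (2 * pi * of_int (\<kappa> x) / of_nat p)" for x
  have "\<psi> (x + y) = \<psi> x * \<psi> y" for x y
  proof -
    have "(x - of_int (\<kappa> x) * a) + (y - of_int (\<kappa> y) * a) - (x + y - of_int (\<kappa> (x + y)) * a) \<in> H"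
      by (intro Hd Ha \<kappa>)
    then have "of_int (\<kappa> (x + y) - (\<kappa> x + \<kappa> y)) * a \<in> H" by (simp add: algebra_simps)
    then obtain m where "\<kappa> (x + y) - (\<kappa> x + \<kappa> y) = int p * m" using dvd by blast
    then have "\<kappa> (x + y) = \<kappa> x + \<kappa> y + int p * m" by simp
    then have "2 * pi * of_int (\<kappa> (x + y)) / of_nat p =
        2 * pi * of_int (\<kappa> x) / of_nat p + 2 * pi * of_int (\<kappa> y) / of_nat p + 2 * pi * of_int m"
      using p by (simp add: field_simps)
    then show ?thesis by (simp add: \<psi>_def cis_mult[symmetric])
  qed
  moreover have "\<exists>x. \<psi> x \<noteq> 1"
  proof (intro exI notI)
    assume "\<psi> a = 1"
    then obtain n :: int where "2 * pi * of_int (\<kappa> a) / of_nat p = of_int (2 * n) * pi"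
      by (auto simp: \<psi>_def complex_eq_iff cos_one_2pi_int)
    then have "real_of_int (\<kappa> a) = of_int (n * int p)" using p by (simp add: field_simps)
    then have k: "\<kappa> a = n * int p" by linarith
    have "of_int n * (of_nat p * a) \<in> H" by (intro Hk p)
    then have "a - of_int (\<kappa> a) * a + of_int n * (of_nat p * a) \<in> H" by (intro Ha \<kappa>)
    then show False using a k by (simp add: algebra_simps)
  qed
  moreover have "norm (\<psi> x) = 1" for x by (simp add: \<psi>_def)
  ultimately show ?thesis using that by blast
qed

section \<open>Residues and characters\<close>

text \<open>For monic \<open>m\<close>, the coefficient of \<open>1 / T\<close> in the expansion of \<open>u / m\<close> in powers of \<open>1 / T\<close>. Composed
  with an additive character of the field it gives an additive character modulo \<open>m\<close>.\<close>

definition rho :: "'a::{field,finite} poly \<Rightarrow> 'a poly \<Rightarrow> 'a" where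
  "rho m u = coeff (u mod m) (degree m - 1)"

text \<open>For a set \<open>X\<close> of primes, the quadratic character to the squarefree modulus \<open>\<Prod>X\<close>. Here the modulus is
  at the bottom of the symbol, whereas in \<open>quad_char D\<close> the polynomial \<open>D\<close> is at the top; reciprocity
  relates the two.\<close>

definition chi :: "'a::{field,finite} poly set \<Rightarrow> 'a poly \<Rightarrow> int" where
  "chi X u = (\<Prod>Q\<in>X. quad_symbol u Q)"

definition prime_set :: "'a::{field,finite} poly set \<Rightarrow> bool" where
  "prime_set X \<longleftrightarrow> finite X \<and> (\<forall>Q\<in>X. monic_prime Q)"

lemma rho_add: "rho m (u + v) = rho m u + rho m v"
  by (simp add: rho_def poly_mod_add_left)

lemma rho_0 [simp]: "rho m 0 = 0"
  by (simp add: rho_def)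

lemma rho_polys_below: "u \<in> polys_below (degree m) \<Longrightarrow> rho m u = coeff u (degree m - 1)"
  by (simp add: rho_def mod_polys_below_eq)

lemma rho_mod: "rho m (u mod m) = rho m u"
  by (simp add: rho_def)

lemma rho_cong: "u mod m = v mod m \<Longrightarrow> rho m u = rho m v"
  by (simp add: rho_def)

lemma rho_mult_self [simp]: "rho m (m * u) = 0" "rho m (u * m) = 0"
  by (simp_all add: rho_def)

lemma coeff_monic_mult:
  assumes "monic a" "z \<in> polys_below (Suc j)"
  shows "coeff (a * z) (degree a + j) = coeff z j"
proof (cases "z = 0 \<or> degree z < j")
  case True
  have "degree (a * z) < degree a + j" if "z \<noteq> 0" "degree z < j"
    using that assms(1) by (simp add: degree_mult_eq monic_nz)
  then show ?thesis using True by (cases "z = 0") (auto simp: coeff_eq_0)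
next
  case False
  then have "degree z = j" using assms(2) by (auto simp: polys_below_iff)
  then show ?thesis using coeff_mult_degree_sum[of a z] assms(1) by (simp add: monic_def)
qed

text \<open>Both sides are the coefficient of \<open>1 / T\<close> in \<open>x / m2\<close>.\<close>

lemma rho_mult_left:
  assumes "monic m1" "monic m2"
  shows "rho (m1 * m2) (m1 * x) = rho m2 x"
proof (cases "degree m2 = 0")
  case True
  then have "m2 = 1" using assms monic_degree_0 by blast
  then show ?thesis by (simp add: rho_def)
next
  case False
  have "(m1 * x) mod (m1 * m2) = m1 * (x mod m2)" by simp
  moreover have "degree (m1 * m2) - 1 = degree m1 + (degree m2 - 1)"
    using False assms by (simp add: monic_degree_mult)
  moreover have "x mod m2 \<in> polys_below (Suc (degree m2 - 1))"
    using mod_in_polys_below[OF monic_nz[OF assms(2)]] False by simp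
  ultimately show ?thesis using coeff_monic_mult[OF assms(1)] unfolding rho_def by metis
qed

lemma polys_below_mult_monic: "u \<in> polys_below n \<Longrightarrow> monic f \<Longrightarrow> u * f \<in> polys_below (n + degree f)"
  by (cases "u = 0") (auto simp: polys_below_iff degree_mult_eq monic_nz)

lemma monic_monom [simp]: "monic (monom 1 n)"
  by (simp add: monic_def degree_monom_eq)

text \<open>The Chinese remainder theorem in a form that needs no reduction: \<open>a * D + b * Q\<close> already has degree
  below that of \<open>Q * D\<close>. Injectivity follows from \<open>Q\<close> being prime, surjectivity from counting.\<close>

lemma sum_crt:
  fixes Q D :: "'a::{field,finite} poly"
  assumes Q: "monic_prime Q" and D: "monic D" and nd: "\<not> Q dvd D"
  shows "(\<Sum>u\<in>polys_below (degree (Q * D)). F u) = (\<Sum>a\<in>polys_below (degree Q). \<Sum>b\<in>polys_below (degree D). F (a * D + b * Q))"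
proof -
  have Qm: "monic Q" using Q by (simp add: monic_prime_def)
  let ?h = "\<lambda>(a, b). a * D + b * Q"
  let ?A = "polys_below (degree Q) \<times> polys_below (degree D) :: ('a poly \<times> 'a poly) set"
  have inj: "inj_on ?h ?A"
  proof (rule inj_onI, clarify)
    fix a b a' b' :: "'a poly"
    assume in1: "a \<in> polys_below (degree Q)" "a' \<in> polys_below (degree Q)" and eq: "a * D + b * Q = a' * D + b' * Q"
    have "(a - a') * D = Q * (b' - b)" using eq by (simp add: algebra_simps)
    then have "Q dvd (a - a') * D" by simp
    then have "Q dvd a - a'" using Q nd by (simp add: monic_prime_dvd_mult)
    then have a: "a = a'" using in1 polys_below_eqI by blast
    then have "b * Q = b' * Q" using eq by simp
    then show "a = a' \<and> b = b'" using a monic_prime_nz[OF Q] by simp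
  qed
  have sub: "?h ` ?A \<subseteq> polys_below (degree (Q * D))"
  proof clarify
    fix a b :: "'a poly" assume "a \<in> polys_below (degree Q)" "b \<in> polys_below (degree D)"
    then have "a * D \<in> polys_below (degree Q + degree D)" "b * Q \<in> polys_below (degree D + degree Q)"
      using D Qm by (simp_all add: polys_below_mult_monic)
    then show "a * D + b * Q \<in> polys_below (degree (Q * D))"
      using D Qm by (simp add: monic_degree_mult polys_below_add add.commute)
  qed
  have "card (?h ` ?A) = card (polys_below (degree (Q * D)) :: 'a poly set)"
    using inj D Qm by (simp add: card_image card_polys_below monic_degree_mult power_add card_cartesian_product)
  then have "?h ` ?A = polys_below (degree (Q * D))"
    using sub by (intro card_subset_eq) auto
  then have "(\<Sum>u\<in>polys_below (degree (Q * D)). F u) = (\<Sum>x\<in>?A. F (?h x))"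
    using inj sum.reindex[of ?h ?A F] by (simp add: o_def)
  also have "\<dots> = (\<Sum>(a, b)\<in>?A. F (a * D + b * Q))" by (simp add: case_prod_unfold)
  also have "\<dots> = (\<Sum>a\<in>polys_below (degree Q). \<Sum>b\<in>polys_below (degree D). F (a * D + b * Q))"
    by (rule sum.cartesian_product[symmetric])
  finally show ?thesis .
qed

lemma sum_polys_below_split:
  fixes F :: "'a::{field,finite} poly \<Rightarrow> 'b::comm_monoid_add"
  shows "(\<Sum>u\<in>polys_below (h + j). F u) = (\<Sum>v\<in>polys_below j. \<Sum>y\<in>polys_below h. F (y + monom 1 h * v))"
proof -
  let ?h = "\<lambda>(v, y). y + monom 1 h * v"
  let ?A = "polys_below j \<times> polys_below h :: ('a poly \<times> 'a poly) set"
  have inj: "inj_on ?h ?A"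
  proof (rule inj_onI, clarify)
    fix v y v' y' :: "'a poly"
    assume l: "y \<in> polys_below h" "y' \<in> polys_below h" and eq: "y + monom 1 h * v = y' + monom 1 h * v'"
    have "coeff y i = coeff y' i" for i
      using arg_cong[OF eq, of "\<lambda>p. coeff p i"] l
      by (cases "i < h") (auto simp: coeff_monom_mult polys_below_def)
    then have y: "y = y'" by (simp add: poly_eq_iff)
    then show "v = v' \<and> y = y'" using eq by simp
  qed
  have sub: "?h ` ?A \<subseteq> polys_below (h + j)"
    by (auto simp: polys_below_def coeff_monom_mult)
  have "card (?h ` ?A) = card (polys_below (h + j) :: 'a poly set)"
    using inj by (simp add: card_image card_polys_below power_add card_cartesian_product)
  then have "?h ` ?A = polys_below (h + j)"
    using sub by (intro card_subset_eq) auto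
  then have "(\<Sum>u\<in>polys_below (h + j). F u) = (\<Sum>x\<in>?A. F (?h x))"
    using inj sum.reindex[of ?h ?A F] by (simp add: o_def)
  also have "\<dots> = (\<Sum>(v, y)\<in>?A. F (y + monom 1 h * v))" by (simp add: case_prod_unfold)
  also have "\<dots> = (\<Sum>v\<in>polys_below j. \<Sum>y\<in>polys_below h. F (y + monom 1 h * v))"
    by (rule sum.cartesian_product[symmetric])
  finally show ?thesis .
qed

lemma polys_below_1: "polys_below (Suc 0) = (\<lambda>c. [:c:]) ` UNIV"
  unfolding polys_below_Suc by auto

lemma sum_polys_below_1: "(\<Sum>v\<in>polys_below (Suc 0). F v) = (\<Sum>c\<in>UNIV. F [:c:])"
  unfolding polys_below_1 by (subst sum.reindex) (auto simp: inj_on_def)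

lemma prime_set_insert: "prime_set (insert Q X) \<longleftrightarrow> monic_prime Q \<and> prime_set X"
  by (auto simp: prime_set_def)

lemma prime_set_empty [simp]: "prime_set {}"
  by (simp add: prime_set_def)

lemma monic_Prod: "prime_set X \<Longrightarrow> monic (\<Prod>X)"
  by (rule monic_prod) (auto simp: prime_set_def monic_prime_def)

lemma monic_prime_dvd_Prod: "prime_set X \<Longrightarrow> monic_prime P \<Longrightarrow> P dvd \<Prod>X \<longleftrightarrow> P \<in> X"
  by (auto simp: prime_set_def monic_prime_dvd_prod monic_prime_dvd_monic_prime)

lemma chi_mult:
  assumes "(2 :: 'a::{field,finite}) \<noteq> 0" "prime_set (X :: 'a poly set)"
  shows "chi X (a * b) = chi X a * chi X b"
  unfolding chi_def prod.distrib[symmetric]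
  using assms by (intro prod.cong) (auto simp: quad_symbol_mult prime_set_def)

lemma chi_insert: "finite X \<Longrightarrow> Q \<notin> X \<Longrightarrow> chi (insert Q X) u = quad_symbol u Q * chi X u"
  by (simp add: chi_def)

lemma chi_empty [simp]: "chi {} u = 1"
  by (simp add: chi_def)

lemma chi_eq_0: "finite X \<Longrightarrow> Q \<in> X \<Longrightarrow> Q dvd u \<Longrightarrow> chi X u = 0"
  by (auto simp: chi_def quad_symbol_eq_0 intro!: prod_zero)

lemma quad_symbol_1: "monic_prime P \<Longrightarrow> quad_symbol 1 P = 1"
  using quad_symbol_square[of 1 P] monic_prime_not_1[of P] by simp

lemma chi_1: "prime_set X \<Longrightarrow> chi X 1 = 1"
  by (auto simp: chi_def prime_set_def quad_symbol_1 intro!: prod.neutral)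

lemma abs_chi_le_1: "\<bar>chi X u\<bar> \<le> 1"
  unfolding chi_def abs_prod by (rule prod_le_1) (auto simp: quad_symbol_def)

lemma quad_symbol_cong: "Q dvd u - v \<Longrightarrow> quad_symbol u Q = quad_symbol v Q"
  by (metis mod_eq_dvd_iff quad_symbol_mod)

lemma chi_cong: "(\<And>Q. Q \<in> X \<Longrightarrow> Q dvd u - v) \<Longrightarrow> chi X u = chi X v"
  unfolding chi_def by (intro prod.cong) (auto intro: quad_symbol_cong)

section \<open>Gauss sums\<close>

text \<open>The additive character \<open>\<psi>\<close> is a tool: the results of the locale that do not mention it are freed from it
  at the end.\<close>

locale odd_field =
  fixes \<psi> :: "'a::{field,finite} \<Rightarrow> complex"
  assumes two: "(2 :: 'a) \<noteq> 0"
    and psi_add: "\<psi> (x + y) = \<psi> x * \<psi> y"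
    and psi_nontrivial: "\<exists>x. \<psi> x \<noteq> 1"
    and psi_norm: "norm (\<psi> x) = 1"
begin

definition char_gauss :: "'a poly set \<Rightarrow> 'a poly \<Rightarrow> complex" where
  "char_gauss X v = (\<Sum>u\<in>polys_below (degree (\<Prod>X)). of_int (chi X u) * \<psi> (rho (\<Prod>X) (u * v)))"

definition quad_gauss :: "'a poly \<Rightarrow> 'a poly \<Rightarrow> complex" where
  "quad_gauss m v = (\<Sum>w\<in>polys_below (degree m). \<psi> (rho m (v * w ^ 2)))"

definition tau :: "'a \<Rightarrow> complex" where
  "tau c = (\<Sum>x\<in>UNIV. \<psi> (c * x ^ 2))"

lemma psi_0 [simp]: "\<psi> 0 = 1"
  using psi_add[of 0 0] psi_norm[of 0] by auto

text \<open>Orthogonality. The map \<open>y \<mapsto> \<psi> (rho m (z * y))\<close> is a character of the additive group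
  \<open>polys_below n\<close>, and it is trivial only if no product \<open>z * y\<close> reaches degree \<open>degree m - 1\<close>.\<close>

lemma sum_psi_polys_below:
  assumes m: "monic m" and z: "z \<in> polys_below (degree m)"
  shows "(\<Sum>y\<in>polys_below n. \<psi> (rho m (z * y))) = (if z \<in> polys_below (degree m - n) then of_nat CARD('a) ^ n else 0)"
proof (cases "z \<in> polys_below (degree m - n)")
  case True
  have "\<psi> (rho m (z * y)) = 1" if "y \<in> polys_below n" for y
  proof (cases "z = 0 \<or> y = 0")
    case False
    then have "degree (z * y) < degree m - 1"
      using True that by (auto simp: polys_below_iff degree_mult_eq)
    then have "rho m (z * y) = 0" by (subst rho_polys_below) (auto simp: polys_below_iff coeff_eq_0)
    then show ?thesis by simp
  qed auto
  then show ?thesis using True by (simp add: card_polys_below)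
next
  case False
  then have z0: "z \<noteq> 0" "degree z \<ge> degree m - n" by (auto simp: polys_below_iff)
  then have i: "degree z < degree m" using z by (auto simp: polys_below_iff)
  obtain c0 where c0: "\<psi> c0 \<noteq> 1" using psi_nontrivial by blast
  define t where "t = degree m - 1 - degree z"
  \<comment> \<open>translating by \<open>y0\<close> multiplies the sum by \<open>\<psi> c0\<close>\<close>
  define y0 where "y0 = monom (c0 / lead_coeff z) t"
  have t: "t < n" "degree m - 1 = t + degree z" using i z0 by (auto simp: t_def)
  have y0: "y0 \<in> polys_below n" using t by (auto simp: y0_def polys_below_def)
  have "rho m (z * y0) = coeff (z * y0) (degree m - 1)"
  proof (rule rho_polys_below)
    show "z * y0 \<in> polys_below (degree m)"
      using t i degree_mult_le[of z y0] degree_monom_le[of "c0 / lead_coeff z" t]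
      by (auto simp: polys_below_iff y0_def)
  qed
  also have "\<dots> = c0" using t z0 by (simp add: y0_def coeff_monom_mult mult.commute[of z])
  finally have r: "rho m (z * y0) = c0" .
  have "(\<Sum>y\<in>polys_below n. \<psi> (rho m (z * y))) = (\<Sum>y\<in>polys_below n. \<psi> (rho m (z * (y + y0))))"
    by (rule sum.reindex_bij_witness[of _ "\<lambda>y. y + y0" "\<lambda>y. y - y0"]) (auto simp: polys_below_add polys_below_diff y0)
  also have "\<dots> = (\<Sum>y\<in>polys_below n. \<psi> (rho m (z * y))) * \<psi> c0"
    by (simp add: distrib_left rho_add psi_add r sum_distrib_right)
  finally have "(\<Sum>y\<in>polys_below n. \<psi> (rho m (z * y))) * (1 - \<psi> c0) = 0" by (simp add: algebra_simps)
  then show ?thesis using c0 False by simp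
qed

text \<open>Split off the leading term of \<open>f\<close> and apply orthogonality to the rest. For \<open>n \<ge> degree m\<close> the only
  \<open>u\<close> in the first case is \<open>0\<close>, and the truncated subtraction is harmless.\<close>

lemma sum_psi_monic_polys:
  assumes m: "monic m" and u: "u \<in> polys_below (degree m)"
  shows "(\<Sum>f\<in>monic_polys n. \<psi> (rho m (u * f))) =
    (if u \<in> polys_below (degree m - n) then of_nat CARD('a) ^ n * \<psi> (coeff u (degree m - 1 - n)) else 0)"
proof -
  have "(\<Sum>f\<in>monic_polys n. \<psi> (rho m (u * f))) =
      \<psi> (rho m (u * monom 1 n)) * (\<Sum>y\<in>polys_below n. \<psi> (rho m (u * y)))"
    by (simp add: sum_monic_polys distrib_left rho_add psi_add sum_distrib_left)
  also have "\<dots> = (if u \<in> polys_below (degree m - n) then of_nat CARD('a) ^ n * \<psi> (coeff u (degree m - 1 - n)) else 0)"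
  proof (cases "u \<in> polys_below (degree m - n)")
    case True
    have "rho m (u * monom 1 n) = coeff u (degree m - 1 - n)"
    proof (cases "n < degree m")
      case n: True
      have "u * monom 1 n \<in> polys_below (degree m)"
        using polys_below_mult_monic[OF True, of "monom 1 n"] n by (simp add: degree_monom_eq)
      then show ?thesis using n by (simp add: rho_polys_below mult.commute[of u] coeff_monom_mult)
    next
      case False
      then have "u = 0" using True by simp
      then show ?thesis by simp
    qed
    then show ?thesis using sum_psi_polys_below[OF m u] True by simp
  qed (simp add: sum_psi_polys_below[OF m u])
  finally show ?thesis .
qed

text \<open>By the Chinese remainder theorem. The two extra symbols come from the cofactors in \<open>a * D + b * Q\<close>.\<close>

lemma char_gauss_insert:
  assumes X: "prime_set (insert Q X)" and Q: "Q \<notin> X"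
  shows "char_gauss (insert Q X) v = of_int (quad_symbol (\<Prod>X) Q) * of_int (chi X Q) * char_gauss {Q} v * char_gauss X v"
proof -
  let ?D = "\<Prod>X"
  have Qp: "monic_prime Q" and Xp: "prime_set X" and fin: "finite X" using X by (auto simp: prime_set_def)
  have nd: "\<not> Q dvd ?D" using Q Qp Xp by (simp add: monic_prime_dvd_Prod)
  have mon: "monic Q" "monic ?D" using Qp monic_Prod[OF Xp] by (auto simp: monic_prime_def)
  have ins: "\<Prod>(insert Q X) = Q * ?D" using fin Q by simp
  have c1: "quad_symbol (a * ?D + b * Q) Q = quad_symbol a Q * quad_symbol ?D Q" for a b
    using quad_symbol_cong[of Q "a * ?D + b * Q" "a * ?D"] quad_symbol_mult[OF two Qp] by simp
  have c2: "chi X (a * ?D + b * Q) = chi X b * chi X Q" for a b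
  proof -
    have "chi X (a * ?D + b * Q) = chi X (b * Q)"
      using fin by (intro chi_cong) (auto intro: dvd_prodI dvd_mult)
    then show ?thesis using chi_mult[OF two Xp] by simp
  qed
  have r: "rho (Q * ?D) ((a * ?D + b * Q) * v) = rho Q (a * v) + rho ?D (b * v)" for a b
  proof -
    have "(a * ?D + b * Q) * v = ?D * (a * v) + Q * (b * v)" by (simp add: algebra_simps)
    then have "rho (Q * ?D) ((a * ?D + b * Q) * v) = rho (?D * Q) (?D * (a * v)) + rho (Q * ?D) (Q * (b * v))"
      by (simp only: rho_add mult.commute[of Q ?D])
    then show ?thesis using rho_mult_left[OF mon(2,1)] rho_mult_left[OF mon] by metis
  qed
  have "char_gauss (insert Q X) v = (\<Sum>u\<in>polys_below (degree (Q * ?D)). of_int (chi (insert Q X) u) * \<psi> (rho (Q * ?D) (u * v)))"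
    by (simp only: char_gauss_def ins)
  also have "\<dots> = (\<Sum>a\<in>polys_below (degree Q). \<Sum>b\<in>polys_below (degree ?D).
      (of_int (quad_symbol a Q) * \<psi> (rho Q (a * v))) * (of_int (chi X b) * \<psi> (rho ?D (b * v))) *
      (of_int (quad_symbol ?D Q) * of_int (chi X Q)))"
    unfolding sum_crt[OF Qp mon(2) nd]
    by (intro sum.cong refl) (simp only: chi_insert[OF fin Q] c1 c2 r psi_add of_int_mult, simp only: mult_ac)
  also have "\<dots> = char_gauss {Q} v * char_gauss X v * (of_int (quad_symbol ?D Q) * of_int (chi X Q))"
  proof -
    have "char_gauss {Q} v = (\<Sum>a\<in>polys_below (degree Q). of_int (quad_symbol a Q) * \<psi> (rho Q (a * v)))"
      by (simp add: char_gauss_def chi_def)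
    moreover have "char_gauss X v = (\<Sum>b\<in>polys_below (degree ?D). of_int (chi X b) * \<psi> (rho ?D (b * v)))"
      by (rule char_gauss_def)
    ultimately show ?thesis by (simp only: sum_product, simp only: sum_distrib_right)
  qed
  finally show ?thesis by (simp add: mult_ac)
qed

text \<open>For \<open>v\<close> prime to \<open>Q\<close>, substitute \<open>v * u\<close> for \<open>u\<close>; otherwise both sides vanish.\<close>

lemma char_gauss_prime:
  assumes Q: "monic_prime Q"
  shows "char_gauss {Q} v = of_int (quad_symbol v Q) * char_gauss {Q} 1"
proof (cases "Q dvd v")
  case True
  then have "rho Q (u * v) = 0" for u by (auto simp: rho_def mod_eq_0_iff_dvd[THEN iffD2])
  then have "char_gauss {Q} v = of_int (\<Sum>u\<in>polys_below (degree Q). quad_symbol u Q)"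
    by (simp add: char_gauss_def chi_def)
  then show ?thesis using True sum_quad_symbol_eq_0[OF two Q] by (simp add: quad_symbol_eq_0)
next
  case False
  have "char_gauss {Q} 1 = (\<Sum>u\<in>polys_below (degree Q). of_int (quad_symbol ((v * u) mod Q) Q) * \<psi> (rho Q ((v * u) mod Q)))"
    using sum.reindex_bij_betw[OF bij_betw_mult_mod[OF Q False],
        of "\<lambda>u. of_int (quad_symbol u Q) * \<psi> (rho Q u)"]
    by (simp add: char_gauss_def chi_def)
  also have "\<dots> = of_int (quad_symbol v Q) * char_gauss {Q} v"
    by (simp add: char_gauss_def chi_def rho_mod quad_symbol_mult[OF two Q] sum_distrib_left mult_ac)
  finally have "of_int (quad_symbol v Q) * char_gauss {Q} 1 = of_int (quad_symbol v Q * quad_symbol v Q) * char_gauss {Q} v"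
    by simp
  moreover have "quad_symbol v Q * quad_symbol v Q = 1"
    using False quad_symbol_range[of v Q] by (auto simp: quad_symbol_eq_0)
  ultimately show ?thesis by simp
qed

lemma char_gauss_empty [simp]: "char_gauss {} v = 1"
  by (simp add: char_gauss_def)

text \<open>That this holds also for \<open>v\<close> not prime to the modulus says that the character is primitive.\<close>

lemma char_gauss_eq_chi:
  assumes "prime_set X"
  shows "char_gauss X v = of_int (chi X v) * char_gauss X 1"
proof -
  have "finite X" using assms by (simp add: prime_set_def)
  then show ?thesis using assms
  proof (induction X rule: finite_induct)
    case (insert Q X)
    then have "monic_prime Q" "prime_set X" by (auto simp: prime_set_insert)
    then show ?case
      using insert.IH char_gauss_prime[of Q v] insert.hyps
      by (simp add: char_gauss_insert[OF insert.prems insert.hyps(2)] chi_insert mult_ac)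
  qed simp
qed

lemma sum_psi_prime_0:
  assumes Q: "monic_prime Q" and v: "\<not> Q dvd v"
  shows "(\<Sum>u\<in>polys_below (degree Q). \<psi> (rho Q (v * u))) = 0"
proof -
  have "v mod Q \<noteq> 0" using v by (simp add: mod_eq_0_iff_dvd)
  then have "(\<Sum>u\<in>polys_below (degree Q). \<psi> (rho Q ((v mod Q) * u))) = 0"
    using sum_psi_polys_below[of Q "v mod Q" "degree Q"] mod_in_polys_below[OF monic_prime_nz[OF Q]] Q by (simp add: monic_prime_def)
  moreover have "rho Q ((v mod Q) * u) = rho Q (v * u)" for u
    by (rule rho_cong) (simp add: mod_mult_left_eq)
  ultimately show ?thesis by simp
qed

text \<open>Collect the \<open>w\<close> with the same square \<open>u\<close>: there are \<open>1 + quad_symbol u Q\<close> of them, and the \<open>1\<close>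
  contributes a complete sum of an additive character, which is zero.\<close>

lemma quad_gauss_prime:
  assumes Q: "monic_prime Q" and v: "\<not> Q dvd v"
  shows "quad_gauss Q v = char_gauss {Q} v"
proof -
  let ?R = "polys_below (degree Q)"
  have "char_gauss {Q} v = (\<Sum>u\<in>?R. of_int (1 + quad_symbol u Q) * \<psi> (rho Q (v * u)))"
    using sum_psi_prime_0[OF Q v] by (simp add: char_gauss_def chi_def algebra_simps sum.distrib)
  also have "\<dots> = (\<Sum>u\<in>?R. of_int (int (card {w \<in> ?R. w ^ 2 mod Q = u})) * \<psi> (rho Q (v * u)))"
    by (intro sum.cong refl) (simp only: card_square_roots_mod[OF two Q])
  also have "\<dots> = (\<Sum>u\<in>?R. \<Sum>w\<in>{w \<in> ?R. w ^ 2 mod Q = u}. \<psi> (rho Q (v * (w ^ 2 mod Q))))"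
    by (intro sum.cong refl) simp
  also have "\<dots> = (\<Sum>w\<in>?R. \<psi> (rho Q (v * (w ^ 2 mod Q))))"
    by (rule sum.group) (use mod_in_polys_below[OF monic_prime_nz[OF Q]] in auto)
  also have "\<dots> = quad_gauss Q v"
    unfolding quad_gauss_def by (intro sum.cong refl arg_cong[of _ _ \<psi>] rho_cong) (simp add: mod_mult_right_eq)
  finally show ?thesis by simp
qed

text \<open>The mixed term of \<open>(a * D + b * Q)\<^sup>2\<close> is divisible by \<open>Q * D\<close>.\<close>

lemma quad_gauss_mult:
  assumes Q: "monic_prime Q" and D: "monic D" and nd: "\<not> Q dvd D"
  shows "quad_gauss (Q * D) v = quad_gauss Q (v * D) * quad_gauss D (v * Q)"
proof -
  have Qm: "monic Q" using Q by (simp add: monic_prime_def)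
  have r: "rho (Q * D) (v * (a * D + b * Q) ^ 2) = rho Q (v * D * a ^ 2) + rho D (v * Q * b ^ 2)" for a b
  proof -
    have "v * (a * D + b * Q) ^ 2 = D * (v * D * a ^ 2) + Q * (v * Q * b ^ 2) + (Q * D) * (2 * v * a * b)"
      by (simp add: power2_eq_square algebra_simps)
    then have "rho (Q * D) (v * (a * D + b * Q) ^ 2) =
        rho (D * Q) (D * (v * D * a ^ 2)) + rho (Q * D) (Q * (v * Q * b ^ 2))"
      by (simp only: rho_add rho_mult_self add_0_right mult.commute[of Q D])
    then show ?thesis using rho_mult_left D Qm by metis
  qed
  show ?thesis
    unfolding quad_gauss_def sum_crt[OF Q D nd] r psi_add sum_product ..
qed

text \<open>Both sums agree at primes and factor in the same way. The left-hand side, a sum over a quadratic form, can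
  be evaluated directly; the right-hand side knows the character.\<close>

lemma quad_gauss_eq_char_gauss:
  assumes "prime_set X" "\<And>Q. Q \<in> X \<Longrightarrow> \<not> Q dvd v"
  shows "quad_gauss (\<Prod>X) v = char_gauss X v"
proof -
  have "finite X" using assms by (simp add: prime_set_def)
  then show ?thesis using assms
  proof (induction X arbitrary: v rule: finite_induct)
    case (insert Q X)
    then have Q: "monic_prime Q" and X: "prime_set X" by (auto simp: prime_set_insert)
    let ?D = "\<Prod>X"
    have nd: "\<not> Q dvd ?D" using insert.hyps Q X by (simp add: monic_prime_dvd_Prod)
    have nd': "\<not> R dvd Q" if "R \<in> X" for R
      using that insert.hyps X Q monic_prime_dvd_monic_prime by (metis prime_set_def)
    have "quad_gauss (\<Prod>(insert Q X)) v = quad_gauss Q (v * ?D) * quad_gauss ?D (v * Q)"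
      using insert.hyps quad_gauss_mult[OF Q monic_Prod[OF X] nd] by simp
    also have "quad_gauss Q (v * ?D) = char_gauss {Q} (v * ?D)"
      using nd insert.prems Q by (intro quad_gauss_prime) (auto simp: monic_prime_dvd_mult)
    also have "\<dots> = of_int (quad_symbol ?D Q) * char_gauss {Q} v"
      using char_gauss_prime[OF Q, of v] char_gauss_prime[OF Q, of "v * ?D"] by (simp add: quad_symbol_mult[OF two Q])
    also have "quad_gauss ?D (v * Q) = char_gauss X (v * Q)"
      using nd' insert.prems X by (intro insert.IH) (auto simp: monic_prime_dvd_mult prime_set_def)
    also have "\<dots> = of_int (chi X Q) * char_gauss X v"
      using char_gauss_eq_chi[OF X, of v] char_gauss_eq_chi[OF X, of "v * Q"] by (simp add: chi_mult[OF two X])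
    finally show ?case
      by (simp add: char_gauss_insert[OF insert.prems(1) insert.hyps(2)] mult_ac)
  qed (simp add: quad_gauss_def)
qed

text \<open>Let \<open>e\<close> be the degree of \<open>m\<close> and \<open>h = e div 2\<close>. On the residues modulo \<open>m\<close>, the polynomials of degree
  less than \<open>h\<close> form a totally isotropic subspace for the quadratic form \<open>w \<mapsto> rho m (c * w\<^sup>2)\<close>, since
  their squares have degree less than \<open>e - 1\<close>. Summing over this subspace first leaves only its
  orthogonal complement, which is the subspace itself, together with the line of \<open>T ^ h\<close> if \<open>e\<close> is odd.\<close>

lemma quad_gauss_const:
  assumes m: "monic m" and c: "c \<noteq> 0"
  shows "quad_gauss m [:c:] = of_nat CARD('a) ^ (degree m div 2) * (if odd (degree m) then tau c else 1)"
proof -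
  define e where "e = degree m"
  define h where "h = e div 2"
  define T :: "'a poly" where "T = monom 1 h"
  have eh: "e = h + (e - h)" by (simp add: h_def)
  have y2: "rho m ([:c:] * y ^ 2) = 0" if "y \<in> polys_below h" for y
  proof (cases "y = 0")
    case False
    have "degree y < h" using that False by (simp add: polys_below_iff)
    then have "degree ([:c:] * y ^ 2) < e - 1"
      using degree_power_le[of y 2] degree_smult_le[of c "y ^ 2"] by (simp add: h_def)
    then have "coeff ([:c:] * y ^ 2) (e - 1) = 0" "[:c:] * y ^ 2 \<in> polys_below e"
      by (auto simp only: coeff_eq_0 polys_below_iff)
    then show ?thesis by (simp only: rho_polys_below e_def)
  qed simp
  have inner: "(\<Sum>y\<in>polys_below h. \<psi> (rho m ([:c:] * (y + T * v) ^ 2))) =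
      (if v \<in> polys_below (e - h - h) then of_nat CARD('a) ^ h * \<psi> (rho m ([:c:] * (T * v) ^ 2)) else 0)"
    if v: "v \<in> polys_below (e - h)" for v
  proof -
    define z where "z = smult (2 * c) (T * v)"
    have z: "z \<in> polys_below k \<longleftrightarrow> v \<in> polys_below (k - h)" for k
    proof (cases "v = 0")
      case False
      have "z \<noteq> 0" "degree z = h + degree v"
        using False two c by (auto simp: z_def T_def degree_mult_eq degree_monom_eq)
      then show ?thesis using False by (auto simp: polys_below_iff)
    qed (simp add: z_def)
    have zl: "z \<in> polys_below (degree m)" unfolding z using v by (simp add: e_def)
    have "rho m ([:c:] * (y + T * v) ^ 2) = rho m (z * y) + rho m ([:c:] * (T * v) ^ 2)" if "y \<in> polys_below h" for y
    proof -
      have "z = [:c:] * (T * v) + [:c:] * (T * v)" by (simp add: z_def flip: smult_add_left)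
      then have "[:c:] * (y + T * v) ^ 2 = [:c:] * y ^ 2 + z * y + [:c:] * (T * v) ^ 2"
        by (simp only: power2_eq_square distrib_left distrib_right) (simp only: ac_simps)
      then show ?thesis using y2[OF that] by (simp add: rho_add)
    qed
    then have "(\<Sum>y\<in>polys_below h. \<psi> (rho m ([:c:] * (y + T * v) ^ 2))) =
        (\<Sum>y\<in>polys_below h. \<psi> (rho m (z * y))) * \<psi> (rho m ([:c:] * (T * v) ^ 2))"
      by (simp add: psi_add sum_distrib_right)
    then show ?thesis unfolding sum_psi_polys_below[OF m zl] z e_def[symmetric] by simp
  qed
  have "quad_gauss m [:c:] = (\<Sum>w\<in>polys_below (h + (e - h)). \<psi> (rho m ([:c:] * w ^ 2)))"
    using eh by (simp only: quad_gauss_def e_def[symmetric])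
  also have "\<dots> = (\<Sum>v\<in>polys_below (e - h). \<Sum>y\<in>polys_below h. \<psi> (rho m ([:c:] * (y + T * v) ^ 2)))"
    unfolding T_def by (rule sum_polys_below_split)
  also have "\<dots> = (\<Sum>v\<in>polys_below (e - h). if v \<in> polys_below (e - h - h) then of_nat CARD('a) ^ h * \<psi> (rho m ([:c:] * (T * v) ^ 2)) else 0)"
    by (intro sum.cong refl inner)
  also have "\<dots> = (\<Sum>v\<in>polys_below (e - h - h). of_nat CARD('a) ^ h * \<psi> (rho m ([:c:] * (T * v) ^ 2)))"
  proof (intro sum.mono_neutral_cong_right)
    have "e - h - h \<le> e - h" by simp
    then show "polys_below (e - h - h) \<subseteq> (polys_below (e - h) :: 'a poly set)" by (rule polys_below_mono)
  qed auto
  also have "\<dots> = of_nat CARD('a) ^ h * (if odd e then tau c else 1)"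
  proof (cases "odd e")
    case True
    then have e1: "e = Suc (2 * h)" by (simp add: h_def)
    have "rho m ([:c:] * (T * [:x:]) ^ 2) = c * x ^ 2" for x
    proof -
      have eq: "[:c:] * (T * [:x:]) ^ 2 = monom (c * x ^ 2) (2 * h)"
        by (simp add: T_def power_mult_distrib monom_power smult_monom mult.commute power2_eq_square mult_monom mult_2_right)
      show ?thesis unfolding eq
        by (subst rho_polys_below) (use e1 in \<open>auto simp: polys_below_def e_def\<close>)
    qed
    then show ?thesis using True e1 by (simp add: sum_polys_below_1 tau_def sum_distrib_left)
  next
    case False
    then have "e - h - h = 0" unfolding h_def by presburger
    then show ?thesis using False by simp
  qed
  finally show ?thesis by (simp add: e_def h_def)
qed


section \<open>Quadratic reciprocity and the functional equation\<close>

definition gauss_value :: "nat \<Rightarrow> complex" where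
  "gauss_value e = of_nat CARD('a) ^ (e div 2) * (if odd e then tau 1 else 1)"

text \<open>The Gauss sum depends on the degree of the modulus only.\<close>

lemma char_gauss_1:
  assumes "prime_set X"
  shows "char_gauss X 1 = gauss_value (degree (\<Prod>X))"
proof -
  have "quad_gauss (\<Prod>X) 1 = char_gauss X 1"
    using assms monic_prime_not_1 by (intro quad_gauss_eq_char_gauss) (auto simp: prime_set_def)
  then show ?thesis
    using quad_gauss_const[OF monic_Prod[OF assms], of 1] by (simp add: gauss_value_def one_pCons)
qed

text \<open>Compare the values at the three moduli \<open>P\<close>, \<open>\<Prod>X\<close> and \<open>P * \<Prod>X\<close>.\<close>

lemma reciprocity_gauss_value:
  assumes X: "prime_set X" and P: "monic_prime (P :: 'a poly)" "P \<notin> X"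
  shows "of_int (quad_symbol (\<Prod>X) P * chi X P) * (gauss_value (degree P) * gauss_value (degree (\<Prod>X))) = gauss_value (degree P + degree (\<Prod>X))"
proof -
  let ?D = "\<Prod>X"
  have fin: "finite X" using X by (simp add: prime_set_def)
  have PX: "prime_set (insert P X)" using X P by (simp add: prime_set_insert)
  have "gauss_value (degree P + degree ?D) = char_gauss (insert P X) 1"
    using char_gauss_1[OF PX] fin P monic_degree_mult[of P ?D] monic_Prod[OF X] by (simp add: monic_prime_def)
  also have "\<dots> = of_int (quad_symbol ?D P) * of_int (chi X P) * char_gauss {P} 1 * char_gauss X 1"
    by (rule char_gauss_insert[OF PX P(2)])
  also have "\<dots> = of_int (quad_symbol ?D P * chi X P) * (gauss_value (degree P) * gauss_value (degree ?D))"
    using char_gauss_1[of "{P}"] char_gauss_1[OF X] P by (simp add: prime_set_def)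
  finally show ?thesis by simp
qed

lemma monic_prime_linear: "monic_prime [:c, 1:]"
proof -
  have "irreducible [:c, 1:]" by (rule irreducible_linear_field_poly) simp
  then show ?thesis by (simp add: monic_prime_def monic_def)
qed

text \<open>The previous lemma for the two primes \<open>T\<close> and \<open>T + 1\<close> of odd degree.\<close>

lemma tau_square:
  obtains s :: int where "s \<in> {1, -1}" "of_int s * tau 1 ^ 2 = of_nat CARD('a)"
proof -
  let ?P = "[:0, 1:] :: 'a poly" and ?Q = "[:1, 1:] :: 'a poly"
  have Q: "prime_set {?Q}" "monic_prime ?P" "?P \<notin> {?Q}" by (auto simp: prime_set_def monic_prime_linear)
  have Q': "monic_prime ?Q" by (rule monic_prime_linear)
  have eq: "of_int (quad_symbol ?Q ?P * quad_symbol ?P ?Q) * tau 1 ^ 2 = of_nat CARD('a)"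
    using reciprocity_gauss_value[OF Q] by (simp add: gauss_value_def chi_def power2_eq_square)
  have "\<not> ?P dvd ?Q" "\<not> ?Q dvd ?P" using Q Q' by (auto simp: monic_prime_dvd_monic_prime)
  then have "quad_symbol ?Q ?P * quad_symbol ?P ?Q \<in> {1, -1}"
    by (auto simp: quad_symbol_def)
  then show ?thesis using eq that by blast
qed

lemma norm_tau_square: "norm (tau 1) ^ 2 = of_nat CARD('a)"
proof -
  obtain s :: int where s: "s \<in> {1, -1}" "of_int s * tau 1 ^ 2 = of_nat CARD('a)" by (rule tau_square)
  have "norm (of_int s * tau 1 ^ 2) = real CARD('a)" unfolding s(2) by simp
  then show ?thesis using s(1) by (auto simp: norm_mult norm_power)
qed

lemma tau_nonzero: "tau 1 \<noteq> 0"
  using norm_tau_square by auto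

lemma norm_gauss_value: "norm (gauss_value e) = sqrt (real CARD('a)) ^ e"
proof -
  have nt: "norm (tau 1) = sqrt (real CARD('a))"
    using norm_tau_square by (metis norm_ge_zero of_nat_eq_of_nat_power_cancel_iff real_sqrt_unique)
  have "sqrt (real CARD('a)) ^ e = (sqrt (real CARD('a)) ^ 2) ^ (e div 2) * sqrt (real CARD('a)) ^ (e mod 2)"
    by (simp only: power_mult[symmetric] power_add[symmetric] mult_div_mod_eq)
  then show ?thesis
    by (cases "odd e") (auto simp: gauss_value_def norm_mult norm_power nt odd_iff_mod_2_eq_one)
qed

text \<open>If both degrees are odd, the comparison of the Gauss sums leaves the quotient of \<open>q\<close> by the square of
  \<open>tau 1\<close>, which is \<open>s\<close>; if the degree of \<open>P\<close> is even, it leaves \<open>1\<close>.\<close>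

lemma prime_reciprocity:
  obtains s :: int where "s \<in> {1, -1}"
    "\<And>X P. prime_set X \<Longrightarrow> monic_prime P \<Longrightarrow> odd (degree (\<Prod>X)) \<Longrightarrow> quad_symbol (\<Prod>X) P = s ^ degree P * chi (X :: 'a poly set) P"
proof -
  obtain s :: int where s: "s \<in> {1, -1}" "of_int s * tau 1 ^ 2 = of_nat CARD('a)" by (rule tau_square)
  have "quad_symbol (\<Prod>X) P = s ^ degree P * chi X P"
    if X: "prime_set X" and P: "monic_prime P" and odd: "odd (degree (\<Prod>X))" for X and P :: "'a poly"
  proof (cases "P \<in> X")
    case True
    then have "quad_symbol (\<Prod>X) P = 0" using X P by (simp add: quad_symbol_eq_0 monic_prime_dvd_Prod)
    moreover have "chi X P = 0" using chi_eq_0[of X P P] True X by (simp add: prime_set_def)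
    ultimately show ?thesis by simp
  next
    case False
    define r where "r = quad_symbol (\<Prod>X) P * chi X P"
    have sE: "gauss_value (degree P + degree (\<Prod>X)) = of_int (s ^ degree P) * (gauss_value (degree P) * gauss_value (degree (\<Prod>X)))"
    proof -
      obtain h where h: "degree (\<Prod>X) = 2 * h + 1" using odd by (elim oddE)
      show ?thesis
      proof (cases "even (degree P)")
        case True
        then obtain j where j: "degree P = 2 * j" by (elim evenE)
        have "s ^ (2 * j) = 1" using s(1) by auto
        moreover have "(2 * j + (2 * h + 1)) div 2 = j + h" by simp
        ultimately show ?thesis by (simp add: gauss_value_def j h power_add)
      next
        case False
        then obtain j where j: "degree P = 2 * j + 1" by (elim oddE)
        have sj: "s ^ degree P = s" using s(1) j by auto
        have "(2 * j + 1 + (2 * h + 1)) div 2 = j + h + 1" by simp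
        then have "gauss_value (degree P + degree (\<Prod>X)) = of_nat CARD('a) ^ (j + h) * (of_int s * tau 1 ^ 2)"
          by (simp add: gauss_value_def j h s(2))
        then show ?thesis
          unfolding sj by (simp add: gauss_value_def j h power_add power2_eq_square mult_ac)
      qed
    qed
    have "gauss_value n \<noteq> 0" for n using tau_nonzero by (simp add: gauss_value_def)
    then have "(of_int r :: complex) = of_int (s ^ degree P)"
      using reciprocity_gauss_value[OF X P False] sE unfolding r_def by (metis mult_cancel_right mult_eq_0_iff)
    then have r: "r = s ^ degree P" by (simp only: of_int_eq_iff)
    have "\<not> Q dvd P" if "Q \<in> X" for Q
      using that False X P monic_prime_dvd_monic_prime by (metis prime_set_def)
    then have "chi X P \<noteq> 0"
      using X by (auto simp: chi_def prime_set_def quad_symbol_eq_0)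
    then have "chi X P \<in> {1, -1}" using abs_chi_le_1[of X P] by auto
    then have "chi X P * chi X P = 1" by auto
    then have "r * chi X P = quad_symbol (\<Prod>X) P" by (simp add: r_def mult.assoc)
    then show ?thesis using r by simp
  qed
  then show ?thesis using that s(1) by blast
qed

text \<open>Sum \<open>char_gauss X f\<close> over \<open>f\<close> in two ways. The result exchanges degree \<open>n\<close> with degrees less than
  \<open>degree (\<Prod>X) - n\<close>; estimated trivially it is the inequality of Polya and Vinogradov, and evaluated
  exactly for odd degree it is the functional equation.\<close>

lemma char_gauss_sum_monic_polys:
  assumes X: "prime_set X"
  shows "char_gauss X 1 * of_int (\<Sum>f\<in>monic_polys n. chi X f) = of_nat CARD('a) ^ n *
    (\<Sum>u\<in>polys_below (degree (\<Prod>X) - n). of_int (chi X u) * \<psi> (coeff u (degree (\<Prod>X) - 1 - n)))"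
proof -
  let ?D = "\<Prod>X"
  have "char_gauss X 1 * of_int (\<Sum>f\<in>monic_polys n. chi X f) = (\<Sum>f\<in>monic_polys n. char_gauss X f)"
    by (subst char_gauss_eq_chi[OF X]) (simp add: sum_distrib_left mult.commute)
  also have "\<dots> = (\<Sum>u\<in>polys_below (degree ?D). \<Sum>f\<in>monic_polys n. of_int (chi X u) * \<psi> (rho ?D (u * f)))"
    unfolding char_gauss_def by (rule sum.swap)
  also have "\<dots> = (\<Sum>u\<in>polys_below (degree ?D). if u \<in> polys_below (degree ?D - n)
      then of_int (chi X u) * (of_nat CARD('a) ^ n * \<psi> (coeff u (degree ?D - 1 - n))) else 0)"
    by (intro sum.cong refl) (simp add: sum_distrib_left[symmetric] sum_psi_monic_polys[OF monic_Prod[OF X]])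
  also have "\<dots> = (\<Sum>u\<in>polys_below (degree ?D - n). of_int (chi X u) * (of_nat CARD('a) ^ n * \<psi> (coeff u (degree ?D - 1 - n))))"
    by (intro sum.mono_neutral_cong_right) (use polys_below_mono[of "degree ?D - n" "degree ?D"] in auto)
  finally show ?thesis by (simp add: sum_distrib_left mult_ac)
qed

text \<open>The Gauss sum on the left of the preceding identity has absolute value \<open>q ^ (e / 2)\<close>, where \<open>e\<close> is the
  degree of \<open>\<Prod>X\<close>, and the right-hand side has absolute value at most \<open>q ^ n * q ^ (e - n)\<close>. For \<open>n > e\<close>
  only \<open>u = 0\<close> remains, where the character vanishes.\<close>

lemma sum_chi_bound:
  assumes X: "prime_set (X :: 'a poly set)" "X \<noteq> {}"
  shows "\<bar>real_of_int (\<Sum>f\<in>monic_polys n. chi X f)\<bar> \<le> sqrt (real CARD('a)) ^ degree (\<Prod>X)"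
proof -
  define e where "e = degree (\<Prod>X)"
  define A where "A = (\<Sum>f\<in>monic_polys n. chi X f)"
  define q where "q = real CARD('a)"
  have q: "q > 0" by (simp add: q_def)
  have chi0: "chi X 0 = 0" using X chi_eq_0[of X _ 0] by (auto simp: prime_set_def)
  have t: "norm (of_int (chi X u) * \<psi> (coeff u j)) \<le> (1::real)" for u :: "'a poly" and j
    using abs_chi_le_1[of X u] by (simp add: norm_mult psi_norm)
  have "sqrt q ^ e * \<bar>real_of_int A\<bar> = norm (char_gauss X 1 * of_int A)"
    using char_gauss_1[OF X(1)] by (simp add: norm_mult norm_gauss_value e_def q_def)
  also have "\<dots> \<le> q ^ e"
  proof (cases "n \<le> e")
    case True
    have "norm (char_gauss X 1 * of_int A) \<le> q ^ n * (\<Sum>u\<in>polys_below (e - n). norm (of_int (chi X u) * \<psi> (coeff u (e - 1 - n))))"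
      unfolding A_def char_gauss_sum_monic_polys[OF X(1)] e_def norm_mult[of "of_nat CARD('a) ^ n"]
      by (simp add: norm_power q_def del: norm_mult) (rule norm_sum)
    also have "\<dots> \<le> q ^ n * (\<Sum>u\<in>(polys_below (e - n) :: 'a poly set). 1)"
      using q by (intro mult_left_mono sum_mono t) auto
    also have "\<dots> = q ^ e" using True by (simp add: card_polys_below q_def power_add[symmetric])
    finally show ?thesis .
  next
    case False
    then show ?thesis
      unfolding A_def char_gauss_sum_monic_polys[OF X(1)] using q by (simp add: e_def chi0)
  qed
  also have "\<dots> = sqrt q ^ e * sqrt q ^ e" using q by (simp add: power_mult_distrib[symmetric])
  finally show ?thesis using q by (simp add: A_def e_def q_def)
qed

text \<open>For odd degree of the modulus, \<open>chi X\<close> takes the value \<open>- 1\<close> at some constant. On the right of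
  \<open>char_gauss_sum_monic_polys\<close> the \<open>u\<close> of degree less than \<open>2 * g - n\<close> therefore cancel, and those of
  degree \<open>2 * g - n\<close> are constant multiples of monic polynomials. The root number is \<open>1\<close> because the
  Gauss sums modulo \<open>\<Prod>X\<close> and modulo \<open>T\<close> are \<open>q ^ g * tau 1\<close> and \<open>tau 1\<close>.\<close>

lemma chi_functional_equation:
  assumes X: "prime_set (X :: 'a poly set)" and e: "degree (\<Prod>X) = 2 * g + 1" and n: "n \<le> 2 * g"
  shows "int CARD('a) ^ g * (\<Sum>f\<in>monic_polys n. chi X f) =
    int CARD('a) ^ n * (\<Sum>f\<in>monic_polys (2 * g - n). chi X f)"
proof -
  let ?q = "of_nat CARD('a) :: complex"
  let ?T = "[:0, 1:] :: 'a poly"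
  define j where "j = 2 * g - n"
  define B where "B = (\<Sum>f\<in>monic_polys j. chi X f)"
  define \<eta> where "\<eta> c = quad_symbol [:c:] ?T" for c
  have T: "monic_prime ?T" "prime_set {?T}" by (auto simp: prime_set_def monic_prime_linear)
  have X0: "X \<noteq> {}" using e by auto
  have const_not_dvd: "\<not> Q dvd [:c:]" if "monic_prime Q" "c \<noteq> 0" for Q c
    using that monic_prime_degree[of Q] dvd_imp_degree_le[of Q "[:c:]"] by auto
  have gauss_const: "of_int (chi Y [:c:]) * gauss_value (degree (\<Prod>Y)) = ?q ^ (degree (\<Prod>Y) div 2) * tau c"
    if Y: "prime_set Y" "odd (degree (\<Prod>Y))" and c: "c \<noteq> 0" for Y c
  proof -
    have "quad_gauss (\<Prod>Y) [:c:] = char_gauss Y [:c:]"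
      using Y(1) const_not_dvd[OF _ c] by (intro quad_gauss_eq_char_gauss[OF Y(1)]) (auto simp: prime_set_def)
    then show ?thesis
      using quad_gauss_const[OF monic_Prod[OF Y(1)] c] char_gauss_eq_chi[OF Y(1), of "[:c:]"] char_gauss_1[OF Y(1)] Y(2) by simp
  qed
  have eta: "of_int (\<eta> c) * tau 1 = tau c" if "c \<noteq> 0" for c
    using gauss_const[OF T(2) _ that] by (simp add: \<eta>_def chi_def gauss_value_def)
  have chi_const: "chi X [:c:] = \<eta> c" for c
  proof (cases "c = 0")
    case True
    have "chi X 0 = 0" using X X0 chi_eq_0[of X _ 0] by (auto simp: prime_set_def)
    then show ?thesis using True by (simp add: \<eta>_def quad_symbol_eq_0)
  next
    case False
    have "of_int (chi X [:c:]) * tau 1 = tau c"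
      using gauss_const[OF X _ False] e by (simp add: gauss_value_def)
    then have "(of_int (chi X [:c:]) :: complex) = of_int (\<eta> c)"
      using eta[OF False] tau_nonzero by (metis mult_cancel_right)
    then show ?thesis by (simp only: of_int_eq_iff)
  qed
  have sum_eta_psi: "(\<Sum>c\<in>UNIV. of_int (\<eta> c) * \<psi> c) = tau 1"
    using char_gauss_1[OF T(2)] by (simp add: char_gauss_def gauss_value_def \<eta>_def chi_def sum_polys_below_1 rho_def mod_pCons)
  have sum_eta: "(\<Sum>c\<in>UNIV. \<eta> c) = 0"
    using sum_quad_symbol_eq_0[OF two T(1)] by (simp add: \<eta>_def sum_polys_below_1)
  have "\<exists>c. \<eta> c = -1"
  proof (rule ccontr)
    assume "\<not> ?thesis"
    moreover have "\<eta> c \<in> {-1, 0, 1}" for c unfolding \<eta>_def by (rule quad_symbol_range)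
    ultimately have "\<eta> c \<ge> 0" for c by (metis empty_iff insert_iff zero_le_one order_refl)
    then have "\<forall>c\<in>UNIV. \<eta> c \<ge> 0" by blast
    then have "\<forall>c\<in>UNIV. \<eta> c = 0" using sum_eta sum_nonneg_eq_0_iff[of UNIV \<eta>] by auto
    then have "\<eta> 1 = 0" by blast
    then show False using quad_symbol_1[OF T(1)] by (simp add: \<eta>_def one_pCons)
  qed
  then obtain c0 where c0: "\<eta> c0 = -1" by blast
  then have c00: "c0 \<noteq> 0" by (auto simp: \<eta>_def quad_symbol_def)
  have smult_chi: "chi X (smult c u) = \<eta> c * chi X u" for c u
    using chi_mult[OF two X, of "[:c:]" u] chi_const by simp
  have polys_below_smult: "smult c u \<in> polys_below k" if "u \<in> polys_below k" for c u k
    using that by (simp add: polys_below_def)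
  have zero: "(\<Sum>y\<in>polys_below j. chi X y) = 0"
  proof -
    have "(\<Sum>y\<in>polys_below j. chi X y) = (\<Sum>y\<in>polys_below j. chi X (smult c0 y))"
      by (rule sum.reindex_bij_witness[of _ "smult c0" "smult (inverse c0)"]) (auto simp: polys_below_smult c00)
    then show ?thesis by (simp add: smult_chi c0 sum_negf)
  qed
  have inner: "(\<Sum>y\<in>polys_below j. of_int (chi X (y + monom 1 j * [:c:])) * \<psi> (coeff (y + monom 1 j * [:c:]) j)) =
      of_int B * (of_int (\<eta> c) * \<psi> c)" for c
  proof -
    have "\<psi> (coeff (y + monom 1 j * [:c:]) j) = \<psi> c" if "y \<in> polys_below j" for y
      using that by (simp add: polys_below_def coeff_monom_mult)
    then have 1: "(\<Sum>y\<in>polys_below j. of_int (chi X (y + monom 1 j * [:c:])) * \<psi> (coeff (y + monom 1 j * [:c:]) j)) =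
        of_int (\<Sum>y\<in>polys_below j. chi X (y + monom 1 j * [:c:])) * \<psi> c"
      by (simp add: sum_distrib_right)
    have "(\<Sum>y\<in>polys_below j. chi X (y + monom 1 j * [:c:])) = \<eta> c * B"
    proof (cases "c = 0")
      case True
      then show ?thesis using zero by (simp add: \<eta>_def quad_symbol_eq_0)
    next
      case False
      have "(\<Sum>y\<in>polys_below j. chi X (y + monom 1 j * [:c:])) = (\<Sum>y\<in>polys_below j. chi X (smult c (monom 1 j + y)))"
        by (rule sum.reindex_bij_witness[of _ "smult c" "smult (inverse c)"])
          (auto simp: polys_below_smult False smult_add_right add.commute mult.commute)
      then show ?thesis by (simp add: smult_chi sum_distrib_left B_def sum_monic_polys)
    qed
    then show ?thesis using 1 by simp
  qed
  have "char_gauss X 1 = ?q ^ g * tau 1" using char_gauss_1[OF X] e by (simp add: gauss_value_def)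
  then have "?q ^ g * tau 1 * of_int (\<Sum>f\<in>monic_polys n. chi X f) =
      ?q ^ n * (\<Sum>u\<in>polys_below (2 * g + 1 - n). of_int (chi X u) * \<psi> (coeff u (2 * g - n)))"
    using char_gauss_sum_monic_polys[OF X, of n] e by simp
  also have "2 * g + 1 - n = j + Suc 0" using n by (simp add: j_def)
  also have "(\<Sum>u\<in>polys_below (j + Suc 0). of_int (chi X u) * \<psi> (coeff u (2 * g - n))) = of_int B * tau 1"
    unfolding sum_polys_below_split sum_polys_below_1 j_def[symmetric] inner sum_distrib_left[symmetric] sum_eta_psi ..
  finally have "?q ^ g * of_int (\<Sum>f\<in>monic_polys n. chi X f) = ?q ^ n * of_int B"
    using tau_nonzero by (simp add: mult_ac)
  then have "(of_int (int CARD('a) ^ g * (\<Sum>f\<in>monic_polys n. chi X f)) :: complex) = of_int (int CARD('a) ^ n * B)"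
    by simp
  then show ?thesis by (simp only: of_int_eq_iff B_def j_def)
qed

end

lemma reciprocity:
  assumes "(2 :: 'a::{field,finite}) \<noteq> 0"
  obtains s :: int where "s \<in> {1, -1}"
    "\<And>X P :: 'a poly. prime_set X \<Longrightarrow> monic_prime P \<Longrightarrow> odd (degree (\<Prod>X)) \<Longrightarrow> quad_symbol (\<Prod>X) P = s ^ degree P * chi X P"
proof -
  obtain \<psi> :: "'a \<Rightarrow> complex" where "odd_field \<psi>"
    using additive_character_exists assms unfolding odd_field_def by metis
  then interpret odd_field \<psi> .
  show ?thesis using prime_reciprocity that by blast
qed

lemma functional_equation_chi:
  fixes X :: "'a::{field,finite} poly set"
  assumes two: "(2 :: 'a) \<noteq> 0"
    and X: "prime_set X" "degree (\<Prod>X) = 2 * g + 1" and n: "n \<le> 2 * g"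
  shows "int CARD('a) ^ g * (\<Sum>f\<in>monic_polys n. chi X f) =
    int CARD('a) ^ n * (\<Sum>f\<in>monic_polys (2 * g - n). chi X f)"
proof -
  obtain \<psi> :: "'a \<Rightarrow> complex" where "odd_field \<psi>"
    using additive_character_exists two unfolding odd_field_def by metis
  then interpret odd_field \<psi> .
  show ?thesis using chi_functional_equation[OF X n] .
qed

lemma polya_vinogradov_chi:
  fixes X :: "'a::{field,finite} poly set"
  assumes two: "(2 :: 'a) \<noteq> 0" and X: "prime_set X" "X \<noteq> {}"
  shows "\<bar>real_of_int (\<Sum>f\<in>monic_polys n. chi X f)\<bar> \<le> sqrt (real CARD('a)) ^ degree (\<Prod>X)"
proof -
  obtain \<psi> :: "'a \<Rightarrow> complex" where "odd_field \<psi>"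
    using additive_character_exists two unfolding odd_field_def by metis
  then interpret odd_field \<psi> .
  show ?thesis using sum_chi_bound[OF X] .
qed

section \<open>Prime divisors\<close>

definition prime_divs :: "'a::{field,finite} poly \<Rightarrow> 'a poly set" where
  "prime_divs f = {P. monic_prime P \<and> P dvd f}"

lemma finite_prime_divs [simp]: "f \<noteq> 0 \<Longrightarrow> finite (prime_divs f)"
  using finite_monic_irreducible_divisors[of f] by (simp add: prime_divs_def monic_prime_def conj_assoc)

lemma prime_set_prime_divs: "f \<noteq> 0 \<Longrightarrow> prime_set (prime_divs f)"
  by (simp add: prime_set_def) (simp add: prime_divs_def)

lemma prime_divs_Prod: "prime_set X \<Longrightarrow> prime_divs (\<Prod>X) = X"
  using monic_prime_dvd_Prod[of X] by (auto simp: prime_divs_def) (auto simp: prime_set_def)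

lemma prime_divs_mult:
  "prime_divs (f * g) = prime_divs f \<union> prime_divs g"
  by (auto simp: prime_divs_def monic_prime_dvd_mult)

lemma monic_prime_power_dvd_mult:
  assumes Q: "monic_prime Q" and a: "\<not> Q dvd a"
  shows "Q ^ n dvd a * r \<Longrightarrow> Q ^ n dvd r"
proof (induction n arbitrary: r)
  case (Suc n)
  have "Q dvd a * r" using Suc.prems by (metis dvd_mult_left power_Suc)
  then obtain r' where r: "r = Q * r'" using Q a by (auto simp: monic_prime_dvd_mult)
  then have "Q * Q ^ n dvd Q * (a * r')" using Suc.prems by (simp add: mult_ac)
  then have "Q ^ n dvd a * r'" using monic_prime_nz[OF Q] by simp
  from Suc.IH[OF this] show ?case by (simp add: r)
qed simp

lemma Prod_power_dvd_iff:
  assumes "prime_set T"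
  shows "\<Prod>T ^ n dvd f \<longleftrightarrow> (\<forall>P\<in>T. P ^ n dvd f)"
proof
  assume d: "\<Prod>T ^ n dvd f"
  show "\<forall>P\<in>T. P ^ n dvd f"
  proof
    fix P assume "P \<in> T"
    then have "P dvd \<Prod>T" using assms by (auto simp: prime_set_def intro: dvd_prodI)
    then show "P ^ n dvd f" using d dvd_power_same dvd_trans by blast
  qed
next
  have "finite T" using assms by (simp add: prime_set_def)
  then show "\<forall>P\<in>T. P ^ n dvd f \<Longrightarrow> \<Prod>T ^ n dvd f" using assms
  proof (induction T rule: finite_induct)
    case (insert Q T)
    then have Q: "monic_prime Q" and T: "prime_set T" by (auto simp: prime_set_insert)
    have "\<Prod>T ^ n dvd f" using insert T by simp
    then obtain r where r: "f = \<Prod>T ^ n * r" by (elim dvdE)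
    have "\<not> Q dvd \<Prod>T" using insert.hyps Q T by (simp add: monic_prime_dvd_Prod)
    then have "\<not> Q dvd \<Prod>T ^ n" using Q by (simp add: monic_prime_dvd_power)
    moreover have "Q ^ n dvd \<Prod>T ^ n * r" using insert.prems r by simp
    ultimately have "Q ^ n dvd r" using monic_prime_power_dvd_mult[OF Q] by blast
    then have "\<Prod>T ^ n * Q ^ n dvd f" unfolding r by (intro mult_dvd_mono) auto
    then show ?case using insert.hyps by (simp add: power_mult_distrib mult.commute)
  qed simp
qed

lemma Prod_dvd_iff: "prime_set T \<Longrightarrow> \<Prod>T dvd f \<longleftrightarrow> (\<forall>P\<in>T. P dvd f)"
  using Prod_power_dvd_iff[of T 1 f] by simp

lemma squarefree_iff_monic_prime:
  assumes "f \<noteq> 0"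
  shows "squarefree f \<longleftrightarrow> (\<forall>P. monic_prime P \<longrightarrow> \<not> P ^ 2 dvd f)"
proof
  assume "squarefree f"
  then show "\<forall>P. monic_prime P \<longrightarrow> \<not> P ^ 2 dvd f"
    using monic_prime_not_1 by (auto simp: squarefree_def)
next
  assume *: "\<forall>P. monic_prime P \<longrightarrow> \<not> P ^ 2 dvd f"
  show "squarefree f"
    unfolding squarefree_def
  proof (intro allI impI)
    fix x assume x: "x ^ 2 dvd f"
    then have x0: "x \<noteq> 0" using assms by auto
    show "x dvd 1"
    proof (rule ccontr)
      assume "\<not> x dvd 1"
      then have "degree x > 0" using x0 is_unit_iff_degree by blast
      then obtain P where "monic_prime P" "P dvd x" by (rule monic_prime_divisor_exists)
      then show False using * x by (meson dvd_power_same dvd_trans)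
    qed
  qed
qed

lemma squarefree_eq_Prod:
  assumes m: "monic f" and sf: "squarefree f"
  shows "\<Prod>(prime_divs f) = f"
proof -
  let ?X = "prime_divs f"
  have f0: "f \<noteq> 0" using m by (rule monic_nz)
  have X: "prime_set ?X" by (rule prime_set_prime_divs[OF f0])
  have "\<Prod>?X dvd f" using X by (simp add: Prod_dvd_iff) (simp add: prime_divs_def)
  then obtain r where r: "f = \<Prod>?X * r" by (elim dvdE)
  have rm: "monic r" using monic_cofactor m monic_Prod[OF X] r by metis
  have "degree r = 0"
  proof (rule ccontr)
    assume "degree r \<noteq> 0"
    then obtain P where P: "monic_prime P" "P dvd r" using monic_prime_divisor_exists by blast
    have "P dvd f" by (subst r) (rule dvd_mult[OF P(2)])
    then have "P \<in> ?X" using P by (simp add: prime_divs_def)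
    then have "P dvd \<Prod>?X" using X P by (simp add: monic_prime_dvd_Prod)
    then have "P * P dvd \<Prod>?X * r" using P by (intro mult_dvd_mono)
    then have "P ^ 2 dvd f" using r by (simp add: power2_eq_square)
    then show False using sf f0 P(1) squarefree_iff_monic_prime by blast
  qed
  then show ?thesis using rm r monic_degree_0 by force
qed

lemma monic_induct [consumes 1, case_names one mult]:
  assumes "monic f" "P 1" "\<And>Q g. monic_prime Q \<Longrightarrow> monic g \<Longrightarrow> P g \<Longrightarrow> P (Q * g)"
  shows "P f"
  using assms(1)
proof (induction "degree f" arbitrary: f rule: less_induct)
  case less
  show ?case
  proof (cases "degree f = 0")
    case True
    then show ?thesis using less.prems assms(2) monic_degree_0 by blast
  next
    case False
    then obtain Q where Q: "monic_prime Q" "Q dvd f" using monic_prime_divisor_exists by blast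
    then obtain g where g: "f = Q * g" by (elim dvdE)
    have Qm: "monic Q" using Q(1) by (simp add: monic_prime_def)
    then have gm: "monic g" using less.prems monic_cofactor g by blast
    then have "degree g < degree f" using g Qm monic_prime_degree[OF Q(1)] by (simp add: monic_degree_mult)
    then show ?thesis using assms(3)[OF Q(1) gm] less.hyps gm g by blast
  qed
qed

lemma poly_multiplicity_eq_0: "\<not> P dvd f \<Longrightarrow> poly_multiplicity P f = 0"
  by (intro poly_multiplicity_eqI) auto

lemma poly_multiplicity_pos_iff:
  assumes "monic_prime P" "f \<noteq> 0"
  shows "poly_multiplicity P f > 0 \<longleftrightarrow> P dvd f"
proof
  assume "poly_multiplicity P f > 0"
  moreover obtain f' where "f = P ^ poly_multiplicity P f * f'"
    using poly_multiplicity_decomp[of P f] assms by (auto simp: monic_prime_def)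
  ultimately show "P dvd f" by (metis dvd_mult2 dvd_power)
next
  assume d: "P dvd f"
  obtain f' where "f = P ^ poly_multiplicity P f * f'" "\<not> P dvd f'"
    using poly_multiplicity_decomp[of P f] assms by (auto simp: monic_prime_def)
  then show "poly_multiplicity P f > 0" using d by (cases "poly_multiplicity P f") auto
qed

lemma poly_multiplicity_mult':
  "monic_prime P \<Longrightarrow> monic f \<Longrightarrow> monic g \<Longrightarrow> poly_multiplicity P (f * g) = poly_multiplicity P f + poly_multiplicity P g"
  by (rule poly_multiplicity_mult) (auto simp: monic_prime_def monic_nz)

section \<open>The central value as a short sum\<close>

text \<open>Reciprocity at every prime divisor of \<open>f\<close>. The sign depends only on the degree of \<open>f\<close>, so it does not
  affect the shape of the functional equation.\<close>

lemma quad_char_eq_chi: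
  assumes two: "(2 :: 'a::{field,finite}) \<noteq> 0"
  obtains s :: int where "s \<in> {1, -1}"
    "\<And>D f :: 'a poly. monic D \<Longrightarrow> squarefree D \<Longrightarrow> odd (degree D) \<Longrightarrow> monic f \<Longrightarrow>
       quad_char D f = s ^ degree f * chi (prime_divs D) f"
proof -
  obtain s :: int where s: "s \<in> {1, -1}"
    "\<And>X P :: 'a poly. prime_set X \<Longrightarrow> monic_prime P \<Longrightarrow> odd (degree (\<Prod>X)) \<Longrightarrow> quad_symbol (\<Prod>X) P = s ^ degree P * chi X P"
    using reciprocity[OF two] by blast
  have main: "quad_char D f = s ^ degree f * chi (prime_divs D) f"
    if D: "monic D" "squarefree D" "odd (degree D)" and f: "monic f" for D f :: "'a poly"
  proof -
    have X: "prime_set (prime_divs D)" by (rule prime_set_prime_divs[OF monic_nz[OF D(1)]])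
    have PX: "\<Prod>(prime_divs D) = D" using squarefree_eq_Prod[OF D(1,2)] .
    show ?thesis
      using f
    proof (induction f rule: monic_induct)
      case one
      then show ?case using chi_1[OF X] by (simp add: quad_char_1)
    next
      case (mult Q g)
      have Q: "monic Q" "irreducible Q" using mult(1) by (auto simp: monic_prime_def)
      have "quad_char D Q = s ^ degree Q * chi (prime_divs D) Q"
        using s(2)[OF X mult(1)] PX D(3) quad_char_irreducible[OF Q, of D] by simp
      then show ?case
        using mult.IH Q mult(2)
        by (simp add: quad_char_mult chi_mult[OF two X] monic_degree_mult power_add)
    qed
  qed
  show ?thesis using s(1) main by (rule that)
qed

lemma functional_equation:
  fixes D :: "'a::{field,finite} poly"
  assumes two: "(2 :: 'a) \<noteq> 0"
    and D: "monic D" "squarefree D" "degree D = 2 * g + 1" and n: "n \<le> 2 * g"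
  shows "int CARD('a) ^ g * (\<Sum>f\<in>monic_polys n. quad_char D f) =
    int CARD('a) ^ n * (\<Sum>f\<in>monic_polys (2 * g - n). quad_char D f)"
proof -
  obtain s :: int where s: "s \<in> {1, -1}" "\<And>D f :: 'a poly. monic D \<Longrightarrow> squarefree D \<Longrightarrow> odd (degree D) \<Longrightarrow> monic f \<Longrightarrow>
       quad_char D f = s ^ degree f * chi (prime_divs D) f"
    using quad_char_eq_chi[OF two] by blast
  have c: "(\<Sum>f\<in>monic_polys k. quad_char D f) = s ^ k * (\<Sum>f\<in>monic_polys k. chi (prime_divs D) f)" for k
    using s(2)[OF D(1,2)] D(3) by (simp add: sum_distrib_left monic_polys_def)
  have "s ^ (2 * g - n) = s ^ n"
    using s(1) n by (auto simp: uminus_power_if)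
  then show ?thesis
    using functional_equation_chi[OF two prime_set_prime_divs[OF monic_nz[OF D(1)]] _ n, of] D
    by (simp add: c squarefree_eq_Prod)
qed

definition monics_below :: "nat \<Rightarrow> 'a::{field,finite} poly set" where
  "monics_below y = {f. monic f \<and> degree f < y}"

lemma finite_monics_below [simp]: "finite (monics_below y)"
  by (rule finite_subset[OF _ finite_polys_degree_le[of y]]) (auto simp: monics_below_def)

lemma sum_monics_below:
  fixes F :: "'a::{field,finite} poly \<Rightarrow> 'b::comm_monoid_add"
  shows "(\<Sum>f\<in>monics_below y. F f) = (\<Sum>n<y. \<Sum>f\<in>monic_polys n. F f)"
proof -
  have "monics_below y = (\<Union>n\<in>{..<y}. monic_polys n :: 'a poly set)"
    by (auto simp: monics_below_def monic_polys_def)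
  moreover have "(\<Sum>f\<in>(\<Union>n\<in>{..<y}. monic_polys n). F f) = (\<Sum>n<y. \<Sum>f\<in>monic_polys n. F f)"
    by (rule sum.UNION_disjoint) (simp_all add: finite_monic_polys, auto simp: monic_polys_def)
  ultimately show ?thesis by simp
qed

text \<open>The weight \<open>|f| ^ (- 1 / 2)\<close> of the central point.\<close>

definition wt :: "'a::{field,finite} poly \<Rightarrow> real" where
  "wt f = (1 / sqrt (real CARD('a))) ^ degree f"

text \<open>The Dirichlet series at the central point, cut off at degree \<open>y\<close>.\<close>

definition short_L :: "nat \<Rightarrow> 'a::{field,finite} poly \<Rightarrow> real" where
  "short_L y D = (\<Sum>f\<in>monics_below y. of_int (quad_char D f) * wt f)"

lemma short_L_eq: "short_L y D = (\<Sum>n<y. (1 / sqrt (real CARD('a))) ^ n * of_int (\<Sum>f\<in>monic_polys n. quad_char D f))"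
  for D :: "'a::{field,finite} poly"
  unfolding short_L_def sum_monics_below
  by (intro sum.cong refl) (simp add: wt_def monic_polys_def sum_distrib_left mult.commute)

text \<open>By the functional equation the terms of degrees \<open>n\<close> and \<open>2 * g - n\<close> are equal at the central point, so the
  upper half of the sum repeats the lower half.\<close>

lemma L_quad_half:
  fixes D :: "'a::{field,finite} poly"
  assumes two: "(2 :: 'a) \<noteq> 0"
    and D: "monic D" "squarefree D" "degree D = 2 * g + 1"
  shows "L_quad (1 / 2) D = of_real (short_L (g + 1) D + short_L g D)"
proof -
  define t where "t = 1 / sqrt (real CARD('a))"
  define c where "c n = real_of_int (\<Sum>f\<in>monic_polys n. quad_char D f)" for n
  have q0: "real CARD('a) > 0" by simp
  have t0: "t > 0" using q0 by (simp add: t_def)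
  have tq: "t ^ 2 * real CARD('a) = 1" using q0 by (simp add: t_def power_divide)
  have pw: "of_nat CARD('a) powr (- (of_nat n * (1 / 2))) = complex_of_real (t ^ n)" for n
  proof -
    have "of_nat CARD('a) powr (- (of_nat n * (1 / 2))) = complex_of_real (real CARD('a)) powr complex_of_real (- (real n / 2))"
      by simp
    also have "\<dots> = complex_of_real (real CARD('a) powr (- (real n / 2)))"
      by (rule powr_of_real) simp
    also have "real CARD('a) powr (- (real n / 2)) = (real CARD('a) powr (1 / 2)) powr (- real n)"
      by (simp add: powr_powr)
    also have "\<dots> = t ^ n"
    proof -
      have "sqrt (real CARD('a)) powr real n = sqrt (real CARD('a)) ^ n"
        using q0 by (intro powr_realpow) simp
      then show ?thesis
        using q0 by (simp only: powr_half_sqrt powr_minus_divide t_def power_divide power_one)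
    qed
    finally show ?thesis .
  qed
  have cn: "c (2 * g - n) * t ^ (2 * g - n) = c n * t ^ n" if "n \<le> 2 * g" for n
  proof -
    have "real CARD('a) ^ g * c n = real CARD('a) ^ n * c (2 * g - n)"
      using arg_cong[OF functional_equation[OF two D that], of real_of_int] by (simp add: c_def)
    moreover have "t ^ (2 * g) * t ^ n = t ^ (2 * n) * t ^ (2 * g - n)"
      using that by (simp add: power_add[symmetric] add.commute)
    ultimately have "(t ^ (2 * g) * t ^ n) * (real CARD('a) ^ g * c n) =
        (t ^ (2 * n) * t ^ (2 * g - n)) * (real CARD('a) ^ n * c (2 * g - n))" by simp
    then have "(t ^ (2 * g) * real CARD('a) ^ g) * (c n * t ^ n) =
        (t ^ (2 * n) * real CARD('a) ^ n) * (c (2 * g - n) * t ^ (2 * g - n))" by (simp only: mult_ac)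
    moreover have "t ^ (2 * m) * real CARD('a) ^ m = 1" for m
      using tq by (simp add: power_mult power_mult_distrib[symmetric])
    ultimately show ?thesis by simp
  qed
  have "L_quad (1 / 2) D = (\<Sum>n = 0..2 * g. complex_of_real (t ^ n * c n))"
    unfolding L_quad_def pw using D(3) by (simp add: sum_distrib_right[symmetric] c_def mult.commute)
  also have "\<dots> = of_real (\<Sum>n\<in>{..<g + 1} \<union> {g + 1..2 * g}. t ^ n * c n)"
    unfolding of_real_sum by (intro sum.cong) auto
  also have "(\<Sum>n\<in>{..<g + 1} \<union> {g + 1..2 * g}. t ^ n * c n) = (\<Sum>n<g + 1. t ^ n * c n) + (\<Sum>n = g + 1..2 * g. t ^ n * c n)"
    by (rule sum.union_disjoint) auto
  also have "(\<Sum>n = g + 1..2 * g. t ^ n * c n) = (\<Sum>n<g. t ^ n * c n)"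
    by (rule sum.reindex_bij_witness[of _ "\<lambda>n. 2 * g - n" "\<lambda>n. 2 * g - n"])
      (use cn in \<open>auto simp: mult.commute\<close>)
  finally show ?thesis by (simp add: short_L_eq t_def c_def)
qed

section \<open>Character sums over the family\<close>

lemma quad_char_mult_left:
  assumes two: "(2 :: 'a::{field,finite}) \<noteq> 0"
  shows "quad_char (a * b) (m :: 'a poly) = quad_char a m * quad_char b m"
  unfolding quad_char_def prod.distrib[symmetric]
  by (intro prod.cong refl) (auto simp: quad_symbol_mult[OF two] monic_prime_def power_mult_distrib)

lemma abs_quad_char_le_1: "\<bar>quad_char D m\<bar> \<le> 1"
  unfolding quad_char_def abs_prod
  by (rule prod_le_1) (auto simp: quad_symbol_def power_abs power_le_one)

lemma abs_quad_char_le_1_real: "\<bar>real_of_int (quad_char D m)\<bar> \<le> 1"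
  using abs_quad_char_le_1[of D m] by (simp flip: of_int_abs)

text \<open>For monic \<open>m\<close> this means that \<open>m\<close> is a square; the form with multiplicities is the one that pairs with
  \<open>quad_char\<close>.\<close>

definition square_like :: "'a::{field,finite} poly \<Rightarrow> bool" where
  "square_like m \<longleftrightarrow> (\<forall>P. monic_prime P \<longrightarrow> even (poly_multiplicity P m))"

lemma sum_multiples:
  assumes d: "monic d"
  shows "(\<Sum>B\<in>monic_polys M. if d dvd B then F B else 0) =
    (if degree d \<le> M then \<Sum>B\<in>monic_polys (M - degree d). F (d * B) else 0)"
proof (cases "degree d \<le> M")
  case True
  have "(\<Sum>B\<in>monic_polys M. if d dvd B then F B else 0) = (\<Sum>B\<in>{B \<in> monic_polys M. d dvd B}. F B)"
    by (simp add: sum.inter_filter finite_monic_polys)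
  also have "{B \<in> monic_polys M. d dvd B} = (*) d ` monic_polys (M - degree d)"
  proof (intro equalityI subsetI)
    fix B assume "B \<in> {B \<in> monic_polys M. d dvd B}"
    then obtain r where r: "B = d * r" "monic (d * r)" "degree (d * r) = M" by (auto simp: monic_polys_def)
    then have "monic r" using d monic_cofactor by blast
    then show "B \<in> (*) d ` monic_polys (M - degree d)"
      using r d by (auto simp: monic_polys_def monic_degree_mult)
  next
    fix B assume "B \<in> (*) d ` monic_polys (M - degree d)"
    then show "B \<in> {B \<in> monic_polys M. d dvd B}"
      using d True by (auto simp: monic_polys_def monic_degree_mult monic_mult)
  qed
  also have "(\<Sum>B\<in>(*) d ` monic_polys (M - degree d). F B) = (\<Sum>B\<in>monic_polys (M - degree d). F (d * B))"
    using monic_nz[OF d] by (subst sum.reindex) (auto simp: inj_on_def)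
  finally show ?thesis using True by simp
next
  case False
  then have "\<not> d dvd B" if "B \<in> monic_polys M" for B
    using that dvd_imp_degree_le[of d B] by (auto simp: monic_polys_def monic_nz)
  then show ?thesis using False by simp
qed

text \<open>Inclusion and exclusion, with sets of primes in the role of the Moebius function.\<close>

lemma prod_one_minus_dvd:
  assumes S: "prime_set S"
  shows "(\<Prod>P\<in>S. 1 - of_bool (P ^ n dvd B)) = (\<Sum>T\<in>Pow S. if \<Prod>T ^ n dvd B then (-1) ^ card T else (0::int))"
proof -
  have fin: "finite S" using S by (simp add: prime_set_def)
  have "(\<Prod>P\<in>T. of_bool (P ^ n dvd B)) = (of_bool (\<Prod>T ^ n dvd B) :: int)" if "T \<in> Pow S" for T
  proof -
    have T: "prime_set T" "finite T" using S that finite_subset by (auto simp: prime_set_def)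
    have "(\<Prod>P\<in>T. of_bool (P ^ n dvd B)) = (of_bool (\<forall>P\<in>T. P ^ n dvd B) :: int)"
      using T(2) by (induction T rule: finite_induct) auto
    then show ?thesis using Prod_power_dvd_iff[OF T(1)] by simp
  qed
  then show ?thesis
    unfolding prod_diff_conv_sum[OF fin] by (intro sum.cong refl) auto
qed

definition \<omega> :: "'a::{field,finite} poly \<Rightarrow> nat" where
  "\<omega> m = card (prime_divs m)"

text \<open>The primes of odd multiplicity in \<open>m\<close> give a primitive character to a squarefree modulus, nontrivial
  since \<open>m\<close> is not a square; the primes of even multiplicity only impose that \<open>B\<close> be prime to them, and
  removing this condition by inclusion and exclusion costs the factor \<open>2 ^ \<omega> m\<close>.\<close>

lemma polya_vinogradov:
  fixes m :: "'a::{field,finite} poly"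
  assumes two: "(2 :: 'a) \<noteq> 0" and m: "monic m" and ns: "\<not> square_like m"
  shows "\<bar>real_of_int (\<Sum>B\<in>monic_polys M. quad_char B m)\<bar> \<le> 2 ^ \<omega> m * sqrt (real CARD('a)) ^ degree m"
proof -
  define Y where "Y = prime_divs m"
  define X where "X = {P \<in> Y. odd (poly_multiplicity P m)}"
  have m0: "m \<noteq> 0" by (rule monic_nz[OF m])
  have Y: "prime_set Y" "finite Y" using m0 by (auto simp: Y_def prime_set_prime_divs)
  have X: "prime_set X" and YX: "prime_set (Y - X)" using Y by (auto simp: X_def prime_set_def)
  have X0: "X \<noteq> {}"
  proof -
    obtain P where P: "monic_prime P" "odd (poly_multiplicity P m)" using ns by (auto simp: square_like_def)
    then have "P dvd m" using poly_multiplicity_eq_0 by fastforce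
    then show ?thesis using P by (auto simp: X_def Y_def prime_divs_def)
  qed
  have "\<Prod>X dvd m" using X by (auto simp: Prod_dvd_iff X_def Y_def prime_divs_def)
  then have degX: "degree (\<Prod>X) \<le> degree m" using m0 by (rule dvd_imp_degree_le)
  define s where "s = sqrt (real CARD('a))"
  have s1: "s \<ge> 1" using real_of_nat_ge_one_iff[of "CARD('a)"] by (simp add: s_def Suc_le_eq)
  have qc: "quad_char B m = chi X B * (\<Prod>P\<in>Y - X. 1 - of_bool (P ^ 1 dvd B))" for B
  proof -
    have "quad_char B m = (\<Prod>P\<in>Y. quad_symbol B P ^ poly_multiplicity P m)"
      by (simp add: quad_char_def Y_def prime_divs_def monic_prime_def conj_assoc)
    also have "\<dots> = (\<Prod>P\<in>X. quad_symbol B P ^ poly_multiplicity P m) * (\<Prod>P\<in>Y - X. quad_symbol B P ^ poly_multiplicity P m)"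
      using Y(2) by (intro prod.subset_diff[of X Y, simplified mult.commute]) (auto simp: X_def)
    also have "(\<Prod>P\<in>X. quad_symbol B P ^ poly_multiplicity P m) = chi X B"
      unfolding chi_def
      by (intro prod.cong refl) (auto simp: X_def quad_symbol_def elim!: oddE)
    also have "(\<Prod>P\<in>Y - X. quad_symbol B P ^ poly_multiplicity P m) = (\<Prod>P\<in>Y - X. 1 - of_bool (P ^ 1 dvd B))"
    proof (intro prod.cong refl)
      fix P assume P: "P \<in> Y - X"
      then have "even (poly_multiplicity P m)" "poly_multiplicity P m > 0"
        using m0 by (auto simp: X_def Y_def prime_divs_def poly_multiplicity_pos_iff)
      then show "quad_symbol B P ^ poly_multiplicity P m = 1 - of_bool (P ^ 1 dvd B)"
        by (auto simp: quad_symbol_def)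
    qed
    finally show ?thesis .
  qed
  have inner: "\<bar>real_of_int (\<Sum>B\<in>monic_polys M. if \<Prod>T dvd B then chi X B else 0)\<bar> \<le> s ^ degree m"
    if T: "T \<in> Pow (Y - X)" for T
  proof -
    have Tp: "prime_set T" using T YX finite_subset by (auto simp: prime_set_def)
    have "\<bar>real_of_int (\<Sum>B\<in>monic_polys k. chi X (\<Prod>T * B))\<bar> \<le> s ^ degree m" for k
    proof -
      have "\<bar>real_of_int (\<Sum>B\<in>monic_polys k. chi X (\<Prod>T * B))\<bar>
          = \<bar>real_of_int (chi X (\<Prod>T))\<bar> * \<bar>real_of_int (\<Sum>B\<in>monic_polys k. chi X B)\<bar>"
        by (simp add: chi_mult[OF two X] sum_distrib_left[symmetric] abs_mult)
      also have "\<dots> \<le> 1 * s ^ degree (\<Prod>X)"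
        using abs_chi_le_1[of X "\<Prod>T"] polya_vinogradov_chi[OF two X X0]
        by (intro mult_mono) (auto simp: s_def)
      also have "\<dots> \<le> s ^ degree m" using s1 degX by (simp add: power_increasing)
      finally show ?thesis .
    qed
    then show ?thesis unfolding sum_multiples[OF monic_Prod[OF Tp]] using s1 by simp
  qed
  have "(\<Sum>B\<in>monic_polys M. quad_char B m) =
      (\<Sum>B\<in>monic_polys M. \<Sum>T\<in>Pow (Y - X). (-1) ^ card T * (if \<Prod>T dvd B then chi X B else 0))"
    unfolding qc prod_one_minus_dvd[OF YX] sum_distrib_left
    by (intro sum.cong refl) auto
  also have "\<dots> = (\<Sum>T\<in>Pow (Y - X). (-1) ^ card T * (\<Sum>B\<in>monic_polys M. if \<Prod>T dvd B then chi X B else 0))"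
    by (subst sum.swap) (simp only: sum_distrib_left)
  also have "\<bar>real_of_int \<dots>\<bar> \<le> (\<Sum>T\<in>Pow (Y - X). \<bar>real_of_int ((-1) ^ card T * (\<Sum>B\<in>monic_polys M. if \<Prod>T dvd B then chi X B else 0))\<bar>)"
    unfolding of_int_sum[of _ "Pow (Y - X)"] by (rule sum_abs)
  also have "\<dots> \<le> (\<Sum>T\<in>Pow (Y - X). s ^ degree m)"
  proof (intro sum_mono)
    fix T assume "T \<in> Pow (Y - X)"
    from inner[OF this] show "\<bar>real_of_int ((-1) ^ card T * (\<Sum>B\<in>monic_polys M. if \<Prod>T dvd B then chi X B else 0))\<bar> \<le> s ^ degree m"
      by (simp add: abs_mult power_abs)
  qed
  also have "\<dots> = 2 ^ card (Y - X) * s ^ degree m" using Y(2) by (simp add: card_Pow)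
  also have "\<dots> \<le> 2 ^ \<omega> m * s ^ degree m"
    using Y(2) s1 by (intro mult_right_mono power_increasing) (auto simp: \<omega>_def Y_def intro!: card_mono)
  finally show ?thesis by (simp add: s_def)
qed

text \<open>Distinct sets of primes have distinct products, and the monic polynomials of any given degree contribute
  \<open>1\<close>.\<close>

lemma sum_inverse_norm_Pow:
  fixes S :: "'a::{field,finite} poly set"
  assumes S: "prime_set S"
  shows "(\<Sum>T\<in>{T \<in> Pow S. degree (\<Prod>T) < y}. 1 / real CARD('a) ^ degree (\<Prod>T)) \<le> real y"
proof -
  let ?P = "{T \<in> Pow S. degree (\<Prod>T) < y}"
  have fin: "finite S" using S by (simp add: prime_set_def)
  have ps: "prime_set T" if "T \<in> ?P" for T using that S finite_subset by (auto simp: prime_set_def)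
  have inj: "inj_on (\<lambda>T. \<Prod>T) ?P"
    using prime_divs_Prod[OF ps] by (rule inj_on_inverseI)
  have "(\<Sum>T\<in>?P. 1 / real CARD('a) ^ degree (\<Prod>T)) = (\<Sum>l\<in>(\<lambda>T. \<Prod>T) ` ?P. 1 / real CARD('a) ^ degree l)"
    using inj by (simp add: sum.reindex)
  also have "\<dots> \<le> (\<Sum>l\<in>(monics_below y :: 'a poly set). 1 / real CARD('a) ^ degree l)"
    using ps by (intro sum_mono2[OF finite_monics_below]) (auto simp: monics_below_def monic_Prod)
  also have "\<dots> = (\<Sum>n<y. \<Sum>l\<in>(monic_polys n :: 'a poly set). 1 / real CARD('a) ^ n)"
    unfolding sum_monics_below by (intro sum.cong refl) (auto simp: monic_polys_def)
  also have "\<dots> = real y" by (simp add: card_monic_polys)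
  finally show ?thesis .
qed

lemma sum_family_sieve:
  fixes F :: "'a::{field,finite} poly \<Rightarrow> int" and N :: nat
  defines "S \<equiv> {P :: 'a poly. monic_prime P \<and> degree P \<le> N}"
  shows "(\<Sum>D\<in>hyperelliptic_family N. F D) =
    (\<Sum>T\<in>Pow S. (-1) ^ card T * (\<Sum>D\<in>monic_polys N. if \<Prod>T ^ 2 dvd D then F D else 0))"
proof -
  have S: "prime_set S"
    using finite_subset[OF _ finite_polys_degree_le[of N], of S] by (auto simp: prime_set_def S_def)
  then have fin: "finite S" by (simp add: prime_set_def)
  have ind: "(\<Prod>P\<in>S. 1 - of_bool (P ^ 2 dvd D)) = (of_bool (squarefree D) :: int)" if D: "D \<in> monic_polys N" for D
  proof -
    have D0: "D \<noteq> 0" "degree D = N" using D by (auto simp: monic_polys_def monic_nz)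
    have "squarefree D \<longleftrightarrow> (\<forall>P\<in>S. \<not> P ^ 2 dvd D)"
    proof -
      have "degree P \<le> N" if "P ^ 2 dvd D" for P
        using dvd_imp_degree_le[of P D] that D0 by (metis dvd_power dvd_trans pos2)
      then show ?thesis unfolding squarefree_iff_monic_prime[OF D0(1)] S_def by blast
    qed
    moreover have "(\<Prod>P\<in>S. 1 - of_bool (P ^ 2 dvd D)) = (of_bool (\<forall>P\<in>S. \<not> P ^ 2 dvd D) :: int)"
      using fin by (induction S rule: finite_induct) auto
    ultimately show ?thesis by simp
  qed
  have "(\<Sum>D\<in>hyperelliptic_family N. F D) = (\<Sum>D\<in>monic_polys N. of_bool (squarefree D) * F D)"
    by (rule sum.mono_neutral_cong_left[OF finite_monic_polys])
      (auto simp: hyperelliptic_family_def monic_polys_def)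
  also have "\<dots> = (\<Sum>D\<in>monic_polys N. \<Sum>T\<in>Pow S. (-1) ^ card T * (if \<Prod>T ^ 2 dvd D then F D else 0))"
    by (intro sum.cong refl)
      (auto simp: ind[symmetric] prod_one_minus_dvd[OF S] sum_distrib_right intro!: sum.cong)
  also have "\<dots> = (\<Sum>T\<in>Pow S. (-1) ^ card T * (\<Sum>D\<in>monic_polys N. if \<Prod>T ^ 2 dvd D then F D else 0))"
    by (subst sum.swap) (simp only: sum_distrib_left)
  finally show ?thesis .
qed

text \<open>After the sieve for squarefree \<open>D\<close>, each inner sum runs over all monic polynomials of degree \<open>N - 2 * j\<close>,
  where \<open>j\<close> is the degree of \<open>\<Prod>T\<close>. Its trivial bound is \<open>q ^ (N - 2 * j)\<close>, and the inequality of Polya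
  and Vinogradov bounds it independently of \<open>j\<close>. The geometric mean of the two is \<open>q ^ (- j)\<close> times a
  quantity independent of \<open>T\<close>, so that the sum over \<open>T\<close> costs only the factor \<open>N + 1\<close>. The number \<open>b\<close> is
  the fourth root of \<open>q\<close>.\<close>

lemma family_character_sum:
  fixes m :: "'a::{field,finite} poly" and b :: real
  assumes two: "(2 :: 'a) \<noteq> 0" and m: "monic m" and ns: "\<not> square_like m"
    and b: "b > 0" "b ^ 4 = real CARD('a)"
  shows "\<bar>real_of_int (\<Sum>D\<in>hyperelliptic_family N. quad_char D m)\<bar> \<le>
    real (N + 1) * b ^ (2 * N) * (b ^ degree m * 2 ^ \<omega> m)"
proof -
  define S where "S = {P :: 'a poly. monic_prime P \<and> degree P \<le> N}"
  define q where "q = real CARD('a)"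
  define I where "I T = real_of_int (\<Sum>D\<in>monic_polys N. if \<Prod>T ^ 2 dvd D then quad_char D m else 0)" for T :: "'a poly set"
  define c where "c = b ^ degree m * 2 ^ \<omega> m"
  have S: "prime_set S"
    using finite_subset[OF _ finite_polys_degree_le[of N], of S] by (auto simp: prime_set_def S_def)
  then have fin: "finite S" by (simp add: prime_set_def)
  have c0: "c \<ge> 0" using b by (simp add: c_def)
  have b2: "b ^ 2 = sqrt q"
    using b by (intro real_sqrt_unique[symmetric]) (auto simp: q_def power_mult[symmetric])
  have ps: "prime_set T" if "T \<in> Pow S" for T using that S finite_subset by (auto simp: prime_set_def)
  have I: "\<bar>I T\<bar> \<le> (if degree (\<Prod>T) < N + 1 then b ^ (2 * N) * c * (1 / q ^ degree (\<Prod>T)) else 0)"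
    if T: "T \<in> Pow S" for T
  proof (cases "2 * degree (\<Prod>T) \<le> N")
    case False
    then have "I T = 0"
      using ps[OF T] by (simp add: I_def sum_multiples monic_power monic_Prod degree_power_eq monic_nz)
    then show ?thesis using b c0 by (simp add: q_def)
  next
    case True
    define j where "j = degree (\<Prod>T)"
    define V where "V = \<bar>real_of_int (\<Sum>B\<in>monic_polys (N - 2 * j). quad_char B m)\<bar>"
    have "I T = real_of_int (quad_char (\<Prod>T ^ 2) m) * real_of_int (\<Sum>B\<in>monic_polys (N - 2 * j). quad_char B m)"
      using ps[OF T] True
      by (simp add: I_def sum_multiples monic_power monic_Prod degree_power_eq monic_nz j_def
          quad_char_mult_left[OF two] sum_distrib_left)
    then have IV: "\<bar>I T\<bar> \<le> V"
      using abs_quad_char_le_1[of "\<Prod>T ^ 2" m] by (simp add: V_def abs_mult mult_left_le_one_le)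
    have V1: "V \<le> (b ^ (2 * (N - 2 * j))) ^ 2"
    proof -
      have "V \<le> (\<Sum>B\<in>(monic_polys (N - 2 * j) :: 'a poly set). 1)"
        unfolding V_def of_int_sum
        by (intro order_trans[OF sum_abs] sum_mono) (rule abs_quad_char_le_1_real)
      also have "\<dots> = q ^ (N - 2 * j)" by (simp add: card_monic_polys q_def)
      also have "\<dots> = (b ^ (2 * (N - 2 * j))) ^ 2"
        unfolding q_def b(2)[symmetric] by (simp add: power_mult[symmetric] mult_ac)
      finally show ?thesis .
    qed
    have V2: "V \<le> c ^ 2"
    proof -
      have "V \<le> 2 ^ \<omega> m * sqrt q ^ degree m"
        unfolding V_def q_def by (rule polya_vinogradov[OF two m ns])
      also have "\<dots> = 2 ^ \<omega> m * (b ^ degree m) ^ 2"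
        by (simp add: b2[symmetric] power_mult[symmetric] mult.commute)
      also have "\<dots> \<le> (2 ^ \<omega> m) ^ 2 * (b ^ degree m) ^ 2"
        by (intro mult_right_mono) (auto simp: power2_eq_square)
      finally show ?thesis by (simp add: c_def power_mult_distrib mult.commute)
    qed
    \<comment> \<open>the geometric mean of the trivial bound and the Polya--Vinogradov bound\<close>
    have "V ^ 2 \<le> (b ^ (2 * (N - 2 * j)) * c) ^ 2"
      unfolding power_mult_distrib power2_eq_square[of V]
      using V1 V2 by (intro mult_mono) (auto simp: V_def)
    then have "V \<le> b ^ (2 * (N - 2 * j)) * c"
      by (rule power2_le_imp_le) (rule mult_nonneg_nonneg[OF zero_le_power[OF less_imp_le[OF b(1)]] c0])
    also have "b ^ (2 * (N - 2 * j)) = b ^ (2 * N) * (1 / q ^ j)"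
    proof -
      have "2 * N = 2 * (N - 2 * j) + 4 * j" using True by (simp add: j_def)
      then have "b ^ (2 * N) = b ^ (2 * (N - 2 * j)) * (b ^ 4) ^ j"
        by (metis power_add power_mult)
      moreover have "q ^ j \<noteq> 0" by (simp add: q_def)
      ultimately show ?thesis unfolding b(2) q_def[symmetric] by simp
    qed
    finally show ?thesis using IV True by (simp add: j_def mult_ac)
  qed
  have "(\<Sum>D\<in>hyperelliptic_family N. quad_char D m) =
      (\<Sum>T\<in>Pow S. (-1) ^ card T * (\<Sum>D\<in>monic_polys N. if \<Prod>T ^ 2 dvd D then quad_char D m else 0))"
    unfolding S_def by (rule sum_family_sieve)
  then have "real_of_int (\<Sum>D\<in>hyperelliptic_family N. quad_char D m) = (\<Sum>T\<in>Pow S. (-1) ^ card T * I T)"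
    by (simp add: I_def)
  then have "\<bar>real_of_int (\<Sum>D\<in>hyperelliptic_family N. quad_char D m)\<bar> \<le> (\<Sum>T\<in>Pow S. \<bar>(-1) ^ card T * I T\<bar>)"
    by (simp only: sum_abs)
  also have "\<dots> = (\<Sum>T\<in>Pow S. \<bar>I T\<bar>)" by (simp add: abs_mult power_abs)
  also have "\<dots> \<le> (\<Sum>T\<in>Pow S. if degree (\<Prod>T) < N + 1 then b ^ (2 * N) * c * (1 / q ^ degree (\<Prod>T)) else 0)"
    by (intro sum_mono I)
  also have "\<dots> = (\<Sum>T\<in>{T \<in> Pow S. degree (\<Prod>T) < N + 1}. b ^ (2 * N) * c * (1 / q ^ degree (\<Prod>T)))"
    using fin by (intro sum.inter_filter[symmetric]) simp
  also have "\<dots> = b ^ (2 * N) * c * (\<Sum>T\<in>{T \<in> Pow S. degree (\<Prod>T) < N + 1}. 1 / q ^ degree (\<Prod>T))"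
    by (simp only: sum_distrib_left)
  also have "\<dots> \<le> b ^ (2 * N) * c * real (N + 1)"
    unfolding q_def using b c0 by (intro mult_left_mono sum_inverse_norm_Pow S) auto
  finally show ?thesis by (simp add: c_def mult_ac)
qed

section \<open>Tuples with square product\<close>

text \<open>The reciprocal of \<open>|f|\<close>.\<close>

definition inorm :: "'a::{field,finite} poly \<Rightarrow> real" where
  "inorm f = 1 / real CARD('a) ^ degree f"

lemma inorm_pos [simp]: "inorm f > 0"
  by (simp add: inorm_def)

lemma inorm_nonneg [simp]: "inorm f \<ge> 0"
  by (simp add: inorm_def)

lemma inorm_mult: "monic f \<Longrightarrow> monic g \<Longrightarrow> inorm (f * g) = inorm f * inorm g"
  by (simp add: inorm_def monic_degree_mult power_add)

lemma inorm_1 [simp]: "inorm 1 = 1"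
  by (simp add: inorm_def)

lemma inorm_prod: "(\<And>i. i \<in> S \<Longrightarrow> monic (f i)) \<Longrightarrow> inorm (prod f S) = (\<Prod>i\<in>S. inorm (f i))"
  by (induction S rule: infinite_finite_induct) (auto simp: inorm_mult monic_prod)

lemma wt_nonneg [simp]: "wt f \<ge> 0"
  by (simp add: wt_def)

lemma wt_1 [simp]: "wt 1 = 1"
  by (simp add: wt_def)

lemma wt_mult: "monic f \<Longrightarrow> monic g \<Longrightarrow> wt (f * g) = wt f * wt g"
  by (simp add: wt_def monic_degree_mult power_add)

lemma wt_prod: "(\<And>i. i \<in> S \<Longrightarrow> monic (f i)) \<Longrightarrow> wt (prod f S) = (\<Prod>i\<in>S. wt (f i))"
  by (induction S rule: infinite_finite_induct) (auto simp: wt_mult monic_prod)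

lemma wt_square: "monic f \<Longrightarrow> wt (f ^ 2) = inorm f"
  by (simp add: power2_eq_square wt_mult) (simp add: wt_def inorm_def power_mult_distrib[symmetric] power_divide)

lemma sum_inorm: "(\<Sum>f\<in>(monics_below y :: 'a::{field,finite} poly set). inorm f) = real y"
proof -
  have "(\<Sum>f\<in>(monics_below y :: 'a poly set). inorm f) = (\<Sum>n<y. \<Sum>f\<in>(monic_polys n :: 'a poly set). 1 / real CARD('a) ^ n)"
    unfolding sum_monics_below by (intro sum.cong refl) (auto simp: monic_polys_def inorm_def)
  then show ?thesis by (simp add: card_monic_polys)
qed

lemma poly_multiplicity_1: "monic_prime P \<Longrightarrow> poly_multiplicity P 1 = 0"
  by (simp add: poly_multiplicity_eq_0 monic_prime_not_1)

lemma poly_multiplicity_prod: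
  assumes "monic_prime P" "finite S" "\<And>i. i \<in> S \<Longrightarrow> monic (f i)"
  shows "poly_multiplicity P (prod f S) = (\<Sum>i\<in>S. poly_multiplicity P (f i))"
  using assms(2,3)
  by (induction S rule: finite_induct) (auto simp: poly_multiplicity_1 assms(1) poly_multiplicity_mult' monic_prod)

lemma poly_multiplicity_power:
  "monic_prime P \<Longrightarrow> monic f \<Longrightarrow> poly_multiplicity P (f ^ n) = n * poly_multiplicity P f"
  by (induction n) (auto simp: poly_multiplicity_1 poly_multiplicity_mult' monic_power)

text \<open>The edges of the complete graph with loops on the vertices \<open>0, \<dots>, k - 1\<close>. Edge labels \<open>l\<close> determine at
  each vertex the product of the labels of its edges, in which a loop counts twice; the product over all
  vertices is then the square of the product of the labels.\<close>

definition pairs :: "nat \<Rightarrow> (nat \<times> nat) set" where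
  "pairs k = {(i, j). i \<le> j \<and> j < k}"

definition ends :: "nat \<times> nat \<Rightarrow> nat \<Rightarrow> nat" where
  "ends p i = of_bool (fst p = i) + of_bool (snd p = i)"

definition vertex_prod :: "nat \<Rightarrow> (nat \<times> nat \<Rightarrow> 'a::{field,finite} poly) \<Rightarrow> nat \<Rightarrow> 'a poly" where
  "vertex_prod k l i = (\<Prod>p\<in>pairs k. l p ^ ends p i)"

lemma pairs_Suc: "pairs (Suc k) = pairs k \<union> (\<lambda>i. (i, k)) ` {..k}"
  by (auto simp: pairs_def less_Suc_eq)

lemma finite_pairs [simp]: "finite (pairs k)"
proof (rule finite_subset)
  show "pairs k \<subseteq> {..<k} \<times> {..<k}" by (auto simp: pairs_def)
qed simp

lemma card_pairs: "card (pairs k) = k * (k + 1) div 2"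
proof -
  have "2 * card (pairs k) = k * (k + 1)"
  proof (induction k)
    case (Suc k)
    have "card (pairs (Suc k)) = card (pairs k) + card ((\<lambda>i. (i, k)) ` {..k})"
      unfolding pairs_Suc by (rule card_Un_disjoint) (simp_all, auto simp: pairs_def)
    also have "card ((\<lambda>i. (i, k)) ` {..k}) = Suc k" by (subst card_image) (auto simp: inj_on_def)
    finally show ?case using Suc by simp
  qed (simp add: pairs_def)
  then show ?thesis by simp
qed

lemma ends_le_2: "ends p i \<le> 2"
  by (auto simp: ends_def)

lemma sum_ends:
  assumes "p \<in> pairs k"
  shows "(\<Sum>i<k. ends p i) = 2"
proof -
  have "fst p < k" "snd p < k" using assms by (auto simp: pairs_def)
  then show ?thesis by (simp add: ends_def sum.distrib of_bool_def)
qed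

lemma ends_pos: "ends p i > 0 \<longleftrightarrow> i = fst p \<or> i = snd p"
  by (auto simp: ends_def)

lemma ends_inj:
  assumes "p \<in> pairs k" "p' \<in> pairs k" "\<And>i. i < k \<Longrightarrow> ends p i = ends p' i"
  shows "p = p'"
proof -
  obtain a b a' b' where ab: "p = (a, b)" "p' = (a', b')" by (cases p; cases p')
  have o: "a \<le> b" "b < k" "a' \<le> b'" "b' < k" using assms ab by (auto simp: pairs_def)
  have iff: "(i = a \<or> i = b) = (i = a' \<or> i = b')" if "i < k" for i
    using assms(3)[OF that] ends_pos[of p i] ends_pos[of p' i] by (simp add: ab)
  have "a = a' \<or> a = b'" "b = a' \<or> b = b'" "a' = a \<or> a' = b" "b' = a \<or> b' = b"
    using iff[of a] iff[of b] iff[of a'] iff[of b'] o by simp_all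
  then have "a = a' \<and> b = b'" using o by linarith
  then show ?thesis by (simp add: ab)
qed

lemma monic_vertex_prod: "(\<And>p. p \<in> pairs k \<Longrightarrow> monic (l p)) \<Longrightarrow> monic (vertex_prod k l i)"
  unfolding vertex_prod_def by (intro monic_prod monic_power)

lemma prod_vertex_prod: "(\<Prod>i<k. vertex_prod k l i) = (\<Prod>p\<in>pairs k. l p) ^ 2"
proof -
  have "(\<Prod>i<k. vertex_prod k l i) = (\<Prod>p\<in>pairs k. \<Prod>i<k. l p ^ ends p i)"
    unfolding vertex_prod_def by (rule prod.swap)
  also have "\<dots> = (\<Prod>p\<in>pairs k. l p ^ 2)"
    by (intro prod.cong refl) (simp add: power_sum[symmetric] sum_ends)
  finally show ?thesis by (simp add: prod_power_distrib)
qed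

lemma vertex_prod_update:
  assumes "p \<in> pairs k"
  shows "vertex_prod k (l(p := l p * c)) i = vertex_prod k l i * c ^ ends p i"
proof -
  have "vertex_prod k (l(p := l p * c)) i = (l p * c) ^ ends p i * (\<Prod>p'\<in>pairs k - {p}. l p' ^ ends p' i)"
    unfolding vertex_prod_def using assms by (subst prod.remove[of _ p]) (auto intro!: prod.cong)
  also have "\<dots> = vertex_prod k l i * c ^ ends p i"
    unfolding vertex_prod_def using assms
    by (subst (2) prod.remove[of _ p]) (auto simp: power_mult_distrib mult_ac)
  finally show ?thesis .
qed

text \<open>Every tuple with square product arises from edge labels. A prime dividing the product occurs in it an even
  number of times; pair up its occurrences in the factors, and put the prime on the edge joining the two
  indices of each pair.\<close>

lemma square_product_factorisation:
  fixes f :: "nat \<Rightarrow> 'a::{field,finite} poly"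
  assumes "\<And>i. i < k \<Longrightarrow> monic (f i)" "square_like (\<Prod>i<k. f i)"
  obtains l where "\<And>p. p \<in> pairs k \<Longrightarrow> monic (l p)" "\<And>i. i < k \<Longrightarrow> f i = vertex_prod k l i"
proof -
  have "\<exists>l. (\<forall>p\<in>pairs k. monic (l p)) \<and> (\<forall>i<k. f i = vertex_prod k l i)"
    using assms
  proof (induction "degree (\<Prod>i<k. f i)" arbitrary: f rule: less_induct)
    case less
    note mon = less.prems(1) and sq = less.prems(2)
    show ?case
    proof (cases "\<forall>i<k. degree (f i) = 0")
      case True
      then have "f i = 1" if "i < k" for i using mon that monic_degree_0 by blast
      then show ?thesis by (intro exI[of _ "\<lambda>_. 1"]) (simp add: vertex_prod_def)
    next
      case False
      then obtain i where i: "i < k" "degree (f i) > 0" by auto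
      obtain P where P: "monic_prime P" "P dvd f i" using monic_prime_divisor_exists[OF i(2)] .
      have Pm: "monic P" using P(1) by (simp add: monic_prime_def)
      have "\<exists>p\<in>pairs k. \<exists>f'. \<forall>j<k. f j = f' j * P ^ ends p j"
      proof (cases "P ^ 2 dvd f i")
        case True
        then obtain r where r: "f i = r * P ^ 2" by (metis dvdE mult.commute)
        have "\<forall>j<k. f j = (f(i := r)) j * P ^ ends (i, i) j"
          using r by (auto simp: ends_def power2_eq_square)
        moreover have "(i, i) \<in> pairs k" using i by (simp add: pairs_def)
        ultimately show ?thesis by blast
      next
        case nsq: False
        have m1: "poly_multiplicity P (f i) = 1"
          using P nsq by (intro poly_multiplicity_eqI) (simp_all add: numeral_2_eq_2)
        have "even (\<Sum>j<k. poly_multiplicity P (f j))"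
        proof -
          have "poly_multiplicity P (\<Prod>j<k. f j) = (\<Sum>j<k. poly_multiplicity P (f j))"
            using mon by (intro poly_multiplicity_prod[OF P(1)]) auto
          moreover have "even (poly_multiplicity P (\<Prod>j<k. f j))"
            using sq P(1) unfolding square_like_def by blast
          ultimately show ?thesis by (simp only:)
        qed
        moreover have "(\<Sum>j<k. poly_multiplicity P (f j)) = 1 + (\<Sum>j\<in>{..<k} - {i}. poly_multiplicity P (f j))"
          using i m1 by (subst sum.remove[of _ i]) auto
        ultimately have "odd (\<Sum>j\<in>{..<k} - {i}. poly_multiplicity P (f j))" by simp
        then have "(\<Sum>j\<in>{..<k} - {i}. poly_multiplicity P (f j)) \<noteq> 0" by (metis even_zero)
        then obtain j where "j \<in> {..<k} - {i}" "poly_multiplicity P (f j) \<noteq> 0"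
          by (rule sum.not_neutral_contains_not_neutral)
        then have j: "j < k" "j \<noteq> i" "poly_multiplicity P (f j) \<noteq> 0" by simp_all
        then have "P dvd f j" by (metis poly_multiplicity_eq_0)
        then obtain r s where r: "f i = r * P" and s: "f j = s * P" using P(2) by (metis dvdE mult.commute)
        have "\<forall>j'<k. f j' = (f(i := r, j := s)) j' * P ^ ends (min i j, max i j) j'"
          using r s j(2) by (auto simp: ends_def min_def max_def)
        moreover have "(min i j, max i j) \<in> pairs k" using i j by (auto simp: pairs_def)
        ultimately show ?thesis by blast
      qed
      then obtain p f' where p: "p \<in> pairs k" and f': "\<And>j. j < k \<Longrightarrow> f j = f' j * P ^ ends p j" by blast
      have mon': "monic (f' j)" if "j < k" for j
        using mon[OF that] monic_power[OF Pm] f'[OF that] monic_cofactor by (metis mult.commute)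
      have pf': "(\<Prod>j<k. f j) = (\<Prod>j<k. f' j) * P ^ 2"
      proof -
        have "(\<Prod>j<k. f j) = (\<Prod>j<k. f' j * P ^ ends p j)" using f' by (intro prod.cong) auto
        then show ?thesis by (simp add: prod.distrib power_sum[symmetric] sum_ends[OF p])
      qed
      have mp: "monic (\<Prod>j<k. f' j)" using mon' by (intro monic_prod) auto
      have "square_like (\<Prod>j<k. f' j)"
        unfolding square_like_def
      proof (intro allI impI)
        fix R :: "'a poly" assume R: "monic_prime R"
        have "poly_multiplicity R (\<Prod>j<k. f j) = poly_multiplicity R (\<Prod>j<k. f' j) + 2 * poly_multiplicity R P"
          unfolding pf' using R mp Pm by (simp add: poly_multiplicity_mult' monic_power poly_multiplicity_power)
        then show "even (poly_multiplicity R (\<Prod>j<k. f' j))"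
          using sq R by (metis even_add even_mult_iff even_numeral square_like_def)
      qed
      moreover have "degree (\<Prod>j<k. f' j) < degree (\<Prod>j<k. f j)"
        unfolding pf' using mp Pm monic_prime_degree[OF P(1)]
        by (simp add: monic_degree_mult monic_power degree_power_eq monic_nz)
      ultimately obtain l' where l': "\<And>p. p \<in> pairs k \<Longrightarrow> monic (l' p)" "\<And>i. i < k \<Longrightarrow> f' i = vertex_prod k l' i"
        using less.hyps mon' by blast
      have "\<forall>p'\<in>pairs k. monic ((l'(p := l' p * P)) p')"
        using l'(1) monic_mult[OF l'(1)[OF p] Pm] by simp
      moreover have "\<forall>i<k. f i = vertex_prod k (l'(p := l' p * P)) i"
        using f' l' by (simp add: vertex_prod_update[OF p])
      ultimately show ?thesis by blast
    qed
  qed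
  then show ?thesis using that by blast
qed

definition square_tuples :: "nat \<Rightarrow> nat \<Rightarrow> (nat \<Rightarrow> 'a::{field,finite} poly) set" where
  "square_tuples k x = {f \<in> PiE {..<k} (\<lambda>_. monics_below x). square_like (\<Prod>i<k. f i)}"

lemma finite_square_tuples [simp]: "finite (square_tuples k x)"
proof (rule finite_subset)
  show "square_tuples k x \<subseteq> PiE {..<k} (\<lambda>_. monics_below x)" by (auto simp: square_tuples_def)
  show "finite (PiE {..<k} (\<lambda>_. monics_below x) :: (nat \<Rightarrow> 'a poly) set)"
    by (intro finite_PiE) simp_all
qed

text \<open>The weight of the tuple is the product of the \<open>1 / |l p|\<close>, and a label divides a factor, so it has degree
  less than \<open>x\<close>. Each of the \<open>k * (k + 1) div 2\<close> labels contributes a factor \<open>x\<close>.\<close>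

lemma sum_square_tuples_upper:
  "(\<Sum>f\<in>(square_tuples k x :: (nat \<Rightarrow> 'a::{field,finite} poly) set). \<Prod>i<k. wt (f i)) \<le> real x ^ (k * (k + 1) div 2)"
proof -
  let ?T = "PiE (pairs k) (\<lambda>_. monics_below x) :: (nat \<times> nat \<Rightarrow> 'a poly) set"
  have "(\<Sum>f\<in>(square_tuples k x :: (nat \<Rightarrow> 'a poly) set). \<Prod>i<k. wt (f i)) \<le> (\<Sum>l\<in>?T. \<Prod>p\<in>pairs k. inorm (l p))"
  proof (rule sum_le_included[where i = "\<lambda>l. restrict (vertex_prod k l) {..<k}"])
    show "\<forall>f\<in>square_tuples k x. \<exists>l\<in>?T. restrict (vertex_prod k l) {..<k} = f \<and>
        (\<Prod>i<k. wt (f i)) \<le> (\<Prod>p\<in>pairs k. inorm (l p))"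
    proof
      fix f :: "nat \<Rightarrow> 'a poly" assume f: "f \<in> square_tuples k x"
      then have fm: "\<And>i. i < k \<Longrightarrow> monic (f i)" "\<And>i. i < k \<Longrightarrow> degree (f i) < x"
        and sq: "square_like (\<Prod>i<k. f i)" and ext: "f \<in> extensional {..<k}"
        by (auto simp: square_tuples_def monics_below_def PiE_def Pi_def)
      obtain l where l: "\<And>p. p \<in> pairs k \<Longrightarrow> monic (l p)" "\<And>i. i < k \<Longrightarrow> f i = vertex_prod k l i"
        using square_product_factorisation[OF fm(1) sq] by blast
      define l' where "l' = restrict l (pairs k)"
      have l': "\<And>p. p \<in> pairs k \<Longrightarrow> l' p = l p" by (simp add: l'_def)
      have vp: "vertex_prod k l' i = vertex_prod k l i" for i
        unfolding vertex_prod_def by (intro prod.cong) (auto simp: l')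
      have "l' \<in> ?T"
      proof (rule PiE_I)
        fix p assume p: "p \<in> pairs k"
        then have i: "fst p < k" by (auto simp: pairs_def)
        have "l p dvd l p ^ ends p (fst p)" by (intro dvd_power) (simp add: ends_def)
        also have "\<dots> dvd vertex_prod k l (fst p)"
          unfolding vertex_prod_def using p by (intro dvd_prodI) auto
        also have "\<dots> = f (fst p)" using l(2) i by simp
        finally have "degree (l p) \<le> degree (f (fst p))" using fm(1)[OF i] monic_nz by (intro dvd_imp_degree_le) auto
        then show "l' p \<in> monics_below x" using l'[OF p] l(1)[OF p] fm(2)[OF i] by (auto simp: monics_below_def)
      qed (simp add: l'_def)
      moreover have "restrict (vertex_prod k l') {..<k} = f"
        using ext l(2) by (auto simp: vp extensional_def restrict_def fun_eq_iff)
      moreover have "(\<Prod>i<k. wt (f i)) = (\<Prod>p\<in>pairs k. inorm (l' p))"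
      proof -
        have "(\<Prod>i<k. wt (f i)) = wt (\<Prod>i<k. vertex_prod k l i)"
          using fm l(2) by (subst wt_prod) (auto intro!: prod.cong)
        also have "\<dots> = (\<Prod>p\<in>pairs k. inorm (l p))"
          unfolding prod_vertex_prod using l(1) by (simp add: wt_square monic_prod inorm_prod)
        finally show ?thesis using l' by simp
      qed
      ultimately show "\<exists>l\<in>?T. restrict (vertex_prod k l) {..<k} = f \<and> (\<Prod>i<k. wt (f i)) \<le> (\<Prod>p\<in>pairs k. inorm (l p))"
        by (intro bexI[of _ l']) auto
    qed
  qed (auto intro!: finite_PiE prod_nonneg)
  also have "\<dots> = (\<Prod>p\<in>pairs k. \<Sum>l\<in>(monics_below x :: 'a poly set). inorm l)"
    by (rule prod_sum_PiE[symmetric]) auto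
  also have "\<dots> = real x ^ (k * (k + 1) div 2)" by (simp add: sum_inorm card_pairs)
  finally show ?thesis .
qed

section \<open>Counting squarefree polynomials\<close>

text \<open>There are \<open>q ^ n\<close> monic polynomials of degree \<open>n\<close>, which leaves a geometric series.\<close>

lemma sum_inorm_square:
  fixes S :: "'a::{field,finite} poly set"
  assumes q: "CARD('a) \<ge> 3" and S: "\<And>P. P \<in> S \<Longrightarrow> monic P \<and> B < degree P \<and> degree P \<le> Z"
  shows "(\<Sum>P\<in>S. inorm P ^ 2) \<le> 1 / (2 * real CARD('a) ^ B)"
proof -
  define q where "q = real CARD('a)"
  have q3: "q \<ge> 3" using q by (simp add: q_def)
  have geo: "(\<Sum>n\<in>{B<..B + d}. 1 / q ^ n) * (q - 1) = 1 / q ^ B - 1 / q ^ (B + d)" for d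
  proof (induction d)
    case (Suc d)
    have "{B<..B + Suc d} = insert (B + Suc d) {B<..B + d}" by auto
    then have "(\<Sum>n\<in>{B<..B + Suc d}. 1 / q ^ n) * (q - 1) = (1 / q ^ (B + Suc d)) * (q - 1) + (1 / q ^ B - 1 / q ^ (B + d))"
      using Suc by (simp add: distrib_right)
    also have "(1 / q ^ (B + Suc d)) * (q - 1) = 1 / q ^ (B + d) - 1 / q ^ (B + Suc d)"
      using q3 by (simp add: field_simps)
    finally show ?case by simp
  qed simp
  have "(\<Sum>P\<in>S. inorm P ^ 2) \<le> (\<Sum>P\<in>(\<Union>n\<in>{B<..B + Z}. monic_polys n :: 'a poly set). inorm P ^ 2)"
    using S by (intro sum_mono2 finite_UN_I finite_monic_polys) (force simp: monic_polys_def)+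
  also have "\<dots> = (\<Sum>n\<in>{B<..B + Z}. \<Sum>P\<in>(monic_polys n :: 'a poly set). inorm P ^ 2)"
    by (rule sum.UNION_disjoint) (simp_all add: finite_monic_polys, auto simp: monic_polys_def)
  also have "\<dots> = (\<Sum>n\<in>{B<..B + Z}. \<Sum>P\<in>(monic_polys n :: 'a poly set). (1 / q ^ n) ^ 2)"
    by (intro sum.cong refl) (simp add: monic_polys_def inorm_def q_def)
  also have "\<dots> = (\<Sum>n\<in>{B<..B + Z}. 1 / q ^ n)"
    using q3 by (simp add: card_monic_polys q_def power2_eq_square)
  also have "\<dots> \<le> (\<Sum>n\<in>{B<..B + Z}. 1 / q ^ n) * ((q - 1) / 2)"
  proof -
    have "(\<Sum>n\<in>{B<..B + Z}. 1 / q ^ n) * 1 \<le> (\<Sum>n\<in>{B<..B + Z}. 1 / q ^ n) * ((q - 1) / 2)"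
      using q3 by (intro mult_left_mono sum_nonneg) auto
    then show ?thesis by simp
  qed
  also have "\<dots> = (1 / q ^ B - 1 / q ^ (B + Z)) / 2" by (simp only: times_divide_eq_right geo)
  also have "\<dots> \<le> 1 / (2 * q ^ B)" using q3 by (simp add: field_simps)
  finally show ?thesis by (simp add: q_def)
qed

lemma count_multiples_le:
  fixes d :: "'a::{field,finite} poly"
  assumes "monic d"
  shows "real (card {D \<in> monic_polys N. d dvd D}) \<le> real CARD('a) ^ N * inorm d"
proof -
  have "card {D \<in> monic_polys N. d dvd D} = (\<Sum>D\<in>monic_polys N. if d dvd D then 1 else 0)"
    by (simp add: sum.inter_filter[symmetric] finite_monic_polys)
  also have "\<dots> = (if degree d \<le> N then CARD('a) ^ (N - degree d) else 0)"
    unfolding sum_multiples[OF assms] by (simp add: card_monic_polys)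
  finally have c: "card {D \<in> monic_polys N. d dvd D} = (if degree d \<le> N then CARD('a) ^ (N - degree d) else 0)" .
  have "real CARD('a) ^ (N - degree d) = real CARD('a) ^ N / real CARD('a) ^ degree d" if "degree d \<le> N"
    using that by (intro power_diff) auto
  then show ?thesis unfolding c by (simp add: inorm_def)
qed

text \<open>At most half of the monic polynomials are divisible by the square of a prime.\<close>

lemma card_family_lower:
  assumes q: "CARD('a::{field,finite}) \<ge> 3"
  shows "real CARD('a) ^ N \<le> 2 * real (card (hyperelliptic_family N :: 'a poly set))"
proof -
  define S where "S = {P :: 'a poly. monic_prime P \<and> degree P \<le> N}"
  have fS: "finite S" using finite_subset[OF _ finite_polys_degree_le[of N], of S] by (auto simp: S_def)
  have "monic_polys N \<subseteq> hyperelliptic_family N \<union> (\<Union>P\<in>S. {D \<in> monic_polys N. P ^ 2 dvd D})"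
  proof
    fix D :: "'a poly" assume D: "D \<in> monic_polys N"
    then have D0: "D \<noteq> 0" "degree D = N" by (auto simp: monic_polys_def monic_nz)
    show "D \<in> hyperelliptic_family N \<union> (\<Union>P\<in>S. {D \<in> monic_polys N. P ^ 2 dvd D})"
    proof (cases "squarefree D")
      case False
      then obtain P where P: "monic_prime P" "P ^ 2 dvd D" using squarefree_iff_monic_prime[OF D0(1)] by blast
      then have "degree P \<le> N"
        using dvd_imp_degree_le[of P D] D0 by (metis dvd_power dvd_trans pos2)
      then show ?thesis using P D by (auto simp: S_def)
    qed (use D in \<open>auto simp: hyperelliptic_family_def monic_polys_def\<close>)
  qed
  then have "card (monic_polys N :: 'a poly set) \<le> card (hyperelliptic_family N \<union> (\<Union>P\<in>S. {D \<in> monic_polys N. P ^ 2 dvd D}))"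
    using fS by (intro card_mono) (auto simp: finite_hyperelliptic_family finite_monic_polys)
  also have "\<dots> \<le> card (hyperelliptic_family N :: 'a poly set) + card (\<Union>P\<in>S. {D \<in> monic_polys N. P ^ 2 dvd D})"
    by (rule card_Un_le)
  also have "card (\<Union>P\<in>S. {D \<in> monic_polys N. P ^ 2 dvd D}) \<le> (\<Sum>P\<in>S. card {D \<in> monic_polys N. P ^ 2 dvd D})"
    by (rule card_UN_le[OF fS])
  finally have "real (card (monic_polys N :: 'a poly set)) \<le> real (card (hyperelliptic_family N :: 'a poly set)) + real (\<Sum>P\<in>S. card {D \<in> monic_polys N. P ^ 2 dvd D})"
    by linarith
  also have "real (\<Sum>P\<in>S. card {D \<in> monic_polys N. P ^ 2 dvd D}) \<le> (\<Sum>P\<in>S. real CARD('a) ^ N * inorm P ^ 2)"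
    unfolding of_nat_sum
  proof (intro sum_mono)
    fix P assume "P \<in> S"
    then have "monic P" by (simp add: S_def monic_prime_def)
    then show "real (card {D \<in> monic_polys N. P ^ 2 dvd D}) \<le> real CARD('a) ^ N * inorm P ^ 2"
      using count_multiples_le[of "P ^ 2" N] monic_power[of P 2] by (simp add: inorm_mult power2_eq_square)
  qed
  also have "\<dots> = real CARD('a) ^ N * (\<Sum>P\<in>S. inorm P ^ 2)" by (simp add: sum_distrib_left)
  also have "\<dots> \<le> real CARD('a) ^ N * (1 / (2 * real CARD('a) ^ 0))"
    by (intro mult_left_mono sum_inorm_square[OF q, where Z = N])
      (auto simp: S_def monic_prime_degree, simp add: monic_prime_def)
  finally show ?thesis by (simp add: card_monic_polys)
qed

definition char_sum :: "nat \<Rightarrow> 'a::{field,finite} poly \<Rightarrow> int" where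
  "char_sum N m = (\<Sum>D\<in>hyperelliptic_family N. quad_char D m)"

lemma prod_of_bool: "finite S \<Longrightarrow> (\<Prod>x\<in>S. of_bool (R x)) = (of_bool (\<forall>x\<in>S. R x) :: 'b::comm_semiring_1)"
  by (induction S rule: finite_induct) auto

text \<open>All exponents are even and positive.\<close>

lemma quad_char_square_like:
  assumes m: "monic m" and sq: "square_like m"
  shows "quad_char D m = of_bool (\<forall>P\<in>prime_divs m. \<not> P dvd D)"
proof -
  have m0: "m \<noteq> 0" using m by (rule monic_nz)
  have "quad_char D m = (\<Prod>P\<in>prime_divs m. quad_symbol D P ^ poly_multiplicity P m)"
    by (simp add: quad_char_def prime_divs_def monic_prime_def conj_assoc)
  also have "\<dots> = (\<Prod>P\<in>prime_divs m. of_bool (\<not> P dvd D))"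
  proof (intro prod.cong refl)
    fix P assume P: "P \<in> prime_divs m"
    then have "even (poly_multiplicity P m)" "poly_multiplicity P m > 0"
      using m0 sq by (auto simp: square_like_def prime_divs_def poly_multiplicity_pos_iff)
    then show "quad_symbol D P ^ poly_multiplicity P m = of_bool (\<not> P dvd D)"
      by (auto simp: quad_symbol_def)
  qed
  also have "\<dots> = of_bool (\<forall>P\<in>prime_divs m. \<not> P dvd D)"
    using finite_prime_divs[OF m0] by (rule prod_of_bool)
  finally show ?thesis .
qed

lemma char_sum_nonneg: "monic m \<Longrightarrow> square_like m \<Longrightarrow> char_sum N m \<ge> 0"
  unfolding char_sum_def by (intro sum_nonneg) (simp add: quad_char_square_like)

lemma char_sum_le:
  fixes m :: "'a::{field,finite} poly"
  shows "real_of_int (char_sum N m) \<le> real (card (hyperelliptic_family N :: 'a poly set))"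
proof -
  have "real_of_int (char_sum N m) \<le> (\<Sum>D\<in>(hyperelliptic_family N :: 'a poly set). 1)"
    unfolding char_sum_def of_int_sum
    by (intro sum_mono order_trans[OF abs_ge_self abs_quad_char_le_1_real])
  then show ?thesis by simp
qed

text \<open>The contribution of the tuple \<open>f\<close> to a moment over the family.\<close>

abbreviation tuple_term :: "nat \<Rightarrow> nat \<Rightarrow> (nat \<Rightarrow> 'a::{field,finite} poly) \<Rightarrow> real" where
  "tuple_term N k f \<equiv> (\<Prod>i<k. wt (f i)) * real_of_int (char_sum N (\<Prod>i<k. f i))"

text \<open>A prime \<open>P\<close> dividing \<open>m\<close> removes at most a proportion \<open>1 / |P|\<close> of the monic polynomials, which is at most
  \<open>2 / |P|\<close> of the family.\<close>

lemma char_sum_square_lower: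
  fixes m :: "'a::{field,finite} poly"
  assumes q: "CARD('a) \<ge> 3" and m: "monic m" and sq: "square_like m"
  shows "real_of_int (char_sum N m) \<ge>
    real (card (hyperelliptic_family N :: 'a poly set)) * (1 - 2 * (\<Sum>P\<in>prime_divs m. inorm P))"
proof -
  let ?H = "hyperelliptic_family N :: 'a poly set"
  have m0: "m \<noteq> 0" using m by (rule monic_nz)
  have fin: "finite (prime_divs m)" using m0 by simp
  have "card {D \<in> ?H. P dvd D} \<le> card {D \<in> monic_polys N. P dvd D}" for P
    by (intro card_mono) (auto simp: finite_monic_polys, auto simp: hyperelliptic_family_def monic_polys_def)
  then have cle: "real (card {D \<in> ?H. P dvd D}) \<le> 2 * real (card ?H) * inorm P" if "P \<in> prime_divs m" for P
  proof -
    have "real (card {D \<in> ?H. P dvd D}) \<le> real (card {D \<in> monic_polys N. P dvd D})"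
      using \<open>\<And>P. card {D \<in> ?H. P dvd D} \<le> card {D \<in> monic_polys N. P dvd D}\<close> by simp
    also have "\<dots> \<le> real CARD('a) ^ N * inorm P"
      using that by (intro count_multiples_le) (simp add: prime_divs_def monic_prime_def)
    also have "\<dots> \<le> 2 * real (card ?H) * inorm P"
      by (intro mult_right_mono card_family_lower[OF q]) simp
    finally show ?thesis .
  qed
  have "of_bool (\<forall>P\<in>prime_divs m. \<not> P dvd D) \<ge> 1 - (\<Sum>P\<in>prime_divs m. of_bool (P dvd D) :: real)" for D
  proof (cases "\<forall>P\<in>prime_divs m. \<not> P dvd D")
    case False
    then obtain P where "P \<in> prime_divs m" "P dvd D" by blast
    then have "(1::real) \<le> (\<Sum>P\<in>prime_divs m. of_bool (P dvd D))"
      using member_le_sum[of P "prime_divs m" "\<lambda>P. of_bool (P dvd D) :: real"] fin by simp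
    then show ?thesis by simp
  qed (simp add: sum_nonneg)
  then have "real_of_int (char_sum N m) \<ge> (\<Sum>D\<in>?H. 1 - (\<Sum>P\<in>prime_divs m. of_bool (P dvd D) :: real))"
    unfolding char_sum_def of_int_sum by (intro sum_mono) (simp only: quad_char_square_like[OF m sq] of_int_of_bool)
  also have "(\<Sum>D\<in>?H. 1 - (\<Sum>P\<in>prime_divs m. of_bool (P dvd D) :: real)) =
      real (card ?H) - (\<Sum>P\<in>prime_divs m. real (card {D \<in> ?H. P dvd D}))"
  proof -
    have "(\<Sum>D\<in>?H. \<Sum>P\<in>prime_divs m. of_bool (P dvd D) :: real) = (\<Sum>P\<in>prime_divs m. \<Sum>D\<in>?H. of_bool (P dvd D))"
      by (rule sum.swap)
    also have "\<dots> = (\<Sum>P\<in>prime_divs m. real (card {D \<in> ?H. P dvd D}))"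
      by (intro sum.cong refl) (simp add: of_bool_def sum.inter_filter[symmetric] finite_hyperelliptic_family)
    finally show ?thesis by (simp add: sum_subtractf)
  qed
  finally have "real (card ?H) - (\<Sum>P\<in>prime_divs m. real (card {D \<in> ?H. P dvd D})) \<le> real_of_int (char_sum N m)" .
  moreover have "(\<Sum>P\<in>prime_divs m. real (card {D \<in> ?H. P dvd D})) \<le> (\<Sum>P\<in>prime_divs m. 2 * real (card ?H) * inorm P)"
    by (intro sum_mono cle)
  ultimately show ?thesis by (simp add: sum_distrib_left algebra_simps)
qed

section \<open>A lower bound for tuples with square product\<close>

text \<open>Conditions on the separate labels behave as independent events.\<close>

lemma sum_PiE_inorm_cond:
  fixes U :: "'a::{field,finite} poly set"
  assumes I: "finite I" and U: "finite U"
    and R: "\<And>a. a \<in> I \<Longrightarrow> (\<Sum>l\<in>U. inorm l * of_bool (R a l)) \<le> r a * V"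
  shows "(\<Sum>l\<in>PiE I (\<lambda>_. U). (\<Prod>a\<in>I. inorm (l a)) * of_bool (\<forall>a\<in>I. R a (l a))) \<le> prod r I * V ^ card I"
proof -
  have "(\<Sum>l\<in>PiE I (\<lambda>_. U). (\<Prod>a\<in>I. inorm (l a)) * of_bool (\<forall>a\<in>I. R a (l a))) =
      (\<Sum>l\<in>PiE I (\<lambda>_. U). \<Prod>a\<in>I. inorm (l a) * of_bool (R a (l a)))"
    by (simp only: prod.distrib prod_of_bool[OF I])
  also have "\<dots> = (\<Prod>a\<in>I. \<Sum>l\<in>U. inorm l * of_bool (R a l))"
    by (rule prod_sum_PiE[symmetric]) (use I U in auto)
  also have "\<dots> \<le> (\<Prod>a\<in>I. r a * V)"
    using R by (intro prod_mono) (auto intro!: sum_nonneg)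
  also have "\<dots> = prod r I * V ^ card I" by (simp add: prod.distrib)
  finally show ?thesis .
qed

text \<open>Labels without small prime factors: for these the losses below are bounded by a sum of \<open>1 / |P|\<^sup>2\<close> over
  the primes \<open>P\<close> of degree greater than \<open>B\<close>, which is small for large \<open>B\<close>.\<close>

definition rough :: "nat \<Rightarrow> nat \<Rightarrow> 'a::{field,finite} poly set" where
  "rough B y = {l \<in> monics_below y. \<forall>P. monic_prime P \<longrightarrow> P dvd l \<longrightarrow> B < degree P}"

lemma finite_rough [simp]: "finite (rough B y)"
  by (rule finite_subset[OF _ finite_monics_below[of y]]) (auto simp: rough_def)

text \<open>Rough polynomials are closed under divisors, so division by \<open>d\<close> maps the multiples of \<open>d\<close> among them into
  the set itself.\<close>

lemma rough_multiples:
  fixes d :: "'a::{field,finite} poly"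
  assumes d: "monic d"
  shows "(\<Sum>l\<in>rough B y. inorm l * of_bool (d dvd l)) \<le> inorm d * (\<Sum>l\<in>(rough B y :: 'a poly set). inorm l)"
proof -
  let ?U = "rough B y :: 'a poly set"
  have "(\<Sum>l\<in>?U. inorm l * of_bool (d dvd l)) = (\<Sum>l\<in>{l \<in> ?U. d dvd l}. inorm l)"
    by (simp add: sum.inter_filter of_bool_def if_distrib cong: if_cong)
  also have "\<dots> \<le> (\<Sum>l\<in>(*) d ` ?U. inorm l)"
  proof (rule sum_mono2)
    show "{l \<in> ?U. d dvd l} \<subseteq> (*) d ` ?U"
    proof
      fix l assume l: "l \<in> {l \<in> ?U. d dvd l}"
      then obtain r where r: "l = d * r" by auto
      have lm: "monic l" "degree l < y" using l by (auto simp: rough_def monics_below_def)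
      then have rm: "monic r" using r d monic_cofactor by blast
      then have "degree r < y" using lm r d by (simp add: monic_degree_mult)
      moreover have "B < degree P" if "monic_prime P" "P dvd r" for P
        using l r that dvd_mult[of P r d] by (auto simp: rough_def)
      ultimately have "r \<in> ?U" using rm by (simp add: rough_def monics_below_def)
      then show "l \<in> (*) d ` ?U" using r by blast
    qed
  qed auto
  also have "\<dots> = (\<Sum>l\<in>?U. inorm (d * l))"
    using monic_nz[OF d] by (subst sum.reindex) (auto simp: inj_on_def)
  also have "\<dots> = inorm d * (\<Sum>l\<in>?U. inorm l)"
    unfolding sum_distrib_left
    by (intro sum.cong refl inorm_mult d) (auto simp: rough_def monics_below_def)
  finally show ?thesis .
qed

text \<open>Let \<open>W\<close> be a nonconstant polynomial divisible by all primes of degree at most \<open>B\<close>. Every monic polynomial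
  congruent to \<open>1\<close> modulo \<open>W\<close> is rough, and these are a proportion \<open>1 / |W|\<close> of the monic polynomials of
  each degree from \<open>w\<close>, the degree of \<open>W\<close>, on.\<close>

lemma rough_sum_lower:
  "\<exists>w. \<forall>y\<ge>w. real (y - w) / real CARD('a) ^ w \<le> (\<Sum>l\<in>(rough B y :: 'a::{field,finite} poly set). inorm l)"
proof -
  define S where "S = {P :: 'a poly. monic_prime P \<and> degree P \<le> B}"
  \<comment> \<open>the factor \<open>T\<close> makes \<open>W\<close> nonconstant, so that \<open>1 + W * h\<close> has the leading coefficient of \<open>h\<close>\<close>
  define W where "W = [:0, 1:] * \<Prod>S"
  define w where "w = degree W"
  have S: "prime_set S"
    using finite_subset[OF _ finite_polys_degree_le[of B], of S] by (auto simp: prime_set_def S_def)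
  have mT: "monic [:0, 1 :: 'a:]" by (simp add: monic_def)
  have Wm: "monic W" unfolding W_def by (intro monic_mult mT monic_Prod S)
  have w0: "w > 0" unfolding w_def W_def using monic_degree_mult[OF mT monic_Prod[OF S]] by simp
  have "real (y - w) / real CARD('a) ^ w \<le> (\<Sum>l\<in>(rough B y :: 'a poly set). inorm l)" if y: "y \<ge> w" for y
  proof -
    let ?f = "\<lambda>h. 1 + W * h"
    have mo: "monic (?f h) \<and> degree (?f h) = w + degree h" if "monic h" for h
    proof -
      have Wh: "monic (W * h)" "degree (W * h) = w + degree h"
        using that Wm by (simp_all add: monic_mult monic_degree_mult w_def)
      then have lt: "degree (1 :: 'a poly) < degree (W * h)" using w0 by simp
      then have "degree (?f h) = w + degree h" using Wh by (simp add: degree_add_eq_right)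
      moreover have "lead_coeff (?f h) = lead_coeff (W * h)" using lt by (rule lead_coeff_add_le)
      ultimately show ?thesis using Wh by (simp add: monic_def)
    qed
    have inj: "inj_on ?f (monics_below (y - w))" using monic_nz[OF Wm] by (auto simp: inj_on_def)
    have sub: "?f ` monics_below (y - w) \<subseteq> rough B y"
    proof
      fix l assume "l \<in> ?f ` monics_below (y - w)"
      then obtain h where h: "l = ?f h" "monic h" "degree h < y - w" by (auto simp: monics_below_def)
      have "B < degree P" if P: "monic_prime P" "P dvd l" for P
      proof (rule ccontr)
        assume "\<not> B < degree P"
        then have "P \<in> S" using P by (simp add: S_def)
        then have "P dvd \<Prod>S" using P S by (simp add: monic_prime_dvd_Prod)
        then have "P dvd W * h" unfolding W_def by (intro dvd_mult2 dvd_mult)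
        then have "P dvd 1" using P(2) h(1) by (simp add: dvd_add_left_iff)
        then show False using monic_prime_not_1 P by blast
      qed
      then show "l \<in> rough B y" using h mo[OF h(2)] y by (auto simp: rough_def monics_below_def)
    qed
    have "(\<Sum>h\<in>(monics_below (y - w) :: 'a poly set). inorm h) / real CARD('a) ^ w = (\<Sum>h\<in>monics_below (y - w). inorm (?f h))"
      unfolding sum_divide_distrib
      by (intro sum.cong refl) (use mo in \<open>simp add: inorm_def monics_below_def power_add\<close>)
    also have "\<dots> = (\<Sum>l\<in>?f ` monics_below (y - w). inorm l)" using inj by (simp add: sum.reindex)
    also have "\<dots> \<le> (\<Sum>l\<in>(rough B y :: 'a poly set). inorm l)" by (rule sum_mono2[OF finite_rough sub]) simp
    finally show ?thesis by (simp add: sum_inorm)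
  qed
  then show ?thesis by blast
qed

lemma square_dvd_prod:
  assumes P: "monic_prime P" and fin: "finite I" and d: "P ^ 2 dvd prod l I"
  shows "(\<exists>a\<in>I. P ^ 2 dvd l a) \<or> (\<exists>a\<in>I. \<exists>b\<in>I - {a}. P dvd l a \<and> P dvd l b)"
proof -
  have "P dvd prod l I" using d by (metis dvd_power dvd_trans pos2)
  then obtain a where a: "a \<in> I" "P dvd l a" using monic_prime_dvd_prod[OF fin P] by blast
  have e: "prod l I = prod l (I - {a}) * l a" using fin a by (simp add: prod.remove mult.commute)
  show ?thesis
  proof (cases "P dvd prod l (I - {a})")
    case True
    have "finite (I - {a})" using fin by simp
    from monic_prime_dvd_prod[OF this P] True show ?thesis using a by blast
  next
    case False
    then have "P ^ 2 dvd l a" using monic_prime_power_dvd_mult[OF P False] d e by metis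
    then show ?thesis using a by blast
  qed
qed

text \<open>If the labels have squarefree product, a prime divides at most one label, and the multiplicities of the
  prime in the vertex products are the incidence vector of that edge.\<close>

lemma multiplicity_vertex_prod:
  assumes P: "monic_prime P" and l: "\<And>p. p \<in> pairs k \<Longrightarrow> monic (l p)"
    and sf: "\<not> P ^ 2 dvd (\<Prod>p\<in>pairs k. l p)" and p0: "p0 \<in> pairs k" "P dvd l p0"
  shows "poly_multiplicity P (vertex_prod k l i) = ends p0 i"
proof -
  have m1: "poly_multiplicity P (l p0) = 1"
  proof (rule poly_multiplicity_eqI)
    show "\<not> P ^ Suc 1 dvd l p0"
    proof
      assume "P ^ Suc 1 dvd l p0"
      moreover have "l p0 dvd (\<Prod>p\<in>pairs k. l p)" using p0 by (intro dvd_prodI) auto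
      ultimately show False using sf dvd_trans by (metis numeral_2_eq_2 One_nat_def)
    qed
  qed (use p0 in simp)
  have m0: "poly_multiplicity P (l p) = 0" if p: "p \<in> pairs k" "p \<noteq> p0" for p
  proof (rule ccontr)
    assume "poly_multiplicity P (l p) \<noteq> 0"
    then have "P dvd l p" by (metis poly_multiplicity_eq_0)
    then have "P ^ 2 dvd l p * l p0" unfolding power2_eq_square using p0 by (intro mult_dvd_mono)
    also have "l p * l p0 = (\<Prod>p\<in>{p, p0}. l p)" using p by simp
    also have "\<dots> dvd (\<Prod>p\<in>pairs k. l p)" using p p0 by (intro prod_dvd_prod_subset) auto
    finally show False using sf by blast
  qed
  have "poly_multiplicity P (vertex_prod k l i) = (\<Sum>p\<in>pairs k. ends p i * poly_multiplicity P (l p))"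
    unfolding vertex_prod_def using P l
    by (subst poly_multiplicity_prod) (auto simp: monic_power poly_multiplicity_power)
  also have "\<dots> = (\<Sum>p\<in>pairs k. if p = p0 then ends p0 i else 0)"
    using m0 m1 by (intro sum.cong) auto
  finally show ?thesis using p0 by simp
qed

definition squarefree_labels :: "nat \<Rightarrow> (nat \<times> nat \<Rightarrow> 'a::{field,finite} poly) \<Rightarrow> bool" where
  "squarefree_labels k l \<longleftrightarrow> (\<forall>p\<in>pairs k. monic (l p)) \<and> squarefree (\<Prod>p\<in>pairs k. l p)"

lemma squarefree_labelsD:
  assumes "squarefree_labels k l"
  shows "\<And>p. p \<in> pairs k \<Longrightarrow> monic (l p)"
    and "\<And>P. monic_prime P \<Longrightarrow> \<not> P ^ 2 dvd (\<Prod>p\<in>pairs k. l p)"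
    and "\<And>p. p \<in> pairs k \<Longrightarrow> squarefree (l p)"
proof -
  show m: "\<And>p. p \<in> pairs k \<Longrightarrow> monic (l p)" using assms by (auto simp: squarefree_labels_def)
  have nz: "(\<Prod>p\<in>pairs k. l p) \<noteq> 0" using m by (intro monic_nz monic_prod)
  then show "\<And>P. monic_prime P \<Longrightarrow> \<not> P ^ 2 dvd (\<Prod>p\<in>pairs k. l p)"
    using assms squarefree_iff_monic_prime[OF nz] by (auto simp: squarefree_labels_def)
  fix p assume p: "p \<in> pairs k"
  then have "l p dvd (\<Prod>p\<in>pairs k. l p)" by (intro dvd_prodI) auto
  then show "squarefree (l p)"
    using assms unfolding squarefree_labels_def squarefree_def by (meson dvd_trans)
qed

lemma label_prime_transfer:
  assumes l: "squarefree_labels k l" and l': "squarefree_labels k l'"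
    and eq: "\<And>i. i < k \<Longrightarrow> vertex_prod k l i = vertex_prod k l' i"
    and P: "monic_prime P" and p0: "p0 \<in> pairs k" "P dvd l p0"
  shows "P dvd l' p0"
proof -
  have i0: "fst p0 < k" using p0 by (auto simp: pairs_def)
  have m: "poly_multiplicity P (vertex_prod k l' i) = ends p0 i" if "i < k" for i
    unfolding eq[OF that, symmetric]
    by (rule multiplicity_vertex_prod[OF P squarefree_labelsD(1)[OF l] squarefree_labelsD(2)[OF l P] p0])
  have "ends p0 (fst p0) > 0" by (simp add: ends_pos)
  then have "P dvd vertex_prod k l' (fst p0)"
    using m[OF i0] by (metis poly_multiplicity_eq_0 less_irrefl)
  then obtain p1 where p1: "p1 \<in> pairs k" "P dvd l' p1"
    unfolding vertex_prod_def using monic_prime_dvd_prod[OF finite_pairs P] P by (auto simp: monic_prime_dvd_power)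
  have "ends p1 i = ends p0 i" if "i < k" for i
    using multiplicity_vertex_prod[OF P squarefree_labelsD(1)[OF l'] squarefree_labelsD(2)[OF l' P] p1] m[OF that] by simp
  then have "p1 = p0" by (intro ends_inj[OF p1(1) p0(1)])
  then show ?thesis using p1 by simp
qed

text \<open>The incidence vector of an edge determines the edge. Hence the vertex products determine which label is
  divisible by which primes, and the labels themselves because they are squarefree.\<close>

lemma labels_determined:
  assumes l: "squarefree_labels k l" and l': "squarefree_labels k l'"
    and eq: "\<And>i. i < k \<Longrightarrow> vertex_prod k l i = vertex_prod k l' i" and p: "p \<in> pairs k"
  shows "l p = l' p"
proof -
  have "prime_divs (l p) = prime_divs (l' p)"
    using label_prime_transfer[OF l l' eq _ p] label_prime_transfer[OF l' l eq[symmetric] _ p]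
    by (auto simp: prime_divs_def)
  then show ?thesis
    using squarefree_eq_Prod squarefree_labelsD(1,3)[OF l p] squarefree_labelsD(1,3)[OF l' p] by metis
qed

lemma square_like_square: "monic f \<Longrightarrow> square_like (f ^ 2)"
  by (simp add: square_like_def poly_multiplicity_power)

lemma prime_divs_square: "prime_divs (f ^ 2) = prime_divs f"
  by (auto simp: prime_divs_def monic_prime_dvd_power)

lemma degree_vertex_prod:
  assumes "\<And>p. p \<in> pairs k \<Longrightarrow> monic (l p) \<and> degree (l p) < y" "y > 0"
  shows "degree (vertex_prod k l i) + k * (k + 1) \<le> k * (k + 1) * y"
proof -
  have K: "2 * card (pairs k) = k * (k + 1)" by (simp add: card_pairs)
  have "degree (vertex_prod k l i) = (\<Sum>p\<in>pairs k. ends p i * degree (l p))"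
    unfolding vertex_prod_def using assms
    by (subst monic_degree_prod) (auto simp: monic_power degree_power_eq monic_nz)
  also have "\<dots> \<le> (\<Sum>p\<in>pairs k. 2 * (y - 1))"
    using assms by (intro sum_mono mult_le_mono ends_le_2) fastforce
  also have "\<dots> = k * (k + 1) * (y - 1)" using K by (metis mult.assoc mult.commute sum_constant of_nat_id)
  finally show ?thesis using assms(2) by (cases y) (simp_all add: algebra_simps)
qed

text \<open>The map from labels to tuples is injective on this set, and the tuples outside its image contribute
  nonnegative terms.\<close>

lemma sum_square_tuples_ge_labels:
  fixes N y k B :: nat
  defines "T \<equiv> {l \<in> PiE (pairs k) (\<lambda>_. rough B y). squarefree_labels k l} :: (nat \<times> nat \<Rightarrow> 'a::{field,finite} poly) set"
  assumes x: "k * (k + 1) * y \<le> x" and y: "y > 0" and k: "k > 0"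
  shows "(\<Sum>l\<in>T. (\<Prod>p\<in>pairs k. inorm (l p)) * real_of_int (char_sum N ((\<Prod>p\<in>pairs k. l p) ^ 2))) \<le>
    (\<Sum>f\<in>(square_tuples k x :: (nat \<Rightarrow> 'a poly) set). tuple_term N k f)"
proof -
  let ?\<Phi> = "\<lambda>l. restrict (vertex_prod k l) {..<k}"
  have T: "squarefree_labels k l" "l \<in> extensional (pairs k)" "\<And>p. p \<in> pairs k \<Longrightarrow> monic (l p) \<and> degree (l p) < y"
    if "l \<in> T" for l
    using that by (auto simp: T_def PiE_def rough_def monics_below_def)
  have val: "(\<Prod>i<k. ?\<Phi> l i) = (\<Prod>p\<in>pairs k. l p) ^ 2" for l :: "nat \<times> nat \<Rightarrow> 'a poly"
    by (simp add: prod_vertex_prod)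
  have inj: "inj_on ?\<Phi> T"
  proof (rule inj_onI)
    fix l l' assume l: "l \<in> T" "l' \<in> T" "?\<Phi> l = ?\<Phi> l'"
    have v: "vertex_prod k l i = vertex_prod k l' i" if "i < k" for i
      using fun_cong[OF l(3), of i] that by simp
    have "l p = l' p" if "p \<in> pairs k" for p
      by (rule labels_determined[OF T(1)[OF l(1)] T(1)[OF l(2)] v that])
    then show "l = l'" using T(2)[OF l(1)] T(2)[OF l(2)] by (intro extensionalityI[of _ "pairs k"]) auto
  qed
  have im: "?\<Phi> ` T \<subseteq> square_tuples k x"
  proof
    fix f assume "f \<in> ?\<Phi> ` T"
    then obtain l where l: "l \<in> T" "f = ?\<Phi> l" by blast
    have "degree (vertex_prod k l i) < x" for i
    proof -
      have "0 < k * (k + 1)" using k by simp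
      moreover have "degree (vertex_prod k l i) + k * (k + 1) \<le> k * (k + 1) * y"
        by (rule degree_vertex_prod[OF _ y]) (rule T(3)[OF l(1)])
      ultimately show ?thesis using x by linarith
    qed
    moreover have "monic (vertex_prod k l i)" for i using T(3)[OF l(1)] by (intro monic_vertex_prod) auto
    moreover have "square_like (\<Prod>i<k. f i)"
      unfolding l(2) val using T(3)[OF l(1)] by (intro square_like_square monic_prod) auto
    ultimately show "f \<in> square_tuples k x"
      unfolding square_tuples_def using l(2) by (auto simp: monics_below_def)
  qed
  have "(\<Sum>l\<in>T. (\<Prod>p\<in>pairs k. inorm (l p)) * real_of_int (char_sum N ((\<Prod>p\<in>pairs k. l p) ^ 2))) =
      (\<Sum>l\<in>T. (\<Prod>i<k. wt (?\<Phi> l i)) * real_of_int (char_sum N (\<Prod>i<k. ?\<Phi> l i)))"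
  proof (intro sum.cong refl)
    fix l assume l: "l \<in> T"
    have m: "monic (l p)" if "p \<in> pairs k" for p using T(3)[OF l] that by blast
    have "(\<Prod>i<k. wt (?\<Phi> l i)) = wt (\<Prod>i<k. ?\<Phi> l i)"
      using m by (intro wt_prod[symmetric]) (auto intro!: monic_vertex_prod)
    also have "\<dots> = (\<Prod>p\<in>pairs k. inorm (l p))"
      unfolding val using m by (simp add: wt_square monic_prod inorm_prod)
    finally show "(\<Prod>p\<in>pairs k. inorm (l p)) * real_of_int (char_sum N ((\<Prod>p\<in>pairs k. l p) ^ 2)) =
        (\<Prod>i<k. wt (?\<Phi> l i)) * real_of_int (char_sum N (\<Prod>i<k. ?\<Phi> l i))" unfolding val by simp
  qed
  also have "\<dots> = (\<Sum>f\<in>?\<Phi> ` T. tuple_term N k f)"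
    using inj by (simp only: sum.reindex o_def)
  also have "\<dots> \<le> (\<Sum>f\<in>(square_tuples k x :: (nat \<Rightarrow> 'a poly) set). tuple_term N k f)"
  proof (rule sum_mono2[OF finite_square_tuples im])
    fix f :: "nat \<Rightarrow> 'a poly" assume "f \<in> square_tuples k x - ?\<Phi> ` T"
    then have "monic (\<Prod>i<k. f i)" "square_like (\<Prod>i<k. f i)"
      by (auto simp: square_tuples_def monics_below_def PiE_def Pi_def intro!: monic_prod)
    then show "0 \<le> tuple_term N k f"
      by (intro mult_nonneg_nonneg prod_nonneg) (auto simp: char_sum_nonneg)
  qed
  finally show ?thesis .
qed

text \<open>With \<open>K\<close> edges and \<open>V\<close> the sum of \<open>1 / |l|\<close> over rough \<open>l\<close>, the sum over all tuples of rough labels is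
  \<open>V ^ K\<close>, and \<open>V\<close> is at least a constant times \<open>y - w\<close>. Two losses have to be subtracted: the tuples
  whose product is divisible by some \<open>P\<^sup>2\<close>, and the \<open>D\<close> not prime to the product. Each is at most a
  constant depending on \<open>K\<close> times \<open>V ^ K\<close> times the sum of \<open>1 / |P|\<^sup>2\<close> over the primes of degree greater
  than \<open>B\<close>, and \<open>B\<close> is chosen to make both together at most half of the main term.\<close>

lemma sum_square_tuples_lower:
  assumes q: "CARD('a::{field,finite}) \<ge> 3" and k: "k > 0"
  shows "\<exists>c>0. \<exists>w. \<forall>N x y. w < y \<longrightarrow> k * (k + 1) * y \<le> x \<longrightarrow>
    c * real (y - w) ^ (k * (k + 1) div 2) * real (card (hyperelliptic_family N :: 'a poly set)) \<le>
    (\<Sum>f\<in>(square_tuples k x :: (nat \<Rightarrow> 'a poly) set). tuple_term N k f)"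
proof -
  let ?I = "pairs k"
  define K where "K = card ?I"
  \<comment> \<open>large enough that \<open>4 * K\<^sup>2 * (1 / (2 * q ^ B)) \<le> 1 / 2\<close>\<close>
  define B where "B = 4 * K ^ 2"
  have K1: "K \<ge> 1"
  proof -
    have "(0, 0) \<in> ?I" using k by (simp add: pairs_def)
    then show ?thesis unfolding K_def by (metis One_nat_def Suc_leI card_gt_0_iff empty_iff finite_pairs)
  qed
  have qB: "real CARD('a) ^ B \<ge> real (4 * K ^ 2)"
  proof -
    have "4 * K ^ 2 < 2 ^ B" unfolding B_def by (rule less_exp)
    also have "(2::nat) ^ B \<le> CARD('a) ^ B" using q by (intro power_mono) auto
    finally show ?thesis by (metis less_imp_le of_nat_le_iff of_nat_power)
  qed
  obtain w where w: "\<And>y. y \<ge> w \<Longrightarrow> real (y - w) / real CARD('a) ^ w \<le> (\<Sum>l\<in>(rough B y :: 'a poly set). inorm l)"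
    using rough_sum_lower[where B = B and 'a = 'a] by blast
  define c where "c = (1 / real CARD('a) ^ w) ^ K / 2"
  have c0: "c > 0" by (simp add: c_def)
  have "c * real (y - w) ^ K * real (card (hyperelliptic_family N :: 'a poly set)) \<le>
    (\<Sum>f\<in>(square_tuples k x :: (nat \<Rightarrow> 'a poly) set). tuple_term N k f)"
    if y: "w < y" and x: "k * (k + 1) * y \<le> x" for N x y
  proof -
    define U where "U = (rough B y :: 'a poly set)"
    define V where "V = (\<Sum>l\<in>U. inorm l)"
    define T where "T = PiE ?I (\<lambda>_. U)"
    define M where "M l = (\<Prod>p\<in>?I. inorm (l p))" for l :: "nat \<times> nat \<Rightarrow> 'a poly"
    define pr where "pr l = (\<Prod>p\<in>?I. l p)" for l :: "nat \<times> nat \<Rightarrow> 'a poly"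
    define h where "h = real (card (hyperelliptic_family N :: 'a poly set))"
    define S where "S = {P :: 'a poly. monic_prime P \<and> B < degree P \<and> degree P \<le> K * y}"
    have finU: "finite U" by (simp add: U_def)
    have finT: "finite T" unfolding T_def by (intro finite_PiE) (auto simp: finU)
    have V0: "V \<ge> 0" unfolding V_def by (intro sum_nonneg) simp
    have M0: "M l \<ge> 0" for l unfolding M_def by (intro prod_nonneg) simp
    have h0: "h \<ge> 0" by (simp add: h_def)
    have fS: "finite S"
      using finite_subset[OF _ finite_polys_degree_le[of "K * y"], of S] by (auto simp: S_def)
    have Tm: "monic (l p)" "degree (l p) < y" "l p \<in> U" if "l \<in> T" "p \<in> ?I" for l p
    proof -
      show "l p \<in> U" using that PiE_mem unfolding T_def by metis
      then show "monic (l p)" "degree (l p) < y" by (auto simp: U_def rough_def monics_below_def)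
    qed
    have Pim: "monic (pr l)" if "l \<in> T" for l
      unfolding pr_def using Tm[OF that] by (intro monic_prod) auto
    have Pi_prime: "P \<in> S" if l: "l \<in> T" and P: "monic_prime P" "P dvd pr l" for l P
    proof -
      obtain p where p: "p \<in> ?I" "P dvd l p" using P monic_prime_dvd_prod[OF finite_pairs P(1)] unfolding pr_def by blast
      have "B < degree P" using Tm(3)[OF l p(1)] P(1) p(2) by (auto simp: U_def rough_def)
      moreover have "degree P \<le> degree (l p)"
        using p(2) monic_nz[OF Tm(1)[OF l p(1)]] by (rule dvd_imp_degree_le)
      moreover have "degree (l p) \<le> K * y" using Tm(2)[OF l p(1)] K1 by (cases K) auto
      ultimately show ?thesis using P by (simp add: S_def)
    qed
    have Sm: "monic_prime P" "monic P" if "P \<in> S" for P using that by (auto simp: S_def monic_prime_def)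
    have mult: "(\<Sum>l\<in>U. inorm l * of_bool (d dvd l)) \<le> inorm d * V" if "monic d" for d
      unfolding V_def U_def by (rule rough_multiples[OF that])
    have all: "(\<Sum>l\<in>U. inorm l * of_bool True) \<le> 1 * V" by (simp add: V_def)
    have one: "(\<Sum>l\<in>T. M l * of_bool (d dvd l a)) \<le> inorm d * V ^ K" if a: "a \<in> ?I" and d: "monic d" for a d
    proof -
      have "(\<Sum>l\<in>T. M l * of_bool (d dvd l a)) = (\<Sum>l\<in>T. M l * of_bool (\<forall>p\<in>?I. p = a \<longrightarrow> d dvd l p))"
        using a by (intro sum.cong refl) auto
      also have "\<dots> \<le> (\<Prod>p\<in>?I. if p = a then inorm d else 1) * V ^ card ?I"
        unfolding T_def M_def using mult[OF d] all by (intro sum_PiE_inorm_cond finite_pairs finU) auto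
      finally show ?thesis using a by (simp add: K_def)
    qed
    have two: "(\<Sum>l\<in>T. M l * of_bool (P dvd l a \<and> P dvd l b)) \<le> inorm P ^ 2 * V ^ K"
      if ab: "a \<in> ?I" "b \<in> ?I - {a}" and P: "monic P" for a b P
    proof -
      have "(\<Sum>l\<in>T. M l * of_bool (P dvd l a \<and> P dvd l b)) = (\<Sum>l\<in>T. M l * of_bool (\<forall>p\<in>?I. p = a \<or> p = b \<longrightarrow> P dvd l p))"
        using ab by (intro sum.cong refl) auto
      also have "\<dots> \<le> (\<Prod>p\<in>?I. if p = a \<or> p = b then inorm P else 1) * V ^ card ?I"
        unfolding T_def M_def
      proof (intro sum_PiE_inorm_cond finite_pairs finU)
        fix p
        show "(\<Sum>l\<in>U. inorm l * of_bool (p = a \<or> p = b \<longrightarrow> P dvd l)) \<le> (if p = a \<or> p = b then inorm P else 1) * V"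
          using mult[OF P] all by (cases "p = a \<or> p = b") simp_all
      qed
      also have "(\<Prod>p\<in>?I. if p = a \<or> p = b then inorm P else 1) = (\<Prod>p\<in>{a, b}. inorm P)"
        using ab by (intro prod.mono_neutral_cong_right) auto
      also have "(\<Prod>p\<in>{a, b}. inorm P) = inorm P ^ 2"
      proof -
        have "a \<noteq> b" using ab by blast
        then show ?thesis by (simp add: power2_eq_square)
      qed
      finally show ?thesis by (simp add: K_def)
    qed
    have sum1: "(\<Sum>l\<in>T. M l * of_bool (P dvd pr l)) \<le> real K * (inorm P * V ^ K)" if P: "P \<in> S" for P
    proof -
      have "of_bool (P dvd pr l) \<le> (\<Sum>a\<in>?I. of_bool (P dvd l a) :: real)" for l
      proof (cases "P dvd pr l")
        case True
        then obtain a where a: "a \<in> ?I" "P dvd l a"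
          using monic_prime_dvd_prod[OF finite_pairs Sm(1)[OF P]] unfolding pr_def by blast
        then show ?thesis
          using member_le_sum[of a ?I "\<lambda>a. of_bool (P dvd l a) :: real"] by simp
      qed (simp add: sum_nonneg)
      then have "(\<Sum>l\<in>T. M l * of_bool (P dvd pr l)) \<le> (\<Sum>l\<in>T. M l * (\<Sum>a\<in>?I. of_bool (P dvd l a)))"
        by (intro sum_mono mult_left_mono M0)
      also have "\<dots> = (\<Sum>a\<in>?I. \<Sum>l\<in>T. M l * of_bool (P dvd l a))"
        unfolding sum_distrib_left by (rule sum.swap)
      also have "\<dots> \<le> (\<Sum>a\<in>?I. inorm P * V ^ K)" by (intro sum_mono one Sm(2)[OF P])
      finally show ?thesis by (simp add: K_def)
    qed
    have sum2: "(\<Sum>l\<in>T. M l * of_bool (P ^ 2 dvd pr l)) \<le> real (K + K ^ 2) * (inorm P ^ 2 * V ^ K)" if P: "P \<in> S" for P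
    proof -
      let ?s1 = "\<lambda>l. \<Sum>a\<in>?I. of_bool (P ^ 2 dvd l a) :: real"
      let ?s2 = "\<lambda>l. \<Sum>a\<in>?I. \<Sum>b\<in>?I - {a}. of_bool (P dvd l a \<and> P dvd l b) :: real"
      have nn: "?s1 l \<ge> 0" "?s2 l \<ge> 0" for l by (auto intro!: sum_nonneg)
      have "of_bool (P ^ 2 dvd pr l) \<le> ?s1 l + ?s2 l" for l
      proof (cases "P ^ 2 dvd pr l")
        case True
        from square_dvd_prod[OF Sm(1)[OF P] finite_pairs True[unfolded pr_def]] show ?thesis
        proof (elim disjE bexE)
          fix a assume "a \<in> ?I" "P ^ 2 dvd l a"
          then have "?s1 l \<ge> 1" using member_le_sum[of a ?I "\<lambda>a. of_bool (P ^ 2 dvd l a) :: real"] by simp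
          then show ?thesis using nn[of l] by simp
        next
          fix a b assume ab: "a \<in> ?I" "b \<in> ?I - {a}" "P dvd l a \<and> P dvd l b"
          have "(1 :: real) \<le> (\<Sum>b\<in>?I - {a}. of_bool (P dvd l a \<and> P dvd l b))"
            using ab member_le_sum[of b "?I - {a}" "\<lambda>b. of_bool (P dvd l a \<and> P dvd l b) :: real"] by simp
          also have "\<dots> \<le> ?s2 l"
            using ab(1) by (intro member_le_sum[of a ?I "\<lambda>a. \<Sum>b\<in>?I - {a}. of_bool (P dvd l a \<and> P dvd l b) :: real"]) (auto intro!: sum_nonneg)
          finally show ?thesis using nn[of l] by simp
        qed
      qed (use nn[of l] in simp)
      then have "(\<Sum>l\<in>T. M l * of_bool (P ^ 2 dvd pr l)) \<le> (\<Sum>l\<in>T. M l * (?s1 l + ?s2 l))"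
        by (intro sum_mono mult_left_mono M0)
      also have "\<dots> = (\<Sum>l\<in>T. M l * ?s1 l) + (\<Sum>l\<in>T. M l * ?s2 l)"
        by (simp add: distrib_left sum.distrib)
      also have "(\<Sum>l\<in>T. M l * ?s1 l) = (\<Sum>a\<in>?I. \<Sum>l\<in>T. M l * of_bool (P ^ 2 dvd l a))"
        unfolding sum_distrib_left by (rule sum.swap)
      also have "\<dots> \<le> (\<Sum>a\<in>?I. inorm (P ^ 2) * V ^ K)" by (intro sum_mono one monic_power Sm(2)[OF P])
      also have "\<dots> = real K * (inorm P ^ 2 * V ^ K)"
        using Sm(2)[OF P] by (simp add: K_def power2_eq_square inorm_mult)
      also have "(\<Sum>l\<in>T. M l * ?s2 l) = (\<Sum>a\<in>?I. \<Sum>b\<in>?I - {a}. \<Sum>l\<in>T. M l * of_bool (P dvd l a \<and> P dvd l b))"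
        unfolding sum_distrib_left by (subst sum.swap) (intro sum.cong refl sum.swap)
      also have "\<dots> \<le> (\<Sum>a\<in>?I. \<Sum>b\<in>?I - {a}. inorm P ^ 2 * V ^ K)"
        by (intro sum_mono two Sm(2)[OF P])
      also have "\<dots> \<le> (\<Sum>a\<in>?I. \<Sum>b\<in>?I. inorm P ^ 2 * V ^ K)"
        using V0 by (intro sum_mono sum_mono2) auto
      also have "\<dots> = real (K ^ 2) * (inorm P ^ 2 * V ^ K)" by (simp add: K_def power2_eq_square)
      finally show ?thesis by (simp add: distrib_right)
    qed
    \<comment> \<open>an upper bound for the lost proportion, valid for every \<open>l\<close>\<close>
    let ?bad = "\<lambda>l. (\<Sum>P\<in>S. of_bool (P ^ 2 dvd pr l)) + 2 * (\<Sum>P\<in>S. inorm P * of_bool (P dvd pr l)) :: real"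
    have point: "M l * h * (1 - ?bad l) \<le>
        (if squarefree_labels k l then M l * real_of_int (char_sum N (pr l ^ 2)) else 0)" if l: "l \<in> T" for l
    proof -
      have nz: "pr l \<noteq> 0" using Pim[OF l] by (rule monic_nz)
      have nn: "(\<Sum>P\<in>S. of_bool (P ^ 2 dvd pr l)) \<ge> (0::real)" "(\<Sum>P\<in>S. inorm P * of_bool (P dvd pr l)) \<ge> 0"
        by (auto intro!: sum_nonneg)
      show ?thesis
      proof (cases "squarefree_labels k l")
        case True
        have "(\<Sum>P\<in>prime_divs (pr l ^ 2). inorm P) = (\<Sum>P\<in>S. inorm P * of_bool (P dvd pr l))"
          unfolding prime_divs_square using fS Pi_prime[OF l]
          by (intro sum.mono_neutral_cong_left) (auto simp: prime_divs_def S_def)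
        then have "h * (1 - 2 * (\<Sum>P\<in>S. inorm P * of_bool (P dvd pr l))) \<le> real_of_int (char_sum N (pr l ^ 2))"
          using char_sum_square_lower[OF q, of "pr l ^ 2" N] Pim[OF l] by (simp add: h_def monic_power square_like_square)
        moreover have "h * (1 - ?bad l) \<le> h * (1 - 2 * (\<Sum>P\<in>S. inorm P * of_bool (P dvd pr l)))"
          using nn h0 by (intro mult_left_mono) auto
        ultimately have "M l * (h * (1 - ?bad l)) \<le> M l * real_of_int (char_sum N (pr l ^ 2))"
          by (intro mult_left_mono M0) linarith
        then show ?thesis using True by (simp add: mult.assoc)
      next
        case False
        then have "\<not> squarefree (pr l)" using Tm[OF l] by (auto simp: squarefree_labels_def pr_def)
        then obtain P where P: "monic_prime P" "P ^ 2 dvd pr l" using squarefree_iff_monic_prime[OF nz] by blast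
        then have "P dvd pr l" by (metis dvd_power dvd_trans pos2)
        then have "P \<in> S" using Pi_prime[OF l P(1)] by blast
        then have "(\<Sum>P\<in>S. of_bool (P ^ 2 dvd pr l)) \<ge> (1::real)"
          using member_le_sum[of P S "\<lambda>P. of_bool (P ^ 2 dvd pr l) :: real"] fS P by simp
        then have "M l * h * (1 - ?bad l) \<le> 0"
          using nn M0 h0 by (intro mult_nonneg_nonpos mult_nonneg_nonneg) auto
        then show ?thesis using False by simp
      qed
    qed
    have bad: "(\<Sum>l\<in>T. M l * ?bad l) \<le> V ^ K / 2"
    proof -
      define Z where "Z = (\<Sum>P\<in>S. inorm P ^ 2)"
      have "(\<Sum>l\<in>T. M l * ?bad l) = (\<Sum>l\<in>T. M l * (\<Sum>P\<in>S. of_bool (P ^ 2 dvd pr l))) + 2 * (\<Sum>l\<in>T. M l * (\<Sum>P\<in>S. inorm P * of_bool (P dvd pr l)))"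
        by (simp add: distrib_left sum.distrib sum_distrib_left mult_ac)
      also have "(\<Sum>l\<in>T. M l * (\<Sum>P\<in>S. of_bool (P ^ 2 dvd pr l))) = (\<Sum>P\<in>S. \<Sum>l\<in>T. M l * of_bool (P ^ 2 dvd pr l))"
        unfolding sum_distrib_left by (rule sum.swap)
      also have "\<dots> \<le> (\<Sum>P\<in>S. real (K + K ^ 2) * (inorm P ^ 2 * V ^ K))" by (intro sum_mono sum2)
      also have "(\<Sum>l\<in>T. M l * (\<Sum>P\<in>S. inorm P * of_bool (P dvd pr l))) = (\<Sum>P\<in>S. inorm P * (\<Sum>l\<in>T. M l * of_bool (P dvd pr l)))"
        unfolding sum_distrib_left by (subst sum.swap) (simp add: mult_ac)
      also have "\<dots> \<le> (\<Sum>P\<in>S. inorm P * (real K * (inorm P * V ^ K)))" by (intro sum_mono mult_left_mono sum1) auto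
      also have "(\<Sum>P\<in>S. real (K + K ^ 2) * (inorm P ^ 2 * V ^ K)) = real (K + K ^ 2) * V ^ K * Z"
        unfolding Z_def sum_distrib_left by (intro sum.cong refl) simp
      also have "(\<Sum>P\<in>S. inorm P * (real K * (inorm P * V ^ K))) = real K * V ^ K * Z"
        unfolding Z_def sum_distrib_left by (intro sum.cong refl) (simp add: power2_eq_square)
      finally have "(\<Sum>l\<in>T. M l * ?bad l) \<le> real (K + K ^ 2) * V ^ K * Z + 2 * (real K * V ^ K * Z)"
        by linarith
      also have "\<dots> = (real (K + K ^ 2) + 2 * real K) * V ^ K * Z" by (simp add: algebra_simps)
      also have "\<dots> \<le> real (4 * K ^ 2) * V ^ K * (1 / (2 * real CARD('a) ^ B))"
      proof (intro mult_mono)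
        have "K \<le> K ^ 2" using K1 by (simp add: power2_eq_square)
        then show "real (K + K ^ 2) + 2 * real K \<le> real (4 * K ^ 2)" by linarith
        show "Z \<le> 1 / (2 * real CARD('a) ^ B)" unfolding Z_def
          by (rule sum_inorm_square[OF q, where Z = "K * y"]) (auto simp: S_def monic_prime_def)
      qed (use V0 in \<open>auto simp: Z_def intro!: sum_nonneg\<close>)
      also have "\<dots> = V ^ K / 2 * (real (4 * K ^ 2) / real CARD('a) ^ B)" by simp
      also have "\<dots> \<le> V ^ K / 2 * 1" using qB V0 by (intro mult_left_mono) (auto simp: divide_le_eq)
      finally show ?thesis by simp
    qed
    have "(\<Sum>l\<in>T. M l) = V ^ K"
      unfolding T_def M_def V_def K_def
      using prod_sum_PiE[of ?I "\<lambda>_. U" "\<lambda>_ l. inorm l"] finU by simp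
    then have "h * (V ^ K / 2) \<le> h * ((\<Sum>l\<in>T. M l) - (\<Sum>l\<in>T. M l * ?bad l))"
      using bad h0 by (intro mult_left_mono) auto
    also have "\<dots> = (\<Sum>l\<in>T. M l * h * (1 - ?bad l))"
      unfolding sum_subtractf[symmetric] sum_distrib_left by (intro sum.cong refl) (simp add: algebra_simps)
    also have "\<dots> \<le> (\<Sum>l\<in>T. if squarefree_labels k l then M l * real_of_int (char_sum N (pr l ^ 2)) else 0)"
      by (intro sum_mono point)
    also have "\<dots> = (\<Sum>l\<in>{l \<in> T. squarefree_labels k l}. M l * real_of_int (char_sum N (pr l ^ 2)))"
      using finT by (simp add: sum.inter_filter)
    also have "\<dots> \<le> (\<Sum>f\<in>(square_tuples k x :: (nat \<Rightarrow> 'a poly) set). tuple_term N k f)"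
      unfolding M_def pr_def T_def U_def using y by (intro sum_square_tuples_ge_labels x k) simp
    finally have "h * (V ^ K / 2) \<le> (\<Sum>f\<in>(square_tuples k x :: (nat \<Rightarrow> 'a poly) set). tuple_term N k f)" .
    moreover have "c * real (y - w) ^ K * h \<le> h * (V ^ K / 2)"
    proof -
      have "(real (y - w) / real CARD('a) ^ w) ^ K \<le> V ^ K"
        using w[of y] y by (intro power_mono) (auto simp: V_def U_def)
      then have "c * real (y - w) ^ K \<le> V ^ K / 2" by (simp add: c_def power_divide)
      then show ?thesis using h0 by (metis mult.commute mult_left_mono)
    qed
    ultimately show ?thesis unfolding h_def by linarith
  qed
  then show ?thesis using c0 unfolding K_def card_pairs by blast
qed

section \<open>Moments of the short sums\<close>

lemma quad_char_prod:
  "finite S \<Longrightarrow> (\<And>i. i \<in> S \<Longrightarrow> monic (f i)) \<Longrightarrow> quad_char D (prod f S) = (\<Prod>i\<in>S. quad_char D (f i))"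
  by (induction S rule: finite_induct) (auto simp: quad_char_1 quad_char_mult monic_prod)

definition tuples :: "nat \<Rightarrow> (nat \<Rightarrow> nat) \<Rightarrow> (nat \<Rightarrow> 'a::{field,finite} poly) set" where
  "tuples k Y = PiE {..<k} (\<lambda>i. monics_below (Y i))"

lemma finite_tuples [simp]: "finite (tuples k Y)"
  unfolding tuples_def by (intro finite_PiE) simp_all

lemma tuples_monic: "f \<in> tuples k Y \<Longrightarrow> i < k \<Longrightarrow> monic (f i)"
  by (auto simp: tuples_def monics_below_def PiE_def Pi_def)

lemma tuples_monic_prod: "f \<in> tuples k Y \<Longrightarrow> monic (\<Prod>i<k. f i)"
  by (intro monic_prod) (simp add: tuples_monic)

lemma sum_prod_short_L:
  "(\<Sum>D\<in>(hyperelliptic_family N :: 'a::{field,finite} poly set). \<Prod>i<k. short_L (Y i) D) =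
    (\<Sum>f\<in>(tuples k Y :: (nat \<Rightarrow> 'a poly) set). tuple_term N k f)"
proof -
  have "(\<Prod>i<k. short_L (Y i) D) = (\<Sum>f\<in>tuples k Y. (\<Prod>i<k. wt (f i)) * real_of_int (quad_char D (\<Prod>i<k. f i)))"
    for D :: "'a poly"
  proof -
    have "(\<Prod>i<k. short_L (Y i) D) = (\<Sum>f\<in>tuples k Y. \<Prod>i<k. real_of_int (quad_char D (f i)) * wt (f i))"
      unfolding short_L_def tuples_def by (rule prod_sum_PiE) simp_all
    also have "\<dots> = (\<Sum>f\<in>tuples k Y. (\<Prod>i<k. wt (f i)) * real_of_int (quad_char D (\<Prod>i<k. f i)))"
    proof (rule sum.cong[OF refl])
      fix f :: "nat \<Rightarrow> 'a poly" assume f: "f \<in> tuples k Y"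
      have "quad_char D (\<Prod>i<k. f i) = (\<Prod>i<k. quad_char D (f i))"
        using tuples_monic[OF f] by (intro quad_char_prod) auto
      then show "(\<Prod>i<k. real_of_int (quad_char D (f i)) * wt (f i)) = (\<Prod>i<k. wt (f i)) * real_of_int (quad_char D (\<Prod>i<k. f i))"
        by (simp add: prod.distrib mult.commute)
    qed
    finally show ?thesis .
  qed
  then have "(\<Sum>D\<in>(hyperelliptic_family N :: 'a poly set). \<Prod>i<k. short_L (Y i) D) =
      (\<Sum>D\<in>hyperelliptic_family N. \<Sum>f\<in>(tuples k Y :: (nat \<Rightarrow> 'a poly) set). (\<Prod>i<k. wt (f i)) * real_of_int (quad_char D (\<Prod>i<k. f i)))"
    by simp
  also have "\<dots> = (\<Sum>f\<in>(tuples k Y :: (nat \<Rightarrow> 'a poly) set). tuple_term N k f)"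
    unfolding char_sum_def by (subst sum.swap) (simp only: sum_distrib_left of_int_sum)
  finally show ?thesis .
qed

lemma omega_mult_le: "monic f \<Longrightarrow> monic g \<Longrightarrow> \<omega> (f * g) \<le> \<omega> f + \<omega> g"
  unfolding \<omega>_def prime_divs_mult by (rule card_Un_le)

lemma omega_prod_le:
  "finite S \<Longrightarrow> (\<And>i. i \<in> S \<Longrightarrow> monic (f i)) \<Longrightarrow> \<omega> (prod f S) \<le> (\<Sum>i\<in>S. \<omega> (f i))"
proof (induction S rule: finite_induct)
  case empty
  have "prime_divs (1 :: 'b poly) = {}" using monic_prime_not_1 by (auto simp: prime_divs_def)
  then show ?case by (simp add: \<omega>_def)
next
  case (insert x S)
  have "\<omega> (prod f (insert x S)) \<le> \<omega> (f x) + \<omega> (prod f S)"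
    using insert omega_mult_le[of "f x" "prod f S"] monic_prod[of S f] by simp
  then show ?case using insert by simp
qed

text \<open>A set of primes dividing \<open>f\<close> gives a monic divisor of \<open>f\<close>, so \<open>2 ^ \<omega> f\<close> is at most the number of those;
  the divisors are counted by exchanging the summations.\<close>

lemma sum_two_power_omega:
  "(\<Sum>f\<in>(monic_polys n :: 'a::{field,finite} poly set). 2 ^ \<omega> f) \<le> real (n + 1) * real CARD('a) ^ n"
proof -
  let ?M = "monics_below (n + 1) :: 'a poly set"
  have le: "(2 :: nat) ^ \<omega> f \<le> card {d \<in> ?M. d dvd f}" if f: "f \<in> monic_polys n" for f :: "'a poly"
  proof -
    have f0: "f \<noteq> 0" "degree f = n" using f by (auto simp: monic_polys_def monic_nz)
    have ps: "prime_set T" if "T \<in> Pow (prime_divs f)" for T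
      using that prime_set_prime_divs[OF f0(1)] finite_subset by (auto simp: prime_set_def)
    have "2 ^ \<omega> f = card (Pow (prime_divs f))" using f0 by (simp add: \<omega>_def card_Pow)
    also have "\<dots> = card ((\<lambda>T. \<Prod>T) ` Pow (prime_divs f))"
      by (rule card_image[symmetric], rule inj_on_inverseI[of _ prime_divs], rule prime_divs_Prod[OF ps])
    also have "\<dots> \<le> card {d \<in> ?M. d dvd f}"
    proof (rule card_mono)
      show "(\<lambda>T. \<Prod>T) ` Pow (prime_divs f) \<subseteq> {d \<in> ?M. d dvd f}"
      proof
        fix d assume "d \<in> (\<lambda>T. \<Prod>T) ` Pow (prime_divs f)"
        then obtain T where T: "T \<in> Pow (prime_divs f)" "d = \<Prod>T" by blast
        have "\<Prod>T dvd f" using T(1) unfolding Prod_dvd_iff[OF ps[OF T(1)]] by (auto simp: prime_divs_def)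
        moreover from this have "degree (\<Prod>T) \<le> n" using dvd_imp_degree_le f0 by blast
        ultimately show "d \<in> {d \<in> ?M. d dvd f}" using T(2) monic_Prod[OF ps[OF T(1)]] by (simp add: monics_below_def)
      qed
    qed simp
    finally show ?thesis .
  qed
  have "(\<Sum>f\<in>(monic_polys n :: 'a poly set). 2 ^ \<omega> f) = real (\<Sum>f\<in>(monic_polys n :: 'a poly set). 2 ^ \<omega> f)"
    by simp
  also have "\<dots> \<le> real (\<Sum>f\<in>(monic_polys n :: 'a poly set). card {d \<in> ?M. d dvd f})"
    by (intro of_nat_mono sum_mono le)
  also have "(\<Sum>f\<in>(monic_polys n :: 'a poly set). card {d \<in> ?M. d dvd f}) = (\<Sum>d\<in>?M. card {f \<in> monic_polys n. d dvd f})"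
    by (rule sum_card_swap) (simp_all add: finite_monic_polys)
  also have "real \<dots> \<le> (\<Sum>d\<in>?M. real CARD('a) ^ n * inorm d)"
    unfolding of_nat_sum by (intro sum_mono count_multiples_le) (simp add: monics_below_def)
  also have "\<dots> = real (n + 1) * real CARD('a) ^ n"
    by (simp add: sum_distrib_left[symmetric] sum_inorm)
  finally show ?thesis .
qed

lemma sum_weighted_omega:
  fixes b :: real
  assumes b: "b \<ge> 1" "b ^ 4 = real CARD('a::{field,finite})"
  shows "(\<Sum>f\<in>(monics_below y :: 'a poly set). wt f * (b ^ degree f * 2 ^ \<omega> f)) \<le> real y ^ 2 * b ^ (3 * y)"
proof -
  have b2: "sqrt (real CARD('a)) = b ^ 2"
    using b by (intro real_sqrt_unique) (auto simp: power_mult[symmetric])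
  have "(\<Sum>f\<in>(monics_below y :: 'a poly set). wt f * (b ^ degree f * 2 ^ \<omega> f)) =
      (\<Sum>n<y. \<Sum>f\<in>(monic_polys n :: 'a poly set). (1 / b ^ n) * 2 ^ \<omega> f)"
    unfolding sum_monics_below
  proof (intro sum.cong refl)
    fix n and f :: "'a poly" assume "f \<in> monic_polys n"
    then have "degree f = n" by (simp add: monic_polys_def)
    moreover have "(1 / b ^ 2) ^ n * b ^ n = 1 / b ^ n"
      using b(1) by (simp add: power_divide power_mult[symmetric] power_mult_distrib power2_eq_square)
    ultimately show "wt f * (b ^ degree f * 2 ^ \<omega> f) = (1 / b ^ n) * 2 ^ \<omega> f"
      by (simp only: wt_def b2 mult.assoc[symmetric])
  qed
  also have "\<dots> = (\<Sum>n<y. (1 / b ^ n) * (\<Sum>f\<in>(monic_polys n :: 'a poly set). 2 ^ \<omega> f))"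
    by (simp only: sum_distrib_left)
  also have "\<dots> \<le> (\<Sum>n<y. (1 / b ^ n) * (real (n + 1) * (b ^ 4) ^ n))"
    unfolding b(2) using b(1) by (intro sum_mono mult_left_mono sum_two_power_omega) simp
  also have "\<dots> \<le> (\<Sum>n<y. real y * b ^ (3 * y))"
  proof (intro sum_mono)
    fix n assume n: "n \<in> {..<y}"
    have "(b ^ 4) ^ n = b ^ n * b ^ (3 * n)" by (simp add: power_mult[symmetric] power_add[symmetric])
    then have "(1 / b ^ n) * (real (n + 1) * (b ^ 4) ^ n) = real (n + 1) * b ^ (3 * n)" using b(1) by simp
    also have "\<dots> \<le> real y * b ^ (3 * y)"
      using n b(1) by (intro mult_mono power_increasing) auto
    finally show "(1 / b ^ n) * (real (n + 1) * (b ^ 4) ^ n) \<le> real y * b ^ (3 * y)" .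
  qed
  also have "\<dots> = real y ^ 2 * b ^ (3 * y)" by (simp add: power2_eq_square)
  finally show ?thesis .
qed

text \<open>The bound of \<open>family_character_sum\<close> for \<open>\<Prod>f\<close> is at most a product over the entries of \<open>f\<close>, because
  \<open>\<omega>\<close> is subadditive; the sum over tuples then factors.\<close>

lemma off_diagonal_bound:
  fixes b :: real
  assumes two: "(2 :: 'a::{field,finite}) \<noteq> 0" and b: "b \<ge> 1" "b ^ 4 = real CARD('a)"
  shows "\<bar>\<Sum>f\<in>{f \<in> tuples k Y. \<not> square_like (\<Prod>i<k. f i :: 'a poly)}. tuple_term N k f\<bar>
    \<le> real (N + 1) * b ^ (2 * N) * (\<Prod>i<k. real (Y i) ^ 2 * b ^ (3 * Y i))"
proof -
  let ?T = "tuples k Y :: (nat \<Rightarrow> 'a poly) set"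
  define C where "C = real (N + 1) * b ^ (2 * N)"
  have C0: "C \<ge> 0" using b by (simp add: C_def)
  let ?u = "\<lambda>f :: 'a poly. wt f * (b ^ degree f * 2 ^ \<omega> f)"
  have u0: "?u f \<ge> 0" for f using b by simp
  have term_le: "\<bar>tuple_term N k f\<bar> \<le> C * (\<Prod>i<k. ?u (f i))"
    if f: "f \<in> ?T" and ns: "\<not> square_like (\<Prod>i<k. f i)" for f
  proof -
    have "\<bar>real_of_int (char_sum N (\<Prod>i<k. f i))\<bar> \<le> C * (b ^ degree (\<Prod>i<k. f i) * 2 ^ \<omega> (\<Prod>i<k. f i))"
      unfolding char_sum_def C_def
      using family_character_sum[OF two tuples_monic_prod[OF f] ns _ b(2)] b(1) by (simp add: mult.assoc)
    also have "\<dots> \<le> C * (b ^ (\<Sum>i<k. degree (f i)) * 2 ^ (\<Sum>i<k. \<omega> (f i)))"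
      using b C0 tuples_monic[OF f] omega_prod_le[of "{..<k}" f] monic_degree_prod[of "{..<k}" f]
      by (intro mult_left_mono mult_mono power_increasing) auto
    also have "\<dots> = C * (\<Prod>i<k. b ^ degree (f i) * 2 ^ \<omega> (f i))"
      by (simp add: power_sum prod.distrib)
    finally have "(\<Prod>i<k. wt (f i)) * \<bar>real_of_int (char_sum N (\<Prod>i<k. f i))\<bar> \<le>
        (\<Prod>i<k. wt (f i)) * (C * (\<Prod>i<k. b ^ degree (f i) * 2 ^ \<omega> (f i)))"
      by (intro mult_left_mono prod_nonneg) simp_all
    moreover have "\<bar>\<Prod>i<k. wt (f i)\<bar> = (\<Prod>i<k. wt (f i))" by (intro abs_of_nonneg prod_nonneg) simp
    ultimately show ?thesis by (simp only: abs_mult prod.distrib mult_ac)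
  qed
  have "\<bar>\<Sum>f\<in>{f \<in> ?T. \<not> square_like (\<Prod>i<k. f i)}. tuple_term N k f\<bar>
      \<le> (\<Sum>f\<in>{f \<in> ?T. \<not> square_like (\<Prod>i<k. f i)}. C * (\<Prod>i<k. ?u (f i)))"
    by (rule order_trans[OF sum_abs sum_mono]) (use term_le in blast)
  also have "\<dots> \<le> (\<Sum>f\<in>?T. C * (\<Prod>i<k. ?u (f i)))"
    by (rule sum_mono2[OF finite_tuples _ mult_nonneg_nonneg[OF C0 prod_nonneg[OF u0]]]) blast
  also have "\<dots> = C * (\<Prod>i<k. \<Sum>f\<in>monics_below (Y i). ?u f)"
    unfolding sum_distrib_left[symmetric] tuples_def by (subst prod_sum_PiE) simp_all
  also have "\<dots> \<le> C * (\<Prod>i<k. real (Y i) ^ 2 * b ^ (3 * Y i))"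
    using C0 u0 by (intro mult_left_mono prod_mono conjI sum_nonneg sum_weighted_omega b) auto
  finally show ?thesis unfolding C_def .
qed

lemma tuples_split:
  "(\<Sum>f\<in>(tuples k Y :: (nat \<Rightarrow> 'a::{field,finite} poly) set). F f) =
    (\<Sum>f\<in>{f \<in> tuples k Y. square_like (\<Prod>i<k. f i)}. F f) + (\<Sum>f\<in>{f \<in> tuples k Y. \<not> square_like (\<Prod>i<k. f i)}. (F f :: real))"
proof -
  have "(\<Sum>f\<in>(tuples k Y :: (nat \<Rightarrow> 'a poly) set). F f) = (\<Sum>f\<in>{f \<in> tuples k Y. square_like (\<Prod>i<k. f i)} \<union> {f \<in> tuples k Y. \<not> square_like (\<Prod>i<k. f i)}. F f)"
    by (rule sum.cong) auto
  also have "\<dots> = (\<Sum>f\<in>{f \<in> tuples k Y. square_like (\<Prod>i<k. f i)}. F f) + (\<Sum>f\<in>{f \<in> tuples k Y. \<not> square_like (\<Prod>i<k. f i)}. F f)"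
  proof (rule sum.union_disjoint)
    show "finite {f \<in> (tuples k Y :: (nat \<Rightarrow> 'a poly) set). square_like (\<Prod>i<k. f i)}"
      "finite {f \<in> (tuples k Y :: (nat \<Rightarrow> 'a poly) set). \<not> square_like (\<Prod>i<k. f i)}"
      by (rule finite_subset[OF _ finite_tuples[of k Y]]; blast)+
  qed blast
  finally show ?thesis .
qed

lemma moment_upper:
  fixes b :: real
  assumes two: "(2 :: 'a::{field,finite}) \<noteq> 0" and b: "b \<ge> 1" "b ^ 4 = real CARD('a)"
  shows "(\<Sum>D\<in>(hyperelliptic_family N :: 'a poly set). short_L x D ^ k) \<le>
    real (card (hyperelliptic_family N :: 'a poly set)) * real x ^ (k * (k + 1) div 2) +
    real (N + 1) * b ^ (2 * N) * (\<Prod>i<k. real x ^ 2 * b ^ (3 * x))"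
proof -
  let ?F = "\<lambda>f :: nat \<Rightarrow> 'a poly. tuple_term N k f"
  let ?h = "real (card (hyperelliptic_family N :: 'a poly set))"
  let ?Q = "{f \<in> tuples k (\<lambda>_. x). square_like (\<Prod>i<k. f i :: 'a poly)}"
  have Q: "?Q = square_tuples k x" by (simp add: tuples_def square_tuples_def)
  have "(\<Sum>f\<in>?Q. ?F f) \<le> (\<Sum>f\<in>?Q. (\<Prod>i<k. wt (f i)) * ?h)"
    by (intro sum_mono mult_left_mono char_sum_le prod_nonneg) simp
  also have "\<dots> = (\<Sum>f\<in>?Q. \<Prod>i<k. wt (f i)) * ?h" by (simp only: sum_distrib_right)
  also have "\<dots> \<le> real x ^ (k * (k + 1) div 2) * ?h"
    unfolding Q by (intro mult_right_mono sum_square_tuples_upper) simp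
  finally have "(\<Sum>f\<in>?Q. ?F f) \<le> ?h * real x ^ (k * (k + 1) div 2)" by (simp only: mult.commute)
  moreover have "(\<Sum>D\<in>(hyperelliptic_family N :: 'a poly set). short_L x D ^ k) = (\<Sum>f\<in>tuples k (\<lambda>_. x). ?F f)"
    using sum_prod_short_L[where k = k and Y = "\<lambda>_. x" and N = N and 'a = 'a] by simp
  ultimately show ?thesis
    using tuples_split[where F = ?F and k = k and Y = "\<lambda>_. x"]
      off_diagonal_bound[OF two b, where k = k and Y = "\<lambda>_. x" and N = N] by linarith
qed

text \<open>One factor may be much longer than the others. On the diagonal only the tuples whose entries all have degree
  less than \<open>x\<close> are kept, the others being nonnegative.\<close>

lemma mixed_moment_lower:
  fixes b :: real
  assumes two: "(2 :: 'a::{field,finite}) \<noteq> 0" and b: "b \<ge> 1" "b ^ 4 = real CARD('a)"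
    and k: "k > 0" and xy: "x \<le> y"
  shows "(\<Sum>D\<in>(hyperelliptic_family N :: 'a poly set). short_L y D * short_L x D ^ (k - 1)) \<ge>
    (\<Sum>f\<in>(square_tuples k x :: (nat \<Rightarrow> 'a poly) set). tuple_term N k f) -
    real (N + 1) * b ^ (2 * N) * (real y ^ 2 * b ^ (3 * y) * (real x ^ 2 * b ^ (3 * x)) ^ (k - 1))"
proof -
  let ?F = "\<lambda>f :: nat \<Rightarrow> 'a poly. tuple_term N k f"
  define Y where "Y i = (if i = 0 then y else x)" for i :: nat
  let ?Q = "{f \<in> tuples k Y. square_like (\<Prod>i<k. f i :: 'a poly)}"
  have pr: "(\<Prod>i<k. g (Y i)) = g y * g x ^ (k - 1)" for g :: "nat \<Rightarrow> real"
  proof -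
    obtain k' where k': "k = Suc k'" using k by (cases k) auto
    show ?thesis unfolding k' by (subst prod.lessThan_Suc_shift) (simp add: Y_def)
  qed
  have "(\<Sum>f\<in>square_tuples k x. ?F f) \<le> (\<Sum>f\<in>?Q. ?F f)"
  proof (rule sum_mono2)
    show "finite ?Q" by (rule finite_subset[OF _ finite_tuples[of k Y]]) blast
    have "monics_below x \<subseteq> (monics_below (Y i) :: 'a poly set)" for i
      using xy by (auto simp: monics_below_def Y_def)
    then show "square_tuples k x \<subseteq> ?Q"
      unfolding square_tuples_def tuples_def by (auto simp: PiE_def Pi_def)
    fix f assume "f \<in> ?Q - square_tuples k x"
    then show "0 \<le> ?F f"
      by (intro mult_nonneg_nonneg prod_nonneg) (auto intro!: char_sum_nonneg tuples_monic_prod)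
  qed
  moreover have "(\<Sum>D\<in>(hyperelliptic_family N :: 'a poly set). short_L y D * short_L x D ^ (k - 1)) = (\<Sum>f\<in>tuples k Y. ?F f)"
  proof -
    have "(\<Prod>i<k. short_L (Y i) D) = short_L y D * short_L x D ^ (k - 1)" for D :: "'a poly" by (rule pr)
    then show ?thesis unfolding sum_prod_short_L[where k = k and Y = Y and N = N and 'a = 'a, symmetric] by simp
  qed
  ultimately show ?thesis
    using tuples_split[where F = ?F and k = k and Y = Y] off_diagonal_bound[OF two b, where k = k and Y = Y and N = N]
    unfolding pr[of "\<lambda>y. real y ^ 2 * b ^ (3 * y)"] by linarith
qed

section \<open>The lower bound\<close>

text \<open>Bernoulli's inequality for even exponents, at \<open>a / c\<close>. It plays the part of Hoelder's inequality in
  comparing the moments.\<close>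

lemma even_power_tangent:
  fixes a c :: real
  assumes "even k" "k > 0"
  shows "a ^ k \<ge> real k * a * c ^ (k - 1) - (real k - 1) * c ^ k"
proof (cases "c = 0")
  case True
  have "a ^ k \<ge> 0" using assms by (simp add: zero_le_even_power)
  then show ?thesis
    using True assms by (cases "k = 1") (auto simp: power_0_left)
next
  case False
  have ck: "c ^ k > 0" using assms False by (simp add: zero_less_power_eq)
  have e: "c ^ k = c * c ^ (k - 1)" using assms(2) by (cases k) auto
  have "1 + real k * (a / c - 1) \<le> (1 + (a / c - 1)) ^ k"
    by (rule Bernoulli_inequality_even[OF assms(1)])
  then have "(1 + real k * (a / c - 1)) * c ^ k \<le> (a / c) ^ k * c ^ k"
    using ck by (intro mult_right_mono) auto
  also have "(a / c) ^ k * c ^ k = a ^ k" using False by (simp add: power_divide)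
  also have "(1 + real k * (a / c - 1)) * c ^ k = real k * a * c ^ (k - 1) - (real k - 1) * c ^ k"
    unfolding e using False by (simp add: field_simps)
  finally show ?thesis .
qed

text \<open>On the left is the off-diagonal bound for one sum of length \<open>g + 1\<close> and \<open>k - 1\<close> short ones whose lengths
  times \<open>3\<close> add up to at most \<open>g div 2\<close>; on the right is \<open>q ^ N\<close> for \<open>N = 2 * g + 1\<close>, as \<open>q = b ^ 4\<close>. In
  the exponent of \<open>b\<close> this is \<open>7 * g + g / 2\<close> against \<open>8 * g\<close>.\<close>

lemma error_negligible:
  fixes b \<epsilon> :: real
  assumes b: "b > 1" and \<epsilon>: "\<epsilon> > 0"
  shows "\<forall>\<^sub>F g in sequentially. real (2 * g + 2) * b ^ (2 * (2 * g + 1)) * (real (g + 1) ^ (2 * k) * b ^ (3 * (g + 1) + g div 2))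
    \<le> \<epsilon> * b ^ (4 * (2 * g + 1))"
proof -
  have "((\<lambda>g::nat. real (2 * g + 2) * real (g + 1) ^ (2 * k) * b / b powr (real g / 2)) \<longlongrightarrow> 0) sequentially"
    using b by real_asymp
  then have "\<forall>\<^sub>F g in sequentially. real (2 * g + 2) * real (g + 1) ^ (2 * k) * b / b powr (real g / 2) < \<epsilon>"
    using \<epsilon> by (rule order_tendstoD)
  then show ?thesis
  proof eventually_elim
    case (elim g)
    have "b powr (real g / 2) \<le> b powr real (g - g div 2)"
      using b by (intro powr_mono) linarith+
    also have "\<dots> = b ^ (g - g div 2)" using b by (intro powr_realpow) simp
    finally have p: "b powr (real g / 2) \<le> b ^ (g - g div 2)" .
    have "real (2 * g + 2) * real (g + 1) ^ (2 * k) * b \<le> \<epsilon> * b powr (real g / 2)"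
      using elim b by (simp add: divide_less_eq)
    also have "\<dots> \<le> \<epsilon> * b ^ (g - g div 2)" using \<epsilon> by (intro mult_left_mono p) simp
    finally have "real (2 * g + 2) * real (g + 1) ^ (2 * k) * b * b ^ (2 * (2 * g + 1) + 3 * (g + 1) + g div 2)
        \<le> \<epsilon> * b ^ (g - g div 2) * b ^ (2 * (2 * g + 1) + 3 * (g + 1) + g div 2)"
      using b by (intro mult_right_mono) auto
    also have "\<dots> = \<epsilon> * b ^ (8 * g + 5)"
    proof -
      have "g - g div 2 + (2 * (2 * g + 1) + 3 * (g + 1) + g div 2) = 8 * g + 5" by simp
      then show ?thesis by (metis mult.assoc power_add)
    qed
    also have "b ^ (8 * g + 5) = b * b ^ (4 * (2 * g + 1))"
    proof -
      have "8 * g + 5 = Suc (4 * (2 * g + 1))" by simp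
      then show ?thesis by (simp only: power_Suc)
    qed
    finally have "b * (real (2 * g + 2) * b ^ (2 * (2 * g + 1)) * (real (g + 1) ^ (2 * k) * b ^ (3 * (g + 1) + g div 2))) \<le> b * (\<epsilon> * b ^ (4 * (2 * g + 1)))"
      by (simp only: power_add mult_ac)
    then show ?case using b by simp
  qed
qed

theorem theorem2p1:
  fixes k :: nat
  assumes "odd CARD('a::{field,finite})"
    and "even k" and "k > 0"
  shows "\<exists>c>0. \<forall>\<^sub>F g in sequentially.
    Re (1 / of_nat (card (hyperelliptic_family (2 * g + 1) :: 'a poly set)) *
        (\<Sum>D\<in>(hyperelliptic_family (2 * g + 1) :: 'a poly set). L_quad (1 / 2) D ^ k))
      \<ge> c * real (2 * g + 1) ^ (k * (k + 1) div 2)"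
proof -
  define K where "K = k * (k + 1) div 2"
  \<comment> \<open>\<open>y = g div m\<close> and \<open>x = g div (6 * k)\<close> below are the lengths of the labels and of the short sum\<close>
  define m where "m = 6 * k * (k * (k + 1))"
  define b where "b = real CARD('a) powr (1 / 4)"
  have two: "(2 :: 'a) \<noteq> 0" by (rule two_nonzero[OF assms(1)])
  have q3: "CARD('a) \<ge> 3"
  proof -
    have "card {0, 1 :: 'a} \<le> CARD('a)" by (intro card_mono) auto
    then have "CARD('a) \<ge> 2" by simp
    moreover have "CARD('a) \<noteq> 2" using assms(1) by auto
    ultimately show ?thesis by linarith
  qed
  have b1: "b > 1" using q3 by (simp add: b_def)
  have b4: "b ^ 4 = real CARD('a)" by (simp add: b_def powr_power)
  have m0: "m > 0" using assms(3) by (simp add: m_def)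
  obtain c0 w where c0: "c0 > 0" and lower: "\<And>N x y. w < y \<Longrightarrow> k * (k + 1) * y \<le> x \<Longrightarrow>
    c0 * real (y - w) ^ K * real (card (hyperelliptic_family N :: 'a poly set)) \<le>
    (\<Sum>f\<in>(square_tuples k x :: (nat \<Rightarrow> 'a poly) set). tuple_term N k f)"
    using sum_square_tuples_lower[where 'a = 'a, OF q3 assms(3)] unfolding K_def by blast
  define c1 where "c1 = c0 * (1 / (4 * real m)) ^ K"
  define \<epsilon> where "\<epsilon> = min (c1 / 2) 1"
  \<comment> \<open>with this scaling the negative term of the tangent costs half of the positive one\<close>
  define lam where "lam = c1 / 4"
  define c where "c = lam ^ (k - 1) * (real k * c1 / 2)"
  have c1: "c1 > 0" using c0 m0 by (simp add: c1_def)
  have \<epsilon>: "\<epsilon> > 0" "\<epsilon> \<le> c1 / 2" "\<epsilon> \<le> 1" using c1 by (simp_all add: \<epsilon>_def)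
  have lam: "lam > 0" using c1 by (simp add: lam_def)
  have c: "c > 0" using lam c1 assms(3) by (simp add: c_def)
  have "\<forall>\<^sub>F g in sequentially. g \<ge> 2 * m * (w + 2)" by (rule eventually_ge_at_top)
  moreover have "\<forall>\<^sub>F g in sequentially. real (2 * g + 2) * b ^ (2 * (2 * g + 1)) * (real (g + 1) ^ (2 * k) * b ^ (3 * (g + 1) + g div 2))
    \<le> \<epsilon> / 2 * b ^ (4 * (2 * g + 1))"
    using \<epsilon>(1) by (intro error_negligible b1) simp
  ultimately have "\<forall>\<^sub>F g in sequentially.
    Re (1 / of_nat (card (hyperelliptic_family (2 * g + 1) :: 'a poly set)) *
        (\<Sum>D\<in>(hyperelliptic_family (2 * g + 1) :: 'a poly set). L_quad (1 / 2) D ^ k))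
      \<ge> c * real (2 * g + 1) ^ K"
  proof eventually_elim
    case (elim g)
    define N where "N = 2 * g + 1"
    let ?H = "hyperelliptic_family N :: 'a poly set"
    define h where "h = real (card ?H)"
    define X where "X = real N ^ K"
    define x where "x = g div (6 * k)"
    define y where "y = g div m"
    define Err where "Err = real (N + 1) * b ^ (2 * N) * (real (g + 1) ^ (2 * k) * b ^ (3 * (g + 1) + g div 2))"
    have h: "h > 0" "real CARD('a) ^ N \<le> 2 * h"
    proof -
      show le: "real CARD('a) ^ N \<le> 2 * h" unfolding h_def by (rule card_family_lower[OF q3])
      have "real CARD('a) ^ N > 0" by simp
      then show "h > 0" using le by linarith
    qed
    have X1: "X \<ge> 1" by (simp add: X_def N_def)
    have Err: "Err \<le> \<epsilon> * X * h"
    proof -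
      have "Err \<le> \<epsilon> / 2 * b ^ (4 * N)" using elim(2) by (simp add: Err_def N_def)
      also have "b ^ (4 * N) = real CARD('a) ^ N" by (simp add: power_mult b4)
      also have "\<epsilon> / 2 * real CARD('a) ^ N \<le> \<epsilon> / 2 * (2 * h)" using h(2) \<epsilon>(1) by (intro mult_left_mono) auto
      also have "\<dots> = \<epsilon> * 1 * h" by simp
      also have "\<dots> \<le> \<epsilon> * X * h" using X1 \<epsilon>(1) h(1) by (intro mult_right_mono mult_left_mono) auto
      finally show ?thesis .
    qed
    have xg: "x \<le> g" by (simp add: x_def)
    have x6: "6 * k * x \<le> g" by (simp add: x_def)
    \<comment> \<open>the lengths of the \<open>k - 1\<close> short factors add up to at most \<open>g / 6\<close>\<close>
    have xk: "3 * ((k - 1) * x) \<le> g div 2"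
    proof -
      have "(k - 1) * x \<le> k * x" by simp
      moreover have "6 * (k * x) \<le> g" using x6 by (simp add: mult.assoc)
      ultimately show ?thesis by linarith
    qed
    have mixed_err: "real (N + 1) * b ^ (2 * N) * (real z ^ 2 * b ^ (3 * z) * (real x ^ 2 * b ^ (3 * x)) ^ (k - 1)) \<le> Err"
      if z: "z \<le> g + 1" for z
    proof -
      have "real z ^ 2 * b ^ (3 * z) * (real x ^ 2 * b ^ (3 * x)) ^ (k - 1) =
          (real z ^ 2 * real x ^ (2 * (k - 1))) * (b ^ (3 * z) * b ^ (3 * ((k - 1) * x)))"
        by (simp add: power_mult_distrib power_mult[symmetric] mult_ac)
      also have "\<dots> \<le> (real (g + 1) ^ 2 * real (g + 1) ^ (2 * (k - 1))) * (b ^ (3 * (g + 1)) * b ^ (g div 2))"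
        using b1 z xg xk by (intro mult_mono power_mono power_increasing) auto
      also have "\<dots> = real (g + 1) ^ (2 * k) * b ^ (3 * (g + 1) + g div 2)"
      proof -
        have "2 + 2 * (k - 1) = 2 * k" using assms(3) by simp
        then show ?thesis by (simp only: power_add[symmetric])
      qed
      finally show ?thesis unfolding Err_def using b1 by (intro mult_left_mono) auto
    qed
    have S2: "(\<Sum>D\<in>?H. short_L x D ^ k) \<le> 2 * X * h"
    proof -
      have kk: "k = Suc (k - 1)" using assms(3) by simp
      have "(\<Sum>D\<in>?H. short_L x D ^ k) \<le> h * real x ^ K + real (N + 1) * b ^ (2 * N) * (\<Prod>i<k. real x ^ 2 * b ^ (3 * x))"
        unfolding h_def K_def using b1 by (intro moment_upper two b4) simp
      also have "(\<Prod>i<k. real x ^ 2 * b ^ (3 * x)) = real x ^ 2 * b ^ (3 * x) * (real x ^ 2 * b ^ (3 * x)) ^ (k - 1)"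
        by (subst kk) simp
      also have "real (N + 1) * b ^ (2 * N) * (real x ^ 2 * b ^ (3 * x) * (real x ^ 2 * b ^ (3 * x)) ^ (k - 1)) \<le> Err"
        using xg by (intro mixed_err) simp
      also have "h * real x ^ K \<le> h * X"
        unfolding X_def using xg h(1) by (intro mult_left_mono power_mono) (auto simp: N_def)
      also note Err
      also have "h * X + \<epsilon> * X * h \<le> h * X + 1 * X * h"
        using \<epsilon>(3) X1 h(1) by (intro add_left_mono mult_right_mono) auto
      finally show ?thesis by simp
    qed
    have yw: "real (y - w) \<ge> real N / (4 * real m)" "w < y"
    proof -
      have g: "real g \<ge> 2 * real m * (real w + 2)"
        using of_nat_mono[OF elim(1), where 'a = real] by (simp add: distrib_left)
      have "g < m * (y + 1)"
        using dividend_less_times_div[OF m0, of g] by (simp add: y_def)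
      then have "real g < real (m * (y + 1))" by (simp only: of_nat_less_iff)
      then have "real g < real m * (real y + 1)" by (simp add: distrib_left)
      define r where "r = real g / real m"
      have y1: "r < real y + 1"
        using \<open>real g < real m * (real y + 1)\<close> m0 by (simp add: r_def divide_less_eq mult.commute)
      have "2 * (real w + 2) \<le> r" using g m0 by (simp add: r_def le_divide_eq mult_ac)
      then have "r / 2 + 1 \<le> r - 1 - real w" by argo
      then have y2: "r / 2 + 1 \<le> real y - real w" using y1 by argo
      have "r \<ge> 0" by (simp add: r_def)
      have "real N / (4 * real m) = r / 2 + 1 / (4 * real m)"
        using m0 by (simp add: r_def N_def field_simps)
      also have "1 / (4 * real m) \<le> 1" using m0 by (simp add: divide_le_eq)
      finally have "real N / (4 * real m) \<le> real y - real w" using y2 by linarith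
      moreover have "real y > real w" using y2 \<open>r \<ge> 0\<close> by linarith
      then show "w < y" by simp
      ultimately show "real (y - w) \<ge> real N / (4 * real m)" by (simp add: of_nat_diff)
    qed
    have diag_low: "c1 * X * h \<le> (\<Sum>f\<in>(square_tuples k x :: (nat \<Rightarrow> 'a poly) set). tuple_term N k f)"
    proof -
      have "y = x div (k * (k + 1))" by (simp only: y_def x_def m_def div_mult2_eq)
      then have "k * (k + 1) * y \<le> x" by simp
      note lower[OF yw(2) this, of N]
      moreover have "c1 * X \<le> c0 * real (y - w) ^ K"
      proof -
        have "c1 * X = c0 * (real N / (4 * real m)) ^ K" by (simp add: c1_def X_def power_divide)
        also have "\<dots> \<le> c0 * real (y - w) ^ K" using yw(1) c0 by (intro mult_left_mono power_mono) auto
        finally show ?thesis .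
      qed
      then have "c1 * X * h \<le> c0 * real (y - w) ^ K * h" using h(1) by (intro mult_right_mono) auto
      ultimately show ?thesis unfolding h_def by linarith
    qed
    have S1: "(\<Sum>D\<in>?H. short_L z D * short_L x D ^ (k - 1)) \<ge> c1 / 2 * X * h" if z: "x \<le> z" "z \<le> g + 1" for z
    proof -
      have "(\<Sum>D\<in>?H. short_L z D * short_L x D ^ (k - 1)) \<ge> c1 * X * h - Err"
        using mixed_moment_lower[OF two less_imp_le[OF b1] b4 assms(3) z(1), of N] mixed_err[OF z(2)] diag_low by linarith
      moreover have "\<epsilon> * X * h \<le> c1 / 2 * X * h"
        using \<epsilon>(2) X1 h(1) by (intro mult_right_mono) auto
      ultimately show ?thesis using Err by (simp add: field_simps)
    qed
    define L where "L D = short_L (g + 1) D + short_L g D" for D :: "'a poly"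
    have L: "L_quad (1 / 2) D = of_real (L D)" if "D \<in> ?H" for D
      using that unfolding L_def by (intro L_quad_half two) (auto simp: hyperelliptic_family_def N_def)
    have SL: "(\<Sum>D\<in>?H. L D * short_L x D ^ (k - 1)) \<ge> c1 * X * h"
      using S1[of "g + 1"] S1[of g] xg by (simp add: L_def distrib_right sum.distrib)
    have "(\<Sum>D\<in>?H. L D ^ k) \<ge> (\<Sum>D\<in>?H. real k * L D * (lam * short_L x D) ^ (k - 1) - (real k - 1) * (lam * short_L x D) ^ k)"
      by (intro sum_mono even_power_tangent assms)
    also have "(\<Sum>D\<in>?H. real k * L D * (lam * short_L x D) ^ (k - 1) - (real k - 1) * (lam * short_L x D) ^ k) =
        real k * lam ^ (k - 1) * (\<Sum>D\<in>?H. L D * short_L x D ^ (k - 1)) - (real k - 1) * lam ^ k * (\<Sum>D\<in>?H. short_L x D ^ k)"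
      by (simp add: sum_subtractf sum_distrib_left power_mult_distrib mult_ac)
    finally have t: "real k * lam ^ (k - 1) * (\<Sum>D\<in>?H. L D * short_L x D ^ (k - 1)) - (real k - 1) * lam ^ k * (\<Sum>D\<in>?H. short_L x D ^ k)
        \<le> (\<Sum>D\<in>?H. L D ^ k)" .
    have "real k * lam ^ (k - 1) * (c1 * X * h) \<le> real k * lam ^ (k - 1) * (\<Sum>D\<in>?H. L D * short_L x D ^ (k - 1))"
      using lam by (intro mult_left_mono SL) simp
    then have t1: "2 * (c * X * h) \<le> real k * lam ^ (k - 1) * (\<Sum>D\<in>?H. L D * short_L x D ^ (k - 1))"
      by (simp add: c_def mult_ac)
    have "(real k - 1) * lam ^ k * (\<Sum>D\<in>?H. short_L x D ^ k) \<le> (real k - 1) * lam ^ k * (2 * X * h)"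
      using lam assms(3) by (intro mult_left_mono S2) simp
    also have "\<dots> \<le> real k * lam ^ k * (2 * X * h)"
      using lam X1 h(1) by (intro mult_right_mono) auto
    also have "\<dots> = c * X * h"
    proof -
      have "lam ^ k = lam ^ (k - 1) * (c1 / 4)" using assms(3) by (cases k) (auto simp: lam_def)
      then show ?thesis by (simp add: c_def)
    qed
    finally have t2: "(real k - 1) * lam ^ k * (\<Sum>D\<in>?H. short_L x D ^ k) \<le> c * X * h" .
    have main: "c * X * h \<le> (\<Sum>D\<in>?H. L D ^ k)"
      using t t1 t2 by linarith
    have "(\<Sum>D\<in>?H. L_quad (1 / 2) D ^ k) = of_real (\<Sum>D\<in>?H. L D ^ k)"
      unfolding of_real_sum by (intro sum.cong refl) (simp add: L)
    then have "Re (1 / of_nat (card ?H) * (\<Sum>D\<in>?H. L_quad (1 / 2) D ^ k)) = (\<Sum>D\<in>?H. L D ^ k) / h"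
      by (simp add: h_def)
    moreover have "c * X \<le> (\<Sum>D\<in>?H. L D ^ k) / h" using main h(1) by (simp add: le_divide_eq)
    ultimately show ?case by (simp only: X_def N_def)
  qed
  then show ?thesis using c unfolding K_def by blast
qed

end
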